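(* Let $N\ge1$ be an integer, $p_c=\frac{2N}{N+1}<p<2$ and $p-1<q<\frac p2$. There is a non-empty closed subset $\mathcal B$ of $(0,\infty)$ such that, for any $a\in\mathcal B$, the solution $f(\cdot;a)$ to $$(|f'|^{p-2}f')'(r)+\frac{N-1}{r}(|f'|^{p-2}f')(r)+\alpha f(r)+\beta r f'(r)-|f'(r)|^q=0,\qquad r>0,$$ with initial conditions $f(0;a)=a$ and $f'(0;a)=0$ is positive on $(0,\infty)$ and satisfies, for some $A>0$ (depending on $a$), $$f(r;a)= r^{-\mu}\left(K^*-Ar^{-\theta}+o(r^{-\theta})\right)\quad\text{as } r\to\infty,\qquad \theta:=\frac{N(p-1)-q(N-1)}{p-1}.$$ In addition, $\mathcal B=\{a^*\}$ when $N=1$, where $a^*$ is the unique element of $(0,\infty)$ such that (for $N=1$) the solution of the equation $$(|f'|^{p-2}f')'(r)+\alpha f(r)+\beta r f'(r)-|f'(r)|^q=0,\qquad r>0,$$ with $f(0)=a^*$, $f'(0)=0$ is positive on $(0,\infty)$ and satisfies $f(r)\sim K^*r^{-\mu}$ as $r\to\infty$.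
   Context: Constants: $\alpha=\frac{p-q}{p-2q}>0$, $\beta=\frac{q-p+1}{p-2q}>0$, $\mu=\frac{p-q}{q-p+1}=\frac{\alpha}{\beta}>N$, $K^*=\frac1\mu\left[(p-1)(\mu+1)-N+1\right]^{1/(q-p+1)}>0$. A solution of the differential equation with $f(0)=a$, $f'(0)=0$ is understood as a function $f\in C^1$ with $|f'|^{p-2}f'\in C^1$; equivalently, with $F:=-|f'|^{p-2}f'$, the pair $(f,F)$ is the unique maximal $C^1$ solution of $f'=-|F|^{(2-p)/(p-1)}F$, $F'+\frac{N-1}{r}F=\alpha f-\beta r|F|^{(2-p)/(p-1)}F-|F|^{q/(p-1)}$, $f(0)=a$, $F(0)=0$. The existence and uniqueness of $a^*$ for $N=1$ is a separate theorem of the same work. The notation $g_1(r)\sim g_2(r)$ means $g_1(r)/g_2(r)\to1$. *)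

theory Defs
  imports "HOL-Analysis.Analysis" "HOL-Library.Landau_Symbols"
begin

definition p_crit :: "nat \<Rightarrow> real" where
  "p_crit N = 2 * real N / (real N + 1)"

definition alpha :: "real \<Rightarrow> real \<Rightarrow> real" where
  "alpha p q = (p - q) / (p - 2 * q)"

definition beta :: "real \<Rightarrow> real \<Rightarrow> real" where
  "beta p q = (q - p + 1) / (p - 2 * q)"

definition mu :: "real \<Rightarrow> real \<Rightarrow> real" where
  "mu p q = (p - q) / (q - p + 1)"

definition theta :: "nat \<Rightarrow> real \<Rightarrow> real \<Rightarrow> real" where
  "theta N p q = (real N * (p - 1) - q * (real N - 1)) / (p - 1)"

definition K_star :: "nat \<Rightarrow> real \<Rightarrow> real \<Rightarrow> real" where
  "K_star N p q =
     (1 / mu p q) * ((p - 1) * (mu p q + 1) - real N + 1) powr (1 / (q - p + 1))"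

text \<open>\<open>f\<close> is of class \<open>C\<^sup>1\<close> on \<open>S\<close> with derivative \<open>f'\<close>. The derivative is taken within \<open>S\<close>,
  hence one-sided at an end point belonging to \<open>S\<close>; values of \<open>f\<close> outside \<open>S\<close> are irrelevant.\<close>

definition C1_with_deriv :: "(real \<Rightarrow> real) \<Rightarrow> (real \<Rightarrow> real) \<Rightarrow> real set \<Rightarrow> bool" where
  "C1_with_deriv f f' S \<longleftrightarrow>
     (\<forall>r\<in>S. (f has_real_derivative f' r) (at r within S)) \<and> continuous_on S f'"

text \<open>In \<open>p_flux\<close> the exponent \<open>p - 2\<close> is negative; at \<open>x = 0\<close> the value is \<open>0\<close>, as it should be.\<close>

definition p_flux :: "real \<Rightarrow> real \<Rightarrow> real" where
  "p_flux p x = \<bar>x\<bar> powr (p - 2) * x"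

definition init_interval :: "ereal \<Rightarrow> real set" where
  "init_interval R = {r. 0 \<le> r \<and> ereal r < R}"

text \<open>\<open>f\<close> solves the initial value problem on \<open>[0,R)\<close>, where \<open>R = \<infinity>\<close> is allowed; \<open>f'\<close> is the
  derivative of \<open>f\<close> and \<open>\<Phi>'\<close> the derivative of \<open>\<bar>f'\<bar>\<^sup>p\<^sup>-\<^sup>2 f'\<close>.\<close>

definition solution_on ::
  "nat \<Rightarrow> real \<Rightarrow> real \<Rightarrow> real \<Rightarrow> ereal \<Rightarrow> (real \<Rightarrow> real) \<Rightarrow> bool" where
  "solution_on N p q a R f \<longleftrightarrow>
     0 < R \<and>
     (\<exists>f' \<Phi>'.
        C1_with_deriv f f' (init_interval R) \<and>
        C1_with_deriv (\<lambda>r. p_flux p (f' r)) \<Phi>' (init_interval R) \<and>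
        f 0 = a \<and> f' 0 = 0 \<and>
        (\<forall>r. 0 < r \<and> ereal r < R \<longrightarrow>
           \<Phi>' r + (real N - 1) / r * p_flux p (f' r)
             + alpha p q * f r + beta p q * r * f' r - \<bar>f' r\<bar> powr q = 0))"

text \<open>\<open>f\<close> on \<open>[0,R)\<close> is the unique maximal solution \<open>f(\<cdot>;a)\<close>: every solution of the same initial
  value problem is a restriction of it. Values of \<open>f\<close> outside \<open>[0,R)\<close> are irrelevant.\<close>

definition maximal_solution ::
  "nat \<Rightarrow> real \<Rightarrow> real \<Rightarrow> real \<Rightarrow> ereal \<Rightarrow> (real \<Rightarrow> real) \<Rightarrow> bool" where
  "maximal_solution N p q a R f \<longleftrightarrow>
     solution_on N p q a R f \<and>
     (\<forall>S g. solution_on N p q a S g \<longrightarrow> S \<le> R \<and> (\<forall>r\<in>init_interval S. g r = f r))"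

text \<open>The property characterising \<open>a\<^sup>*\<close>; it is used for \<open>N = 1\<close>, where the term with factor
  \<open>(N - 1) / r\<close> of the equation disappears.\<close>

definition has_K_star_decay :: "nat \<Rightarrow> real \<Rightarrow> real \<Rightarrow> real \<Rightarrow> bool" where
  "has_K_star_decay N p q a \<longleftrightarrow>
     (\<exists>f. maximal_solution N p q a \<infinity> f \<and> (\<forall>r>0. 0 < f r) \<and>
          asymp_equiv f at_top (\<lambda>r. K_star N p q * r powr (- mu p q)))"

end

(* With F = |f'|^(p-1), m = 1/(p-1), k = q/(p-1), d = N-1, the equation for decreasing f reads
   f' = -F^m, F' = D - F^k - d F/r with D = alpha f + beta r f'. Besides D, follow
   Y = r F^(k-1) = r |f'|^(q-p+1). Both derivatives are governed by the same quantity
   J = r D + F (kappa - Y): D' = -beta m F^(m-1) J and Y' = (k-1) F^(k-2) J. The explicit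
   singular solution K* r^(-mu) is the point D = 0, Y = kappa.

   Every solution starts in the region D > 0, Y < kappa. It may leave it through D = 0, into
   D < 0, Y < kappa, or through Y = kappa, into D > 0, Y > kappa; both of these are forward
   invariant and both exits are open conditions on a. Large a gives the first exit, small a
   the second one, so by connectedness some a gives neither; B is the singleton of such an a.
   A trapped solution has Y increasing to kappa, and a Riccati argument for
   (r D/F)/(kappa - Y) yields kappa - Y ~ A r^(-theta), hence the expansion of f.

   For N = 1, f ~ K* r^(-mu) forces the solution to be trapped. Given two of them with
   a1 < a2, the scaling l^mu f2(l r) with l < 1 brings the second one to the central value a1 and puts
   a factor c > 1 in front of D. Viewed as functions of f, the scaled flux stays above F1, and
   the difference is eventually nondecreasing as f decreases to 0, although both tend to 0. *)

theory Submission
  imports Defs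
begin

section \<open>Calculus on the half line\<close>

text \<open>The flux F is the unknown rather than f' because both nonlinearities are C1 functions of
  F, even at F = 0, while the original operator has the negative exponent p - 2. Shooting therefore
  runs on one family of globally defined truncated solutions, with a truncation height fixed for the
  whole range of central values; before an exit the truncation is not felt.

  The corner D = 0, Y = kappa would spoil the dichotomy of exits. It is never reached: J is linear
  in D and kappa - Y, so these two solve a linear homogeneous system along the solution.

  The bound q < p/2 enters three times: it makes r^2 F^(m-1) decay in the Riccati argument, it lets
  D lose only o(a) when a is small, and it gives c > 1 in the comparison. The bound p > p_c lets the
  flux of a solution with large a grow by a positive power of a, which forces the exit through D =
  0; with q < p/2 it also gives kappa > 0.\<close>

lemma first_zero:
  fixes g :: "real \<Rightarrow> real"
  assumes "a \<le> b" "continuous_on {a..b} g" "0 < g a" "g b \<le> 0"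
  obtains c where "a < c" "c \<le> b" "g c = 0" "\<And>s. a \<le> s \<Longrightarrow> s < c \<Longrightarrow> 0 < g s"
proof -
  define S where "S = {s \<in> {a..b}. g s \<le> 0}"
  have "closed S"
    unfolding S_def
    using continuous_closed_preimage[OF assms(2) closed_atLeastAtMost, of "{..0}"]
    by (simp add: vimage_def Int_def)
  moreover have ne: "S \<noteq> {}" "bdd_below S"
    using assms by (auto simp: S_def intro!: bdd_belowI[of _ a])
  ultimately have "Inf S \<in> S" using closed_contains_Inf by blast
  then have c: "a \<le> Inf S" "Inf S \<le> b" "g (Inf S) \<le> 0" by (auto simp: S_def)
  have lt: "0 < g s" if "a \<le> s" "s < Inf S" for s
  proof (rule ccontr)
    assume "\<not> 0 < g s"
    then have "s \<in> S" using that c by (auto simp: S_def)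
    then show False using cInf_lower[OF _ ne(2)] that by force
  qed
  have "a \<noteq> Inf S" using c assms(3) by auto
  then have "a < Inf S" using c by auto
  have "g (Inf S) = 0"
  proof (rule ccontr)
    assume "g (Inf S) \<noteq> 0"
    then have neg: "g (Inf S) < 0" using c by auto
    have "\<exists>x\<ge>a. x \<le> Inf S \<and> g x = 0"
      using IVT2'[of g "Inf S" 0 a] c assms neg continuous_on_subset[OF assms(2)] by force
    then obtain x where "a \<le> x" "x \<le> Inf S" "g x = 0" by auto
    with neg lt[of x] show False by (cases "x = Inf S") auto
  qed
  then show thesis using that \<open>a < Inf S\<close> c lt by blast
qed

lemma deriv_at_first_zero_nonpos:
  fixes g :: "real \<Rightarrow> real"
  assumes "(g has_real_derivative l) (at c)" "a < c" "g c = 0" "\<And>s. a < s \<Longrightarrow> s < c \<Longrightarrow> 0 < g s"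
  shows "l \<le> 0"
proof (rule ccontr)
  assume "\<not> l \<le> 0"
  then obtain e where "0 < e" and e: "\<And>h. 0 < h \<Longrightarrow> h < e \<Longrightarrow> g (c - h) < g c"
    using DERIV_pos_inc_left[OF assms(1)] by auto
  define h where "h = min (e/2) ((c - a)/2)"
  have "0 < h" "h < e" "a < c - h"
    using \<open>0 < e\<close> assms(2) by (auto simp: h_def min_def field_simps)
  then show False using e[of h] assms(3) assms(4)[of "c - h"] by auto
qed

lemma converges_of_nonincreasing:
  fixes g :: "real \<Rightarrow> real"
  assumes "\<And>x y. a \<le> x \<Longrightarrow> x \<le> y \<Longrightarrow> g y \<le> g x" "\<And>x. a \<le> x \<Longrightarrow> c \<le> g x"
  shows "\<exists>l. (g \<longlongrightarrow> l) at_top \<and> (\<forall>x\<ge>a. l \<le> g x)"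
proof -
  define l where "l = Inf (g ` {a..})"
  have bd: "bdd_below (g ` {a..})" using assms(2) by (auto intro!: bdd_belowI)
  have le: "l \<le> g x" if "a \<le> x" for x
    unfolding l_def using that by (intro cInf_lower bd) auto
  have "(g \<longlongrightarrow> l) at_top"
  proof (rule tendstoI)
    fix e :: real assume "0 < e"
    then obtain x where x: "a \<le> x" "g x < l + e"
      using cInf_lessD[of "g ` {a..}" "l + e"] by (auto simp: l_def)
    show "\<forall>\<^sub>F y in at_top. dist (g y) l < e"
      using eventually_ge_at_top[of x]
    proof eventually_elim
      case (elim y)
      then have "g y \<le> g x" "l \<le> g y" using assms(1) x le by auto
      then show ?case using x by (simp add: dist_real_def)
    qed
  qed
  with le show ?thesis by blast
qed

lemma tendsto_powr_neg_at_top: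
  fixes c :: real assumes "0 < c"
  shows "((\<lambda>x::real. x powr (-c)) \<longlongrightarrow> 0) at_top"
  using assms by (intro tendsto_neg_powr filterlim_ident) auto

text \<open>Adding \<open>C/c * x powr (-c)\<close> makes \<open>g\<close> nonincreasing,
  subtracting it makes \<open>g\<close> nondecreasing; the second function stays below the first and
  thus bounds it from below. This replaces integrability of \<open>g'\<close> at infinity.\<close>

lemma converges_of_deriv_bound:
  fixes g :: "real \<Rightarrow> real"
  assumes "0 < a" "0 < c"
    and d: "\<And>x. a \<le> x \<Longrightarrow> (g has_real_derivative g' x) (at x)"
    and b: "\<And>x. a \<le> x \<Longrightarrow> \<bar>g' x\<bar> \<le> C * x powr (-c-1)"
  shows "\<exists>l. (g \<longlongrightarrow> l) at_top"
proof -
  define h where "h x = g x + C/c * x powr (-c)" for x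
  define j where "j x = g x - C/c * x powr (-c)" for x
  have dp: "((\<lambda>x. C/c * x powr (-c)) has_real_derivative (- C * x powr (-c-1))) (at x)" if "a \<le> x" for x
    using that assms(1,2) by (auto intro!: derivative_eq_intros simp: field_simps)
  have dec: "h y \<le> h x" if "a \<le> x" "x \<le> y" for x y
  proof (rule DERIV_nonpos_imp_nonincreasing[OF that(2)])
    fix z assume "x \<le> z" "z \<le> y"
    then have z: "a \<le> z" using that by auto
    have "(h has_real_derivative (g' z + - C * z powr (-c-1))) (at z)"
      unfolding h_def by (intro DERIV_add d dp z)
    moreover have "g' z + - C * z powr (-c-1) \<le> 0" using b[OF z] by auto
    ultimately show "\<exists>y. (h has_real_derivative y) (at z) \<and> y \<le> 0" by blast
  qed
  have inc: "j x \<le> j y" if "a \<le> x" "x \<le> y" for x y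
  proof (rule DERIV_nonneg_imp_nondecreasing[OF that(2)])
    fix z assume "x \<le> z" "z \<le> y"
    then have z: "a \<le> z" using that by auto
    have "(j has_real_derivative (g' z - (- C * z powr (-c-1)))) (at z)"
      unfolding j_def by (intro DERIV_diff d dp z)
    moreover have "g' z - (- C * z powr (-c-1)) \<ge> 0" using b[OF z] by auto
    ultimately show "\<exists>y. (j has_real_derivative y) (at z) \<and> 0 \<le> y" by blast
  qed
  have C: "0 \<le> C * a powr (-c-1)" using b[of a] by auto
  then have "0 \<le> C" using assms(1) by (simp add: zero_le_mult_iff)
  then have "j x \<le> h x" for x
    using assms(2) by (simp add: j_def h_def)
  then have "j a \<le> h x" if "a \<le> x" for x using inc[of a x] that by (meson order.refl order_trans)
  then obtain l where l: "(h \<longlongrightarrow> l) at_top"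
    using converges_of_nonincreasing[of a h "j a"] dec by blast
  have "((\<lambda>x. h x - C/c * x powr (-c)) \<longlongrightarrow> l - C/c * 0) at_top"
    by (intro tendsto_intros l tendsto_powr_neg_at_top assms)
  then show ?thesis by (auto simp: h_def)
qed

text \<open>The difference \<open>g - h\<close> is nondecreasing and tends to 0, hence is never
  positive: the inequality between derivatives is integrated from infinity.\<close>

lemma tail_le_of_deriv_le:
  fixes g h :: "real \<Rightarrow> real"
  assumes "\<And>x. a \<le> x \<Longrightarrow> (g has_real_derivative g' x) (at x)"
    and "\<And>x. a \<le> x \<Longrightarrow> (h has_real_derivative h' x) (at x)"
    and "\<And>x. a \<le> x \<Longrightarrow> h' x \<le> g' x"
    and "(g \<longlongrightarrow> 0) at_top" "(h \<longlongrightarrow> 0) at_top"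
  shows "\<forall>x\<ge>a. g x \<le> h x"
proof (intro allI impI)
  fix x assume x: "a \<le> x"
  have inc: "(g x - h x) \<le> (g y - h y)" if "x \<le> y" for y
  proof (rule DERIV_nonneg_imp_nondecreasing[OF that])
    fix z assume "x \<le> z"
    then have "a \<le> z" using x by auto
    then show "\<exists>w. ((\<lambda>x. g x - h x) has_real_derivative w) (at z) \<and> 0 \<le> w"
      using DERIV_diff[OF assms(1)[OF \<open>a \<le> z\<close>] assms(2)[OF \<open>a \<le> z\<close>]] assms(3)[OF \<open>a \<le> z\<close>]
      by (metis diff_ge_0_iff_ge)
  qed
  have "((\<lambda>y. g y - h y) \<longlongrightarrow> 0 - 0) at_top"
    by (intro tendsto_intros assms)
  moreover have "\<forall>\<^sub>F y in at_top. g x - h x \<le> g y - h y"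
    using eventually_ge_at_top[of x] by eventually_elim (use inc in auto)
  ultimately have "g x - h x \<le> 0 - 0"
    by (intro tendsto_lowerbound) auto
  then show "g x \<le> h x" by simp
qed

text \<open>Since \<open>h' < 0\<close>, a bound on \<open>g' / h'\<close> puts \<open>g'\<close>
  between two multiples of \<open>h'\<close>; integrating from infinity puts \<open>g\<close>
  between the same multiples of \<open>h\<close>.\<close>

lemma lhospital_0_0_at_top:
  fixes g h :: "real \<Rightarrow> real"
  assumes g: "\<And>x. a \<le> x \<Longrightarrow> (g has_real_derivative g' x) (at x)"
    and h: "\<And>x. a \<le> x \<Longrightarrow> (h has_real_derivative h' x) (at x)"
    and neg: "\<And>x. a \<le> x \<Longrightarrow> h' x < 0" and pos: "\<And>x. a \<le> x \<Longrightarrow> 0 < h x"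
    and lim: "(g \<longlongrightarrow> 0) at_top" "(h \<longlongrightarrow> 0) at_top"
    and q: "((\<lambda>x. g' x / h' x) \<longlongrightarrow> l) at_top"
  shows "((\<lambda>x. g x / h x) \<longlongrightarrow> l) at_top"
proof (rule tendstoI)
  fix e :: real assume "0 < e"
  then have "\<forall>\<^sub>F x in at_top. dist (g' x / h' x) l < e/2"
    by (intro tendstoD[OF q]) simp
  then obtain b0 where b0: "\<And>x. b0 \<le> x \<Longrightarrow> dist (g' x / h' x) l < e/2"
    unfolding eventually_at_top_linorder by blast
  define b where "b = max a b0"
  have b: "a \<le> x" "l - e/2 < g' x / h' x" "g' x / h' x < l + e/2" if "b \<le> x" for x
    using b0[of x] that unfolding b_def dist_real_def abs_less_iff by linarith+
  have 1: "\<forall>x\<ge>b. g x \<le> (l + e/2) * h x"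
  proof (rule tail_le_of_deriv_le)
    fix x assume x: "b \<le> x"
    show "(g has_real_derivative g' x) (at x)" using g b x by auto
    show "((\<lambda>x. (l + e/2) * h x) has_real_derivative (l + e/2) * h' x) (at x)"
      using h[of x] b x by (auto intro!: derivative_eq_intros)
    show "(l + e/2) * h' x \<le> g' x"
      using b(3)[OF x] neg[OF b(1)[OF x]] by (simp only: neg_divide_less_eq less_imp_le)
  qed (rule lim(1), rule tendsto_mult_right_zero[OF lim(2)])
  have 2: "\<forall>x\<ge>b. (l - e/2) * h x \<le> g x"
  proof (rule tail_le_of_deriv_le)
    fix x assume x: "b \<le> x"
    show "(g has_real_derivative g' x) (at x)" using g b x by auto
    show "((\<lambda>x. (l - e/2) * h x) has_real_derivative (l - e/2) * h' x) (at x)"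
      using h[of x] b x by (auto intro!: derivative_eq_intros)
    show "g' x \<le> (l - e/2) * h' x"
      using b(2)[OF x] neg[OF b(1)[OF x]] by (simp only: neg_less_divide_eq less_imp_le)
  qed (rule tendsto_mult_right_zero[OF lim(2)], rule lim(1))
  show "\<forall>\<^sub>F x in at_top. dist (g x / h x) l < e"
    using eventually_ge_at_top[of b]
  proof eventually_elim
    case (elim x)
    have "0 < h x" using pos b(1) elim by blast
    moreover have "g x \<le> (l + e/2) * h x" "(l - e/2) * h x \<le> g x" using 1 2 elim by blast+
    ultimately have "l - e/2 \<le> g x / h x" "g x / h x \<le> l + e/2"
      by (simp_all only: pos_divide_le_eq pos_le_divide_eq)
    then show ?case using \<open>0 < e\<close> unfolding dist_real_def abs_less_iff by linarith
  qed
qed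

lemma pos_beyond:
  fixes g :: "real \<Rightarrow> real"
  assumes "continuous_on {0..<T} g" "0 \<le> r" "r < T" "0 < g r"
  shows "\<exists>b. r < b \<and> b < T \<and> (\<forall>s\<in>{r..b}. 0 < g s)"
proof -
  obtain \<delta> where \<delta>: "0 < \<delta>" "\<forall>s\<in>{0..<T}. dist s r < \<delta> \<longrightarrow> dist (g s) (g r) < g r"
    using assms unfolding continuous_on_iff by (metis atLeastLessThan_iff)
  define b where "b = min (r + \<delta>/2) ((r + T)/2)"
  have b: "r < b" "b < T" "b < r + \<delta>"
    using \<delta>(1) assms(3) by (auto simp: b_def min_def field_simps)
  have "0 < g s" if "s \<in> {r..b}" for s
  proof -
    have "dist (g s) (g r) < g r" using \<delta>(2) that b assms(2) by (auto simp: dist_real_def)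
    then show ?thesis unfolding dist_real_def by linarith
  qed
  then show ?thesis using b by blast
qed

lemma powr_div_tendsto_0:
  fixes c e :: real assumes "0 < c" "0 < e"
  shows "((\<lambda>R. (c / R) powr e) \<longlongrightarrow> 0) at_top"
proof (rule tendsto_zero_powrI[OF _ tendsto_const])
  show "((\<lambda>R. c / R) \<longlongrightarrow> 0) at_top"
    by (intro tendsto_divide_0[OF tendsto_const] filterlim_at_top_imp_at_infinity filterlim_ident)
  show "\<forall>\<^sub>F R in at_top. 0 \<le> c / R"
    using eventually_gt_at_top[of 0] by (rule eventually_mono) (use assms in auto)
qed (use assms in auto)

text \<open>For fixed \<open>r\<close> the condition on \<open>G\<close> is open in
  \<open>a\<close>, and the tube lemma handles the compact segment \<open>{0..r}\<close>. Both exit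
  conditions of the shooting argument have this shape.\<close>

lemma open_uniformly_positive:
  fixes G H :: "real \<times> real \<Rightarrow> real"
  assumes "continuous_on UNIV G" "continuous_on UNIV H"
  shows "open {a. \<exists>r>0. 0 < G (a, r) \<and> (\<forall>s\<in>{0..r}. 0 < H (a, s))}"
proof (subst open_subopen, intro ballI)
  fix a0 assume "a0 \<in> {a. \<exists>r>0. 0 < G (a, r) \<and> (\<forall>s\<in>{0..r}. 0 < H (a, s))}"
  then obtain r where r: "0 < r" "0 < G (a0, r)" "\<forall>s\<in>{0..r}. 0 < H (a0, s)" by blast
  have "open {p. 0 < H p}" by (intro open_Collect_less continuous_intros assms)
  then obtain X where X: "a0 \<in> X" "open X" "X \<times> {0..r} \<subseteq> {p. 0 < H p}"
    using Elementary_Topology.tube_lemma[of "{0..r}" "{p. 0 < H p}" a0] r(3) by auto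
  have "open {a. 0 < G (a, r)}"
    by (intro open_Collect_less continuous_on_const continuous_on_compose2[OF assms(1)] continuous_intros) auto
  then show "\<exists>T. open T \<and> a0 \<in> T \<and> T \<subseteq> {a. \<exists>r>0. 0 < G (a, r) \<and> (\<forall>s\<in>{0..r}. 0 < H (a, s))}"
    using X r by (intro exI[of _ "X \<inter> {a. 0 < G (a, r)}"]) auto
qed

text \<open>Mean value theorem on \<open>{0..r}\<close>. It supplies the one-sided derivatives at
  the centre, where the equation is singular and only limits of derivatives are at hand.\<close>

lemma deriv_at_0_of_limit:
  fixes g g' :: "real \<Rightarrow> real"
  assumes cont: "continuous_on {0..} g" and d: "\<And>r. 0 < r \<Longrightarrow> (g has_real_derivative g' r) (at r)"
    and lim: "(g' \<longlongrightarrow> l) (at_right 0)"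
  shows "(g has_real_derivative l) (at 0 within {0..})"
proof -
  have "((\<lambda>r. (g r - g 0) / (r - 0)) \<longlongrightarrow> l) (at_right 0)"
  proof (rule tendstoI)
    fix e :: real assume "0 < e"
    then have "\<forall>\<^sub>F r in at_right 0. dist (g' r) l < e" using lim tendstoD by blast
    then obtain b where b: "0 < b" "\<forall>r>0. r < b \<longrightarrow> dist (g' r) l < e"
      unfolding eventually_at_right_field by blast
    have "dist ((g r - g 0) / (r - 0)) l < e" if r: "0 < r" "r < b" for r
    proof -
      have "\<exists>z>0. z < r \<and> g r - g 0 = (r - 0) * g' z"
      proof -
        obtain l' z where z: "0 < z" "z < r" "DERIV g z :> l'" "g r - g 0 = (r - 0) * l'"
          using MVT[OF r(1), of g] continuous_on_subset[OF cont, of "{0..r}"] d real_differentiable_def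
          by (metis atLeastAtMost_iff atLeast_iff subsetI)
        then have "l' = g' z" using d[OF z(1)] DERIV_unique by blast
        then show ?thesis using z by blast
      qed
      then obtain z where z: "0 < z" "z < r" "g r - g 0 = (r - 0) * g' z" by blast
      have "(g r - g 0) / (r - 0) = g' z" unfolding z(3) using r by simp
      then show ?thesis using b(2) z r by simp
    qed
    then show "\<forall>\<^sub>F r in at_right 0. dist ((g r - g 0) / (r - 0)) l < e"
      unfolding eventually_at_right_field using b(1) by blast
  qed
  then show ?thesis by (simp add: has_field_derivative_iff at_within_Ici_at_right)
qed

section \<open>Signed powers and their truncation\<close>

definition spow :: "real \<Rightarrow> real \<Rightarrow> real" where
  "spow e x = \<bar>x\<bar> powr (e - 1) * x"

lemma spow_0 [simp]: "spow e 0 = 0" by (simp add: spow_def)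

lemma spow_pos: "0 < x \<Longrightarrow> spow e x = x powr e"
  by (simp add: spow_def powr_mult_base mult.commute)

lemma spow_minus: "spow e (- x) = - spow e x" by (simp add: spow_def)

lemma abs_spow: "\<bar>spow e x\<bar> = \<bar>x\<bar> powr e"
  by (cases "x = 0") (auto simp: spow_def abs_mult powr_mult_base mult.commute)

lemma spow_spow:
  assumes "x \<noteq> 0" shows "spow a (spow b x) = spow (a * b) x"
proof -
  have p: "spow a (spow b y) = spow (a * b) y" if "0 < y" for y
    using that by (simp add: spow_pos powr_powr mult.commute)
  show ?thesis
  proof (cases "0 < x")
    case False
    then have "0 < - x" using assms by auto
    then show ?thesis using p[of "- x"] unfolding spow_minus by simp
  qed (rule p)
qed

text \<open>With the exponents \<open>p - 1\<close> and \<open>m\<close> this inverts the flux: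
  \<open>F = - p_flux p f'\<close> becomes \<open>f' = - spow m F\<close>.\<close>

lemma spow_inverse: "a * b = 1 \<Longrightarrow> spow a (spow b x) = x"
  by (cases "x = 0") (auto simp: spow_spow, simp add: spow_def)

text \<open>At 0 the difference quotient is \<open>\<bar>h\<bar> powr (e - 1)\<close>, which tends
  to 0; negative arguments follow by oddness. That the derivative is bounded on bounded sets is the
  source of all Lipschitz bounds.\<close>

lemma DERIV_spow:
  assumes "1 < e"
  shows "(spow e has_real_derivative e * \<bar>x\<bar> powr (e - 1)) (at x)"
proof -
  have p: "(spow e has_real_derivative e * \<bar>x\<bar> powr (e - 1)) (at x)" if "0 < x" for x
  proof (rule has_field_derivative_transform_within_open[where S = "{0<..}"])
    show "((\<lambda>x. x powr e) has_real_derivative e * \<bar>x\<bar> powr (e - 1)) (at x)"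
      using that by (auto intro!: derivative_eq_intros)
  qed (use that in \<open>auto simp: spow_pos\<close>)
  consider "0 < x" | "x = 0" | "x < 0" by linarith
  then show ?thesis
  proof cases
    case 1 then show ?thesis by (rule p)
  next
    case 2
    have "((\<lambda>h. \<bar>h\<bar> powr (e - 1)) \<longlongrightarrow> 0) (at (0::real))"
      by (rule tendsto_zero_powrI[OF tendsto_rabs_zero[OF tendsto_ident_at] tendsto_const])
        (use assms in simp_all)
    moreover have "\<forall>\<^sub>F h in at 0. \<bar>h\<bar> powr (e - 1) = (spow e (0 + h) - spow e 0) / h"
      unfolding eventually_at_filter by (rule always_eventually) (simp add: spow_def)
    ultimately have "((\<lambda>h. (spow e (0 + h) - spow e 0) / h) \<longlongrightarrow> 0) (at 0)"
      by (rule Lim_transform_eventually)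
    then show ?thesis unfolding DERIV_def 2 using assms by simp
  next
    case 3
    have "((\<lambda>x. - spow e (- x)) has_real_derivative - (e * \<bar>- x\<bar> powr (e - 1) * -1)) (at x)"
      by (rule DERIV_minus, rule DERIV_chain2[OF p]) (use 3 in \<open>auto intro!: derivative_eq_intros\<close>)
    then show ?thesis by (simp add: spow_minus)
  qed
qed

lemma continuous_on_spow: "1 < e \<Longrightarrow> continuous_on S (spow e)"
  by (meson DERIV_isCont DERIV_spow continuous_at_imp_continuous_on)

lemma spow_lipschitz:
  assumes "1 < e" "\<bar>x\<bar> \<le> M" "\<bar>y\<bar> \<le> M"
  shows "\<bar>spow e x - spow e y\<bar> \<le> e * M powr (e - 1) * \<bar>x - y\<bar>"
proof -
  have "norm (spow e x - spow e y) \<le> e * M powr (e - 1) * norm (x - y)"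
  proof (rule field_differentiable_bound[where S = "{-M..M}"])
    show "(spow e has_real_derivative e * \<bar>z\<bar> powr (e - 1)) (at z within {-M..M})" for z
      using DERIV_spow[OF assms(1)] by (rule has_field_derivative_at_within)
    show "norm (e * \<bar>z\<bar> powr (e - 1)) \<le> e * M powr (e - 1)" if "z \<in> {-M..M}" for z
      using that assms(1) by (auto simp: abs_mult abs_le_iff intro!: powr_mono2)
  qed (use assms in \<open>auto simp: abs_le_iff\<close>)
  then show ?thesis by simp
qed

definition trunc_at :: "real \<Rightarrow> real \<Rightarrow> real" where
  "trunc_at M x = max (- M) (min M x)"

lemma trunc_at_eq: "\<bar>x\<bar> \<le> M \<Longrightarrow> trunc_at M x = x" by (auto simp: trunc_at_def)
lemma trunc_at_bound: "0 \<le> M \<Longrightarrow> \<bar>trunc_at M x\<bar> \<le> M" by (auto simp: trunc_at_def)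
lemma trunc_at_lipschitz: "\<bar>trunc_at M x - trunc_at M y\<bar> \<le> \<bar>x - y\<bar>" by (auto simp: trunc_at_def)

lemma spow_trunc_at_lipschitz:
  assumes "1 < e" "0 \<le> M"
  shows "\<bar>spow e (trunc_at M x) - spow e (trunc_at M y)\<bar> \<le> e * M powr (e - 1) * \<bar>x - y\<bar>"
proof -
  have "\<bar>spow e (trunc_at M x) - spow e (trunc_at M y)\<bar>
      \<le> e * M powr (e - 1) * \<bar>trunc_at M x - trunc_at M y\<bar>"
    by (intro spow_lipschitz assms trunc_at_bound)
  also have "\<dots> \<le> e * M powr (e - 1) * \<bar>x - y\<bar>"
    using assms by (intro mult_left_mono trunc_at_lipschitz) auto
  finally show ?thesis .
qed

section \<open>Existence for globally Lipschitz nonlinearities\<close>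

text \<open>The nonlinearities are parameters because the same estimates serve the original pair and
  the truncated one; \<open>d\<close> stands for \<open>N - 1\<close>. At 0 only continuity is
  recorded, so the singular term never has to be evaluated there.\<close>

definition ivp ::
  "nat \<Rightarrow> real \<Rightarrow> real \<Rightarrow> (real \<Rightarrow> real) \<Rightarrow> (real \<Rightarrow> real) \<Rightarrow> real \<Rightarrow> real \<Rightarrow>
   (real \<Rightarrow> real) \<Rightarrow> (real \<Rightarrow> real) \<Rightarrow> bool" where
  "ivp d \<alpha> \<beta> \<phi> \<psi> a T f F \<longleftrightarrow>
     continuous_on {0..<T} f \<and> continuous_on {0..<T} F \<and> f 0 = a \<and> F 0 = 0 \<and>
     (\<forall>r. 0 < r \<and> r < T \<longrightarrow>
        (f has_real_derivative - \<phi> (F r)) (at r) \<and>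
        (F has_real_derivative \<alpha> * f r - \<beta> * r * \<phi> (F r) - \<psi> (F r) - d / r * F r) (at r))"

lemma abs_integral_le:
  fixes f g :: "real \<Rightarrow> real"
  assumes "f integrable_on S" "g integrable_on S" "\<And>x. x \<in> S \<Longrightarrow> \<bar>f x\<bar> \<le> g x"
  shows "\<bar>integral S f\<bar> \<le> integral S g"
  using integral_norm_bound_integral[of f S g] assms by simp

text \<open>The quadratic exponent matches the coefficient \<open>\<beta> * r\<close> of the
  equation: the Lipschitz constant grows like \<open>1 + s\<close>, and
  \<open>(1 + 2 * s) * exp (L * (s + s\<^sup>2))\<close> is the derivative of the weight over
  \<open>L\<close>.\<close>

lemma integral_exp_weight_le:
  fixes L :: real
  assumes "0 < L" "0 \<le> r"
  shows "integral {0..r} (\<lambda>s. (1 + s) * exp (L * (s + s\<^sup>2))) \<le> exp (L * (r + r\<^sup>2)) / L"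
proof -
  let ?w = "\<lambda>s. exp (L * (s + s\<^sup>2))"
  have "((\<lambda>s. (1 + 2 * s) * ?w s) has_integral ?w r / L - ?w 0 / L) {0..r}"
    by (rule fundamental_theorem_of_calculus)
      (use assms in \<open>auto intro!: derivative_eq_intros
        simp: has_real_derivative_iff_has_vector_derivative[symmetric] field_simps\<close>)
  then have "integral {0..r} (\<lambda>s. (1 + s) * ?w s) \<le> ?w r / L - ?w 0 / L"
    by (intro has_integral_le[OF integrable_integral])
      (auto intro!: integrable_continuous_real continuous_intros mult_right_mono)
  also have "\<dots> \<le> ?w r / L" using assms by auto
  finally show ?thesis .
qed

lemma fundamental_theorem_at:
  fixes g :: "real \<Rightarrow> real"
  assumes "continuous_on {0..} g" "0 < r"
  shows "((\<lambda>x. integral {0..x} g) has_real_derivative g r) (at r)"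
proof -
  have "((\<lambda>x. integral {0..x} g) has_real_derivative g r) (at r within {0..r+1})"
    by (rule integral_has_real_derivative) (use assms in \<open>auto intro: continuous_on_subset\<close>)
  then show ?thesis using assms(2) by (simp add: at_within_Icc_at)
qed

lemma continuous_on_atLeast_0I:
  fixes g :: "real \<Rightarrow> real"
  assumes "\<And>b. continuous_on {0..b} g"
  shows "continuous_on {0..} g"
  unfolding continuous_on_eq_continuous_within
proof
  fix x :: real assume x: "x \<in> {0..}"
  have "continuous (at x within {0..x+1}) g"
    using assms[of "x + 1"] x by (simp add: continuous_on_eq_continuous_within)
  moreover have "at x within {0..} = at x within {0..x+1}"
    by (rule at_within_nhd[of x "{..<x+1}"]) auto
  ultimately show "continuous (at x within {0..}) g" by (simp add: continuous_within)
qed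

lemma continuous_on_integral_from_0:
  fixes g :: "real \<Rightarrow> real"
  assumes "continuous_on {0..} g"
  shows "continuous_on {0..} (\<lambda>x. integral {0..x} g)"
  by (intro continuous_on_atLeast_0I indefinite_integral_continuous_1)
    (use assms in \<open>auto intro!: integrable_continuous_real intro: continuous_on_subset\<close>)

text \<open>The unknown of the fixed-point problem is the flux divided by the weight \<open>w\<close>, which makes the
  integral operator a contraction on the whole half line.\<close>

locale volterra =
  fixes d :: nat and \<alpha> \<beta> a L\<^sub>0 :: real and \<phi> \<psi> :: "real \<Rightarrow> real"
  assumes nonneg: "0 \<le> \<alpha>" "0 \<le> \<beta>"
    and lip: "\<And>x y. \<bar>\<phi> x - \<phi> y\<bar> \<le> L\<^sub>0 * \<bar>x - y\<bar>" "\<And>x y. \<bar>\<psi> x - \<psi> y\<bar> \<le> L\<^sub>0 * \<bar>x - y\<bar>"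
    and zero: "\<phi> 0 = 0" "\<psi> 0 = 0"
begin

definition C where "C = (\<alpha> + \<beta> + 1) * L\<^sub>0"
text \<open>Chosen so that \<open>C / L\<close>, the contraction factor, is at most 1/2 and
  \<open>1 \<le> L\<close>.\<close>

definition L where "L = 2 * C + 1"
definition w where "w s = exp (L * (s + s\<^sup>2))"
definition v where "v (g :: real \<Rightarrow>\<^sub>C real) s = w s * apply_bcontfun g s"
definition I where "I g r = integral {0..r} (\<lambda>s. \<phi> (v g s))"
definition H where "H g s = \<alpha> * (a - I g s) - \<beta> * s * \<phi> (v g s) - \<psi> (v g s)"
definition G where "G g r = integral {0..r} (\<lambda>s. s ^ d * H g s)"
text \<open>The power \<open>r ^ d\<close> absorbs the singular term, as
  \<open>(r ^ d * F)' = r ^ d * H\<close>. Bounded continuous functions live on the whole line here,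
  hence the extension by 0 to negative \<open>r\<close>.\<close>

definition S where "S g r = (if r \<le> 0 then 0 else G g r / (r ^ d * w r))"

lemma L0: "0 \<le> L\<^sub>0"
  using lip(1)[of 1 0] abs_ge_zero[of "\<phi> 1 - \<phi> 0"] by simp

lemma C0: "0 \<le> C" and L1: "1 \<le> L"
  using L0 nonneg by (auto simp: C_def L_def)

lemma w_pos [simp]: "0 < w s" by (simp add: w_def)

lemma lipschitz_continuous:
  assumes "\<And>x y. \<bar>\<eta> x - \<eta> y\<bar> \<le> L\<^sub>0 * \<bar>x - y\<bar>"
  shows "continuous_on U (\<eta> :: real \<Rightarrow> real)"
proof (rule lipschitz_on_continuous_on)
  show "L\<^sub>0-lipschitz_on U \<eta>"
    using assms L0 by (auto intro!: lipschitz_onI simp: dist_real_def)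
qed

lemma continuous_\<phi>: "continuous_on U \<phi>" and continuous_\<psi>: "continuous_on U \<psi>"
  using lip by (auto intro: lipschitz_continuous)

lemma continuous_w: "continuous_on U w"
  unfolding w_def by (intro continuous_intros)

lemma continuous_v: "continuous_on U (v g)"
  unfolding v_def by (intro continuous_intros continuous_w continuous_on_apply_bcontfun)

lemma continuous_\<phi>v: "continuous_on U (\<lambda>s. \<phi> (v g s))"
  and continuous_\<psi>v: "continuous_on U (\<lambda>s. \<psi> (v g s))"
  using continuous_on_compose2[OF continuous_\<phi> continuous_v]
    continuous_on_compose2[OF continuous_\<psi> continuous_v] by blast+

lemma continuous_I: "continuous_on {0..} (I g)"
  unfolding I_def by (intro continuous_on_integral_from_0 continuous_\<phi>v)

lemma continuous_H: "continuous_on {0..} (H g)"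
  unfolding H_def by (intro continuous_intros continuous_I continuous_\<phi>v continuous_\<psi>v)

lemma continuous_H_Icc: "continuous_on {0..r} (H g)"
  by (rule continuous_on_subset[OF continuous_H]) auto

lemma continuous_G: "continuous_on {0..} (G g)"
  unfolding G_def by (intro continuous_on_integral_from_0 continuous_intros continuous_H)

lemma weight_integral_le:
  assumes "0 \<le> r" shows "integral {0..r} (\<lambda>s. (1 + s) * w s) \<le> w r / L"
  using integral_exp_weight_le[of L r] L1 assms by (simp add: w_def)

lemma abs_\<phi>_diff_le:
  "\<bar>\<phi> (v g s) - \<phi> (v h s)\<bar> \<le> L\<^sub>0 * (w s * dist g h)" "\<bar>\<psi> (v g s) - \<psi> (v h s)\<bar> \<le> L\<^sub>0 * (w s * dist g h)"
proof -
  have "\<bar>v g s - v h s\<bar> = w s * \<bar>apply_bcontfun g s - apply_bcontfun h s\<bar>"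
    by (simp add: v_def right_diff_distrib[symmetric] abs_mult less_imp_le[OF w_pos])
  also have "\<dots> \<le> w s * dist g h"
    using dist_bounded[of g s h] by (intro mult_left_mono) (auto simp: dist_real_def less_imp_le)
  finally have "L\<^sub>0 * \<bar>v g s - v h s\<bar> \<le> L\<^sub>0 * (w s * dist g h)"
    using L0 by (rule mult_left_mono)
  then show "\<bar>\<phi> (v g s) - \<phi> (v h s)\<bar> \<le> L\<^sub>0 * (w s * dist g h)"
    "\<bar>\<psi> (v g s) - \<psi> (v h s)\<bar> \<le> L\<^sub>0 * (w s * dist g h)"
    using lip(1)[of "v g s" "v h s"] lip(2)[of "v g s" "v h s"] by linarith+
qed

lemma abs_I_diff_le:
  assumes "0 \<le> r" shows "\<bar>I g r - I h r\<bar> \<le> L\<^sub>0 * (w r * dist g h)"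
proof -
  have int: "(\<lambda>s. \<phi> (v u s)) integrable_on {0..r}" for u
    by (intro integrable_continuous_real continuous_\<phi>v)
  have "\<bar>I g r - I h r\<bar> = \<bar>integral {0..r} (\<lambda>s. \<phi> (v g s) - \<phi> (v h s))\<bar>"
    unfolding I_def by (subst Henstock_Kurzweil_Integration.integral_diff[OF int int]) simp
  also have "\<dots> \<le> integral {0..r} (\<lambda>s. (L\<^sub>0 * dist g h) * ((1 + s) * w s))"
  proof (rule abs_integral_le)
    fix s assume s: "s \<in> {0..r}"
    have "w s * dist g h \<le> (1 + s) * (w s * dist g h)"
      using s mult_right_mono[of 1 "1 + s" "w s * dist g h"] by (auto simp: less_imp_le)
    then have "L\<^sub>0 * (w s * dist g h) \<le> L\<^sub>0 * ((1 + s) * (w s * dist g h))"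
      using L0 by (rule mult_left_mono)
    then show "\<bar>\<phi> (v g s) - \<phi> (v h s)\<bar> \<le> (L\<^sub>0 * dist g h) * ((1 + s) * w s)"
      using abs_\<phi>_diff_le(1)[of g s h] by (simp add: mult_ac)
  qed (auto intro!: integrable_continuous_real continuous_intros continuous_\<phi>v continuous_w)
  also have "\<dots> = (L\<^sub>0 * dist g h) * integral {0..r} (\<lambda>s. (1 + s) * w s)"
    by (rule integral_mult_right)
  also have "\<dots> \<le> (L\<^sub>0 * dist g h) * (w r / L)"
    using L0 assms by (intro mult_left_mono weight_integral_le) auto
  also have "\<dots> \<le> (L\<^sub>0 * dist g h) * w r"
    using L0 L1 by (intro mult_left_mono) (auto simp: divide_le_eq mult_left_le less_imp_le)
  finally show ?thesis by (simp add: mult_ac)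
qed

lemma abs_H_diff_le:
  assumes "0 \<le> s" shows "\<bar>H g s - H h s\<bar> \<le> (C * dist g h) * ((1 + s) * w s)"
proof -
  let ?e = "L\<^sub>0 * (w s * dist g h)"
  have e: "0 \<le> ?e" using L0 by (auto simp: less_imp_le)
  have "\<bar>\<alpha> * (I h s - I g s)\<bar> \<le> \<alpha> * ?e" "\<bar>\<beta> * s * (\<phi> (v h s) - \<phi> (v g s))\<bar> \<le> \<beta> * s * ?e"
    using nonneg assms abs_I_diff_le[of s h g] abs_\<phi>_diff_le(1)[of h s g]
    by (auto simp: abs_mult dist_commute mult.assoc intro!: mult_left_mono)
  moreover have "\<bar>\<psi> (v h s) - \<psi> (v g s)\<bar> \<le> ?e"
    using abs_\<phi>_diff_le(2)[of h s g] by (simp add: dist_commute)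
  moreover have "H g s - H h s = \<alpha> * (I h s - I g s) + \<beta> * s * (\<phi> (v h s) - \<phi> (v g s))
      + (\<psi> (v h s) - \<psi> (v g s))"
    by (simp add: H_def algebra_simps)
  ultimately have "\<bar>H g s - H h s\<bar> \<le> (\<alpha> + \<beta> * s + 1) * ?e"
    by (simp add: algebra_simps)
  also have "\<dots> \<le> ((\<alpha> + \<beta> + 1) * (1 + s)) * ?e"
    using nonneg assms e by (intro mult_right_mono) (auto simp: algebra_simps)
  finally show ?thesis by (simp add: C_def mult_ac)
qed

lemma abs_G_diff_le:
  assumes "0 \<le> r" shows "\<bar>G g r - G h r\<bar> \<le> r ^ d * w r * (dist g h / 2)"
proof -
  have int: "(\<lambda>s. s ^ d * H u s) integrable_on {0..r}" for u
    by (intro integrable_continuous_real continuous_intros continuous_on_subset[OF continuous_H]) auto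
  have "\<bar>G g r - G h r\<bar> = \<bar>integral {0..r} (\<lambda>s. s ^ d * H g s - s ^ d * H h s)\<bar>"
    unfolding G_def by (subst Henstock_Kurzweil_Integration.integral_diff[OF int int]) simp
  also have "\<dots> \<le> integral {0..r} (\<lambda>s. (r ^ d * (C * dist g h)) * ((1 + s) * w s))"
  proof (rule abs_integral_le)
    fix s assume s: "s \<in> {0..r}"
    have "\<bar>s ^ d * H g s - s ^ d * H h s\<bar> = s ^ d * \<bar>H g s - H h s\<bar>"
      using s by (simp add: right_diff_distrib[symmetric] abs_mult)
    also have "\<dots> \<le> r ^ d * ((C * dist g h) * ((1 + s) * w s))"
      using s by (intro mult_mono abs_H_diff_le power_mono) auto
    finally show "\<bar>s ^ d * H g s - s ^ d * H h s\<bar> \<le> (r ^ d * (C * dist g h)) * ((1 + s) * w s)"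
      by (simp add: mult_ac)
  next
    show "(\<lambda>s. s ^ d * H g s - s ^ d * H h s) integrable_on {0..r}"
      by (intro integrable_diff int)
    show "(\<lambda>s. (r ^ d * (C * dist g h)) * ((1 + s) * w s)) integrable_on {0..r}"
      by (intro integrable_continuous_real continuous_intros continuous_w)
  qed
  also have "\<dots> = (r ^ d * (C * dist g h)) * integral {0..r} (\<lambda>s. (1 + s) * w s)"
    by (rule integral_mult_right)
  also have "\<dots> \<le> (r ^ d * (C * dist g h)) * (w r / L)"
    using C0 assms by (intro mult_left_mono weight_integral_le) auto
  also have "\<dots> = (r ^ d * w r * dist g h) * (C / L)" by (simp only: times_divide_eq_right mult_ac)
  also have "\<dots> \<le> (r ^ d * w r * dist g h) * (1 / 2)"
    using C0 assms by (intro mult_left_mono) (auto simp: L_def less_imp_le divide_le_eq)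
  finally show ?thesis by simp
qed

lemma abs_S_diff_le: "\<bar>S g r - S h r\<bar> \<le> dist g h / 2"
proof (cases "r \<le> 0")
  case False
  then have "S g r - S h r = (G g r - G h r) / (r ^ d * w r)"
    by (simp add: S_def diff_divide_distrib)
  then show ?thesis using abs_G_diff_le[of r g h] False
    by (simp add: abs_mult abs_divide divide_le_eq mult_ac less_imp_le)
qed (simp add: S_def)

text \<open>For \<open>g = 0\<close> the function \<open>H\<close> is constant, and \<open>S\<close>
  is at most \<open>\<alpha> * \<bar>a\<bar> * r / w r\<close>. One bounded image together with the
  contraction estimate makes every image bounded.\<close>

lemma S_zero_bounded: "\<bar>S (const_bcontfun 0) r\<bar> \<le> \<alpha> * \<bar>a\<bar>"
proof (cases "r \<le> 0")
  case False
  let ?g = "const_bcontfun 0 :: real \<Rightarrow>\<^sub>C real"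
  have v: "v ?g s = 0" for s by (simp add: v_def const_bcontfun.rep_eq)
  have H: "H ?g s = \<alpha> * a" for s unfolding H_def I_def v zero by simp
  have "\<bar>G ?g r\<bar> \<le> integral {0..r} (\<lambda>s. r ^ d * (\<alpha> * \<bar>a\<bar>))"
    unfolding G_def H
  proof (rule abs_integral_le)
    fix s assume "s \<in> {0..r}"
    then show "\<bar>s ^ d * (\<alpha> * a)\<bar> \<le> r ^ d * (\<alpha> * \<bar>a\<bar>)"
      using nonneg by (auto simp: abs_mult intro!: mult_right_mono power_mono)
  qed (intro integrable_continuous_real continuous_intros)+
  also have "\<dots> = r ^ d * (\<alpha> * \<bar>a\<bar>) * r" using False by simp
  also have "\<dots> \<le> r ^ d * (\<alpha> * \<bar>a\<bar>) * w r"
  proof (rule mult_left_mono)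
    have "1 * r \<le> L * (r + r\<^sup>2)" using L1 False by (intro mult_mono) auto
    then show "r \<le> w r" unfolding w_def using exp_ge_add_one_self[of "L * (r + r\<^sup>2)"] by linarith
  qed (use nonneg False in auto)
  finally show ?thesis using False by (simp add: S_def divide_le_eq mult_ac abs_mult less_imp_le)
qed (use nonneg in \<open>auto simp: S_def\<close>)

lemma S_bounded: "bounded (range (S g))"
proof -
  have "\<bar>S g r\<bar> \<le> \<alpha> * \<bar>a\<bar> + dist g (const_bcontfun 0) / 2" for r
    using abs_S_diff_le[of g r "const_bcontfun 0"] S_zero_bounded[of r] by linarith
  then show ?thesis by (auto intro!: boundedI)
qed

text \<open>The integrand carries \<open>s ^ d\<close>, so dividing by \<open>r ^ d\<close> leaves a
  factor \<open>r\<close>: this makes \<open>S\<close> continuous at 0.\<close>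

lemma G_bound_near_0:
  obtains B where "0 \<le> B" "\<And>r. 0 \<le> r \<Longrightarrow> r \<le> 1 \<Longrightarrow> \<bar>G g r\<bar> \<le> B * r ^ d * r"
proof -
  have "compact ((\<lambda>s. \<bar>H g s\<bar>) ` {0..1})"
    by (intro compact_continuous_image continuous_intros continuous_on_subset[OF continuous_H]) auto
  then have "bdd_above ((\<lambda>s. \<bar>H g s\<bar>) ` {0..1})"
    by (intro bounded_imp_bdd_above compact_imp_bounded)
  then obtain B where "\<forall>x \<in> (\<lambda>s. \<bar>H g s\<bar>) ` {0..1}. x \<le> B"
    unfolding bdd_above_def by blast
  then have B: "\<bar>H g s\<bar> \<le> B" if "0 \<le> s" "s \<le> 1" for s using that by simp
  have "0 \<le> B" using B[of 0] by auto
  moreover have "\<bar>G g r\<bar> \<le> B * r ^ d * r" if "0 \<le> r" "r \<le> 1" for r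
  proof -
    have "\<bar>G g r\<bar> \<le> integral {0..r} (\<lambda>s. r ^ d * B)"
      unfolding G_def
    proof (rule abs_integral_le)
      fix s assume "s \<in> {0..r}"
      then show "\<bar>s ^ d * H g s\<bar> \<le> r ^ d * B"
        using that B[of s] by (auto simp: abs_mult intro!: mult_mono power_mono)
    qed (intro integrable_continuous_real continuous_intros continuous_H_Icc)+
    then show ?thesis using that by (simp add: mult_ac)
  qed
  ultimately show ?thesis using that by blast
qed

lemma continuous_S: "continuous_on UNIV (S g)"
proof (rule continuous_at_imp_continuous_on, rule ballI)
  fix x :: real
  consider "x < 0" | "x = 0" | "0 < x" by linarith
  then show "isCont (S g) x"
  proof cases
    case 1
    then have "\<forall>\<^sub>F y in nhds x. S g y = 0"
      using eventually_nhds_in_open[of "{..<0}" x] by (auto elim!: eventually_mono simp: S_def)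
    then show ?thesis using isCont_cong[of "S g" "\<lambda>_. 0" x] by simp
  next
    case 2
    obtain B where B: "0 \<le> B" "\<And>r. 0 \<le> r \<Longrightarrow> r \<le> 1 \<Longrightarrow> \<bar>G g r\<bar> \<le> B * r ^ d * r"
      using G_bound_near_0 by blast
    have le: "norm (S g r) \<le> B * \<bar>r\<bar>" if "\<bar>r\<bar> < 1" for r
    proof (cases "r \<le> 0")
      case False
      have "\<bar>G g r\<bar> \<le> B * r ^ d * r * w r"
      proof -
        have "1 \<le> w r" using L1 False by (simp add: w_def)
        then have "B * r ^ d * r * 1 \<le> B * r ^ d * r * w r"
          using B(1) False by (intro mult_left_mono) auto
        then show ?thesis using B(2)[of r] that False by auto
      qed
      then show ?thesis using False
        by (simp add: S_def abs_mult divide_le_eq mult_ac less_imp_le)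
    next
      case True
      have "0 \<le> B * \<bar>r\<bar>" using B(1) by (rule mult_nonneg_nonneg) simp
      then show ?thesis using True by (simp add: S_def)
    qed
    have "\<forall>\<^sub>F r in at 0. \<bar>r\<bar> < (1::real)"
      using eventually_at_ball[of 1 "0::real" UNIV] by (auto elim!: eventually_mono)
    then have "\<forall>\<^sub>F r in at 0. norm (S g r) \<le> B * \<bar>r\<bar>"
      by eventually_elim (rule le)
    moreover have "((\<lambda>r. B * \<bar>r\<bar>) \<longlongrightarrow> 0) (at (0::real))"
      by (auto intro!: tendsto_eq_intros)
    ultimately have "(S g \<longlongrightarrow> 0) (at 0)" by (rule Lim_null_comparison)
    then show ?thesis using 2 by (simp add: isCont_def S_def)
  next
    case 3
    have "continuous_on {0<..} (\<lambda>r. G g r / (r ^ d * w r))"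
      by (intro continuous_intros continuous_w continuous_on_subset[OF continuous_G])
        (auto simp: less_imp_neq[OF w_pos, symmetric])
    then have "isCont (\<lambda>r. G g r / (r ^ d * w r)) x"
      using 3 by (simp add: continuous_on_eq_continuous_at)
    moreover have "\<forall>\<^sub>F y in nhds x. S g y = G g y / (y ^ d * w y)"
      using eventually_nhds_in_open[of "{0<..}" x] 3 by (auto elim!: eventually_mono simp: S_def)
    ultimately show ?thesis using isCont_cong by fast
  qed
qed

lemma ex_solution: "\<exists>f F. \<forall>T. ivp d \<alpha> \<beta> \<phi> \<psi> a T f F"
proof -
  \<comment> \<open>\<open>S g\<close> is continuous and bounded, so \<open>Bcontfun\<close> loses
    nothing and \<open>U\<close> is a contraction of a complete space.\<close>
  define U where "U g = Bcontfun (S g)" for g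
  have U: "apply_bcontfun (U g) = S g" for g
    unfolding U_def by (rule Bcontfun_inverse) (simp add: bcontfun_def continuous_S S_bounded)
  have "\<exists>!g. U g = g"
  proof (rule banach_fix_type[of "1/2"])
    show "\<forall>g h. dist (U g) (U h) \<le> 1/2 * dist g h"
      using abs_S_diff_le by (intro allI dist_bound) (simp add: U dist_real_def)
  qed auto
  then obtain g where g: "apply_bcontfun g = S g" using U by metis
  \<comment> \<open>Multiplied by the weight again, the fixed point is the flux itself.\<close>
  have v: "v g r = (if r \<le> 0 then 0 else G g r / r ^ d)" for r
    by (simp add: v_def g S_def less_imp_neq[OF w_pos, symmetric])
  have I': "(I g has_real_derivative \<phi> (v g r)) (at r)" if "0 < r" for r
    unfolding I_def by (rule fundamental_theorem_at[OF continuous_\<phi>v that])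
  have G': "(G g has_real_derivative r ^ d * H g r) (at r)" if "0 < r" for r
    unfolding G_def by (rule fundamental_theorem_at) (use that in \<open>auto intro!: continuous_intros continuous_H\<close>)
  have v': "(v g has_real_derivative H g r - d / r * v g r) (at r)" if "0 < r" for r
  proof (rule has_field_derivative_transform_within_open[where S = "{0<..}"])
    have "((\<lambda>r. G g r / r ^ d) has_real_derivative
       (r ^ d * H g r * r ^ d - G g r * (d * r ^ (d - 1))) / (r ^ d * r ^ d)) (at r)"
      using that by (auto intro!: derivative_eq_intros G')
    moreover have "(r ^ d * H g r * r ^ d - G g r * (d * r ^ (d - 1))) / (r ^ d * r ^ d)
       = H g r - d / r * v g r"
      using that by (cases d) (auto simp: v field_simps)
    ultimately show "((\<lambda>r. G g r / r ^ d) has_real_derivative H g r - d / r * v g r) (at r)"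
      by simp
  qed (use that in \<open>auto simp: v\<close>)
  have "ivp d \<alpha> \<beta> \<phi> \<psi> a T (\<lambda>r. a - I g r) (v g)" for T
    unfolding ivp_def
  proof (intro conjI allI impI)
    show "continuous_on {0..<T} (\<lambda>r. a - I g r)"
      by (intro continuous_intros continuous_on_subset[OF continuous_I]) auto
    show "continuous_on {0..<T} (v g)" by (rule continuous_v)
    show "a - I g 0 = a" by (simp add: I_def)
    show "v g 0 = 0" by (simp add: v)
    fix r assume r: "0 < r \<and> r < T"
    show "((\<lambda>r. a - I g r) has_real_derivative - \<phi> (v g r)) (at r)"
      using I'[of r] r by (auto intro!: derivative_eq_intros)
    show "(v g has_real_derivative
        \<alpha> * (a - I g r) - \<beta> * r * \<phi> (v g r) - \<psi> (v g r) - d / r * v g r) (at r)"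
      using v'[of r] r by (simp add: H_def)
  qed
  then show ?thesis by blast
qed

end

section \<open>Comparison and uniqueness\<close>

text \<open>Gronwall for the squared distance. The singular term contributes
  \<open>- 2 * d / s * (F - G)\<^sup>2\<close>, which has the good sign. The Lipschitz bounds are
  asked only along the two solutions, so that local ones suffice. Equal central values give
  uniqueness, different ones continuous dependence.\<close>

lemma ivp_difference:
  assumes 1: "ivp d \<alpha> \<beta> \<phi> \<psi> a T f F" and 2: "ivp d \<alpha> \<beta> \<phi> \<psi> b T g G"
    and nonneg: "0 \<le> \<alpha>" "0 \<le> \<beta>" "0 \<le> L"
    and lip: "\<And>r. 0 < r \<Longrightarrow> r < T \<Longrightarrow> \<bar>\<phi> (F r) - \<phi> (G r)\<bar> \<le> L * \<bar>F r - G r\<bar>"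
      "\<And>r. 0 < r \<Longrightarrow> r < T \<Longrightarrow> \<bar>\<psi> (F r) - \<psi> (G r)\<bar> \<le> L * \<bar>F r - G r\<bar>"
    and r: "0 \<le> r" "r < T"
  shows "(f r - g r)\<^sup>2 + (F r - G r)\<^sup>2 \<le> (a - b)\<^sup>2 * exp ((3 * L + \<alpha> + 2 * \<beta> * T * L) * r)"
proof -
  define C where "C = 3 * L + \<alpha> + 2 * \<beta> * T * L"
  let ?h = "\<lambda>s. ((f s - g s)\<^sup>2 + (F s - G s)\<^sup>2) * exp (- C * s)"
  have "?h r \<le> ?h 0"
  proof (rule DERIV_nonpos_imp_decreasing_open[OF r(1)])
    fix s assume s: "0 < s" "s < r"
    define x y P Q where "x = f s - g s" and "y = F s - G s"
      and "P = \<phi> (F s) - \<phi> (G s)" and "Q = \<psi> (F s) - \<psi> (G s)"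
    have df: "(f has_real_derivative - \<phi> (F s)) (at s)" "(g has_real_derivative - \<phi> (G s)) (at s)"
      and dF: "(F has_real_derivative \<alpha> * f s - \<beta> * s * \<phi> (F s) - \<psi> (F s) - d / s * F s) (at s)"
         "(G has_real_derivative \<alpha> * g s - \<beta> * s * \<phi> (G s) - \<psi> (G s) - d / s * G s) (at s)"
      using 1 2 s r unfolding ivp_def by auto
    have dx: "((\<lambda>s. f s - g s) has_real_derivative - P) (at s)"
      using DERIV_diff[OF df] by (simp add: P_def algebra_simps)
    have dy: "((\<lambda>s. F s - G s) has_real_derivative \<alpha> * x - \<beta> * s * P - Q - d / s * y) (at s)"
      using DERIV_diff[OF dF] by (simp add: P_def Q_def x_def y_def algebra_simps)
    let ?N = "2 * x * (- P) + 2 * y * (\<alpha> * x - \<beta> * s * P - Q - d / s * y)"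
    have "((\<lambda>s. (f s - g s)\<^sup>2 + (F s - G s)\<^sup>2) has_real_derivative ?N) (at s)"
      by (rule DERIV_cong[OF DERIV_add[OF DERIV_power[OF dx, of 2] DERIV_power[OF dy, of 2]]])
        (simp only: x_def[symmetric] y_def[symmetric], simp)
    moreover have "((\<lambda>s. exp (- C * s)) has_real_derivative exp (- C * s) * - C) (at s)"
      by (auto intro!: derivative_eq_intros)
    ultimately have "(?h has_real_derivative
        ?N * exp (- C * s) + exp (- C * s) * - C * ((f s - g s)\<^sup>2 + (F s - G s)\<^sup>2)) (at s)"
      by (rule DERIV_mult)
    then have "(?h has_real_derivative
        ?N * exp (- C * s) + (x\<^sup>2 + y\<^sup>2) * (exp (- C * s) * - C)) (at s)"
      by (simp add: x_def y_def mult_ac)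
    \<comment> \<open>Each product is bounded by a multiple of \<open>x\<^sup>2 + y\<^sup>2\<close>:
      the term with \<open>x * P\<close> costs \<open>L\<close>, the one with
      \<open>\<alpha> * x * y\<close> costs \<open>\<alpha>\<close>, the one with
      \<open>y * Q\<close> costs \<open>2 * L\<close>, and the one with \<open>s * y * P\<close>
      costs \<open>2 * \<beta> * T * L\<close>.\<close>
    moreover have "?N \<le> C * (x\<^sup>2 + y\<^sup>2)"
    proof -
      have PQ: "\<bar>P\<bar> \<le> L * \<bar>y\<bar>" "\<bar>Q\<bar> \<le> L * \<bar>y\<bar>"
        using lip[of s] s r by (auto simp: P_def Q_def y_def)
      have xy: "2 * (\<bar>x\<bar> * \<bar>y\<bar>) \<le> x\<^sup>2 + y\<^sup>2"
        using zero_le_power2[of "\<bar>x\<bar> - \<bar>y\<bar>"] by (simp add: power2_diff)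
      have yP: "\<bar>y * P\<bar> \<le> L * y\<^sup>2" "\<bar>y * Q\<bar> \<le> L * y\<^sup>2"
        using mult_left_mono[OF PQ(1), of "\<bar>y\<bar>"] mult_left_mono[OF PQ(2), of "\<bar>y\<bar>"]
        by (auto simp: abs_mult power2_eq_square algebra_simps)
      have "2 * x * (- P) \<le> 2 * (\<bar>x\<bar> * \<bar>P\<bar>)"
        using abs_ge_self[of "2 * x * (- P)"] by (simp add: abs_mult)
      also have "\<dots> \<le> 2 * (\<bar>x\<bar> * (L * \<bar>y\<bar>))" using PQ by (intro mult_left_mono) auto
      also have "\<dots> \<le> L * (x\<^sup>2 + y\<^sup>2)" using mult_left_mono[OF xy nonneg(3)] by (simp add: algebra_simps)
      finally have t1: "2 * x * (- P) \<le> L * (x\<^sup>2 + y\<^sup>2)" .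
      have "2 * (x * y) \<le> x\<^sup>2 + y\<^sup>2" using xy abs_ge_self[of "x * y"] by (simp add: abs_mult)
      then have t2: "2 * y * (\<alpha> * x) \<le> \<alpha> * (x\<^sup>2 + y\<^sup>2)"
        using mult_left_mono[OF _ nonneg(1)] by (fastforce simp: algebra_simps)
      have "- (\<beta> * s) * (y * P) \<le> (\<beta> * s) * (L * y\<^sup>2)"
        using mult_left_mono[OF order_trans[OF abs_ge_minus_self yP(1)], of "\<beta> * s"] nonneg s by simp
      also have "\<dots> \<le> (\<beta> * T) * (L * y\<^sup>2)"
        using nonneg s r by (intro mult_right_mono mult_left_mono) auto
      finally have t3: "- (\<beta> * s) * (y * P) \<le> \<beta> * T * L * y\<^sup>2" by (simp add: mult_ac)
      have t4: "- (y * Q) \<le> L * y\<^sup>2" using yP(2) by linarith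
      have t5: "0 \<le> d / s * y\<^sup>2" using s by simp
      have t6: "0 \<le> \<beta> * T * L * x\<^sup>2" "0 \<le> L * x\<^sup>2" using nonneg s r by auto
      have "?N = 2 * x * (- P) + 2 * y * (\<alpha> * x) + 2 * (- (\<beta> * s) * (y * P))
          + 2 * (- (y * Q)) - 2 * (d / s * y\<^sup>2)"
        by (simp add: algebra_simps power2_eq_square)
      also have "\<dots> \<le> L * (x\<^sup>2 + y\<^sup>2) + \<alpha> * (x\<^sup>2 + y\<^sup>2) + 2 * (\<beta> * T * L * y\<^sup>2) + 2 * (L * y\<^sup>2)
          + 2 * (\<beta> * T * L * x\<^sup>2) + 2 * (L * x\<^sup>2)"
        using t1 t2 t3 t4 t5 t6 by linarith
      also have "\<dots> = C * (x\<^sup>2 + y\<^sup>2)" by (simp add: C_def algebra_simps)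
      finally show ?thesis .
    qed
    then have "(?N - C * (x\<^sup>2 + y\<^sup>2)) * exp (- C * s) \<le> 0"
      by (intro mult_nonpos_nonneg) auto
    ultimately show "\<exists>z. (?h has_real_derivative z) (at s) \<and> z \<le> 0"
      by (intro exI[of _ "?N * exp (- C * s) + (x\<^sup>2 + y\<^sup>2) * (exp (- C * s) * - C)"] conjI)
        (simp_all add: algebra_simps)
  next
    have sub: "{0..r} \<subseteq> {0..<T}" using r by auto
    have "continuous_on {0..r} f" "continuous_on {0..r} g" "continuous_on {0..r} F" "continuous_on {0..r} G"
      using 1 2 continuous_on_subset[OF _ sub] unfolding ivp_def by blast+
    then show "continuous_on {0..r} ?h" by (intro continuous_intros)
  qed
  also have "?h 0 = (a - b)\<^sup>2" using 1 2 by (simp add: ivp_def)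
  finally have "?h r * exp (C * r) \<le> (a - b)\<^sup>2 * exp (C * r)" by (rule mult_right_mono) simp
  then show ?thesis unfolding C_def[symmetric] by (simp add: mult.assoc exp_add[symmetric])
qed

lemma ivp_unique:
  assumes "ivp d \<alpha> \<beta> \<phi> \<psi> a T f F" "ivp d \<alpha> \<beta> \<phi> \<psi> a T g G"
    and "0 \<le> \<alpha>" "0 \<le> \<beta>" "0 \<le> L"
    and "\<And>r. 0 < r \<Longrightarrow> r < T \<Longrightarrow> \<bar>\<phi> (F r) - \<phi> (G r)\<bar> \<le> L * \<bar>F r - G r\<bar>"
      "\<And>r. 0 < r \<Longrightarrow> r < T \<Longrightarrow> \<bar>\<psi> (F r) - \<psi> (G r)\<bar> \<le> L * \<bar>F r - G r\<bar>"
    and "0 \<le> r" "r < T"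
  shows "f r = g r \<and> F r = G r"
  using ivp_difference[OF assms] by (simp add: sum_power2_le_zero_iff)

lemma ivp_restrict: "ivp d \<alpha> \<beta> \<phi> \<psi> a T f F \<Longrightarrow> S \<le> T \<Longrightarrow> ivp d \<alpha> \<beta> \<phi> \<psi> a S f F"
  unfolding ivp_def by (auto elim!: continuous_on_subset)

lemma ivp_flux_deriv:
  assumes "ivp d \<alpha> \<beta> \<phi> \<psi> a T f F" "0 < r" "r < T"
  shows "((\<lambda>r. r ^ d * F r) has_real_derivative r ^ d * (\<alpha> * f r - \<beta> * r * \<phi> (F r) - \<psi> (F r))) (at r)"
proof -
  have "((\<lambda>r. r ^ d * F r) has_real_derivative (d * r ^ (d - 1)) * F r +
     r ^ d * (\<alpha> * f r - \<beta> * r * \<phi> (F r) - \<psi> (F r) - d / r * F r)) (at r)"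
    using assms unfolding ivp_def by (auto intro!: derivative_eq_intros)
  moreover have "real d * r ^ (d - 1) = d / r * r ^ d"
    using assms by (cases d) auto
  ultimately show ?thesis by (simp add: algebra_simps)
qed

text \<open>\<open>r ^ d * F\<close> has derivative \<open>r ^ d * H\<close> with \<open>H\<close>
  tending to \<open>\<alpha> * a\<close>; comparing with \<open>c * r ^ (d + 1) / (d + 1)\<close>
  for \<open>c\<close> slightly below and above \<open>\<alpha> * a\<close> gives the slope of the
  flux at the centre.\<close>

lemma ivp_flux_asymp:
  assumes ivp: "ivp d \<alpha> \<beta> \<phi> \<psi> a T f F" and "0 < T"
    and cont: "continuous_on UNIV \<phi>" "continuous_on UNIV \<psi>" and zero: "\<phi> 0 = 0" "\<psi> 0 = 0"
  shows "((\<lambda>r. F r / r) \<longlongrightarrow> \<alpha> * a / (real d + 1)) (at_right 0)"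
proof (rule tendstoI)
  fix e :: real assume e: "0 < e"
  define H where "H r = \<alpha> * f r - \<beta> * r * \<phi> (F r) - \<psi> (F r)" for r
  have cf: "continuous_on {0..<T} f" "continuous_on {0..<T} F" and ini: "f 0 = a" "F 0 = 0"
    using ivp by (auto simp: ivp_def)
  have "continuous_on {0..<T} H"
    unfolding H_def
    by (intro continuous_intros cf continuous_on_compose2[OF cont(1) cf(2)]
        continuous_on_compose2[OF cont(2) cf(2)]) auto
  then obtain \<delta> where \<delta>: "0 < \<delta>" "\<And>r. r \<in> {0..<T} \<Longrightarrow> dist r 0 < \<delta> \<Longrightarrow> dist (H r) (H 0) < e/2"
    using \<open>0 < T\<close> e unfolding continuous_on_iff by (metis atLeastLessThan_iff half_gt_zero order_refl)
  define q where "q = min \<delta> T"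
  have H0: "H 0 = \<alpha> * a" by (simp add: H_def ini zero)
  have q: "0 < q" "q \<le> T" using \<delta> \<open>0 < T\<close> by (auto simp: q_def)
  have near: "\<alpha> * a - e/2 \<le> H r" "H r \<le> \<alpha> * a + e/2" if "0 < r" "r < q" for r
    using \<delta>(2)[of r] that unfolding H0 dist_real_def q_def
    by (auto simp: abs_if split: if_splits)
  have bound: "\<bar>F r / r - \<alpha> * a / (real d + 1)\<bar> < e" if r: "0 < r" "r < q" for r
  proof -
    have dG: "((\<lambda>r. r ^ d * F r - c * r ^ (d + 1) / (real d + 1)) has_real_derivative s ^ d * (H s - c)) (at s)"
      if "0 < s" "s < r" for s c
    proof -
      have "((\<lambda>r. r ^ d * F r) has_real_derivative s ^ d * H s) (at s)"
        unfolding H_def by (rule ivp_flux_deriv[OF ivp]) (use that r q in auto)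
      moreover have "((\<lambda>r. c * r ^ (d + 1) / (real d + 1)) has_real_derivative c * s ^ d) (at s)"
      proof (rule DERIV_cong[OF DERIV_cdivide[OF DERIV_cmult[OF DERIV_pow]]])
        have "real d + 1 \<noteq> 0" by linarith
        then show "c * (real (d + 1) * s ^ (d + 1 - Suc 0)) / (real d + 1) = c * s ^ d"
          by (simp add: nonzero_divide_eq_eq algebra_simps)
      qed
      ultimately show ?thesis by (rule DERIV_cong[OF DERIV_diff]) (simp add: algebra_simps)
    qed
    have cG: "continuous_on {0..r} (\<lambda>r. r ^ d * F r - c * r ^ (d + 1) / (real d + 1))" for c
      by (intro continuous_intros continuous_on_subset[OF cf(2)]) (use r q in auto)
    have "0 ^ d * F 0 - (\<alpha> * a - e/2) * 0 ^ (d + 1) / (real d + 1)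
        \<le> r ^ d * F r - (\<alpha> * a - e/2) * r ^ (d + 1) / (real d + 1)"
      by (rule DERIV_nonneg_imp_increasing_open[OF _ _ cG])
        (use r dG[of _ "\<alpha> * a - e/2"] near in \<open>auto intro!: exI mult_nonneg_nonneg\<close>)
    moreover have "r ^ d * F r - (\<alpha> * a + e/2) * r ^ (d + 1) / (real d + 1)
        \<le> 0 ^ d * F 0 - (\<alpha> * a + e/2) * 0 ^ (d + 1) / (real d + 1)"
      by (rule DERIV_nonpos_imp_decreasing_open[OF _ _ cG])
        (use r dG[of _ "\<alpha> * a + e/2"] near in \<open>auto intro!: exI mult_nonneg_nonpos\<close>)
    ultimately have "r ^ d * ((\<alpha> * a - e/2) * r / (real d + 1)) \<le> r ^ d * F r"
      "r ^ d * F r \<le> r ^ d * ((\<alpha> * a + e/2) * r / (real d + 1))"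
      by (auto simp: ini algebra_simps)
    then have "(\<alpha> * a - e/2) * r / (real d + 1) \<le> F r" "F r \<le> (\<alpha> * a + e/2) * r / (real d + 1)"
      using r by (simp_all only: mult_le_cancel_left_pos zero_less_power)
    then have "(\<alpha> * a - e/2) / (real d + 1) \<le> F r / r" "F r / r \<le> (\<alpha> * a + e/2) / (real d + 1)"
      using r by (auto simp: divide_simps mult_ac)
    moreover have "e / 2 / (real d + 1) < e" using e by (simp add: divide_simps)
    ultimately show ?thesis by (auto simp: add_divide_distrib diff_divide_distrib abs_less_iff)
  qed
  show "\<forall>\<^sub>F r in at_right 0. dist (F r / r) (\<alpha> * a / (real d + 1)) < e"
    using eventually_at_right_real[OF q(1)]
    by eventually_elim (use bound in \<open>auto simp: dist_real_def\<close>)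
qed

text \<open>The flux starts with positive slope, and at a first zero the equation reduces to
  \<open>F' = \<alpha> * f > 0\<close>. Asking for \<open>f > 0\<close> only at zeros of
  \<open>F\<close> lets both \<open>D > 0\<close> and positivity of the profile serve as its
  source.\<close>

lemma ivp_flux_pos:
  assumes ivp: "ivp d \<alpha> \<beta> \<phi> \<psi> a T f F"
    and cont: "continuous_on UNIV \<phi>" "continuous_on UNIV \<psi>" and zero: "\<phi> 0 = 0" "\<psi> 0 = 0"
    and pos: "0 < \<alpha>" "0 < a" and r: "0 < r" "r < T"
    and f: "\<And>s. 0 < s \<Longrightarrow> s \<le> r \<Longrightarrow> F s = 0 \<Longrightarrow> 0 < f s"
  shows "0 < F r"
proof (rule ccontr)
  assume neg: "\<not> 0 < F r"
  have "((\<lambda>r. F r / r) \<longlongrightarrow> \<alpha> * a / (real d + 1)) (at_right 0)"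
    using ivp_flux_asymp[OF ivp _ cont zero] r by auto
  moreover have "0 < \<alpha> * a / (real d + 1)" using pos by auto
  ultimately have "\<forall>\<^sub>F r in at_right 0. 0 < F r / r" by (rule order_tendstoD)
  then obtain b where b: "0 < b" "\<And>s. 0 < s \<Longrightarrow> s < b \<Longrightarrow> 0 < F s"
    unfolding eventually_at_right_field by (metis zero_less_divide_iff less_asym)
  define s where "s = min (b/2) r"
  have s: "0 < s" "s \<le> r" "s < b" using b r by (auto simp: s_def min_def)
  obtain c where c: "s < c" "c \<le> r" "F c = 0" "\<And>u. s \<le> u \<Longrightarrow> u < c \<Longrightarrow> 0 < F u"
  proof (rule first_zero[of s r F])
    show "continuous_on {s..r} F"
      using ivp s r unfolding ivp_def by (auto elim!: continuous_on_subset)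
  qed (use s b neg in auto)
  have "(F has_real_derivative \<alpha> * f c) (at c)"
    using ivp c s r unfolding ivp_def by (auto simp: zero dest: spec[of _ c])
  then have "\<alpha> * f c \<le> 0" by (rule deriv_at_first_zero_nonpos) (use c in auto)
  moreover have "0 < f c" using f c s by auto
  ultimately show False using pos by (simp add: mult_le_0_iff)
qed

text \<open>Before a first contact with \<open>M\<close> the profile decreases, so \<open>f\<close>
  is at most \<open>a\<close>; at the contact the absorption \<open>\<psi> M\<close> exceeds
  \<open>\<alpha> * a\<close>, which makes \<open>F' < 0\<close>.\<close>

lemma ivp_flux_less:
  assumes ivp: "ivp d \<alpha> \<beta> \<phi> \<psi> a T f F" and nonneg: "0 \<le> \<alpha>" "0 \<le> \<beta>"
    and M: "0 < M" "\<alpha> * a < \<psi> M" and \<phi>: "\<And>x. 0 \<le> x \<Longrightarrow> x \<le> M \<Longrightarrow> 0 \<le> \<phi> x"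
    and r: "0 < r" "r < T" and F: "\<And>s. 0 < s \<Longrightarrow> s \<le> r \<Longrightarrow> 0 \<le> F s"
  shows "F r < M"
proof (rule ccontr)
  assume "\<not> F r < M"
  then have "M - F r \<le> 0" by simp
  have cont: "continuous_on {0..r} F" "continuous_on {0..r} f"
    using ivp r unfolding ivp_def by (auto elim: continuous_on_subset)
  obtain c where c: "0 < c" "c \<le> r" "M - F c = 0" "\<And>s. 0 \<le> s \<Longrightarrow> s < c \<Longrightarrow> 0 < M - F s"
  proof (rule first_zero[of 0 r "\<lambda>s. M - F s"])
    show "continuous_on {0..r} (\<lambda>s. M - F s)" by (intro continuous_intros cont)
    show "0 < M - F 0" using M ivp by (simp add: ivp_def)
  qed (use r \<open>M - F r \<le> 0\<close> in auto)
  have Fc: "F c = M" using c by simp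
  have "f c \<le> f 0"
  proof (rule DERIV_nonpos_imp_decreasing_open[where f = f])
    fix s assume s: "0 < s" "s < c"
    then have "0 \<le> \<phi> (F s)" using F[of s] c(2) c(4)[of s] by (intro \<phi>) auto
    then show "\<exists>y. (f has_real_derivative y) (at s) \<and> y \<le> 0"
      using ivp s c r unfolding ivp_def by (intro exI[of _ "- \<phi> (F s)"]) auto
  qed (use c cont in \<open>auto elim: continuous_on_subset\<close>)
  then have fc: "\<alpha> * f c \<le> \<alpha> * a" using ivp nonneg by (auto simp: ivp_def intro: mult_left_mono)
  define l where "l = \<alpha> * f c - \<beta> * c * \<phi> (F c) - \<psi> (F c) - d / c * F c"
  have "(F has_real_derivative l) (at c)"
    using ivp c r unfolding ivp_def l_def by auto
  then have "((\<lambda>s. M - F s) has_real_derivative - l) (at c)"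
    by (auto intro!: derivative_eq_intros)
  then have "- l \<le> 0" by (rule deriv_at_first_zero_nonpos[of _ _ _ 0]) (use c in auto)
  moreover have "l < 0"
  proof -
    have "0 \<le> \<beta> * c * \<phi> M" "0 \<le> d / c * M" using nonneg c M \<phi>[of M] by auto
    then show ?thesis unfolding l_def Fc using fc M by linarith
  qed
  ultimately show False by simp
qed

section \<open>The flow and its invariant regions\<close>

text \<open>The assumptions are \<open>q > p - 1\<close>, \<open>q < p / 2\<close>,
  \<open>p > p_crit N\<close> and positivity of \<open>\<beta>\<close>, rewritten for
  \<open>m\<close>, \<open>k\<close> and \<open>d\<close>.\<close>

locale profile_ode =
  fixes d :: nat and m k \<beta> :: real
  assumes k_gt_1: "1 < k" and k_lt: "2 * k < m + 1" and d_lt: "real d * (m - 1) < 2"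
    and \<beta>_pos: "0 < \<beta>"
begin

definition \<mu> where "\<mu> = m / (k - 1) - 1"
definition \<alpha> where "\<alpha> = \<beta> * \<mu>"
text \<open>With \<open>D = 0\<close> and \<open>F powr (k - 1) = \<kappa> / r\<close> the flux
  equation reads \<open>- 1 / (k - 1) = - \<kappa> - d\<close>; this fixes the constant.\<close>

definition \<kappa> where "\<kappa> = 1 / (k - 1) - real d"
text \<open>In the original exponents this is \<open>(p - 2 * q) / (q - p + 1)\<close>. It is the
  rate at which \<open>r\<^sup>2 * F powr (m - 1)\<close> decays when \<open>Y\<close> stays
  bounded.\<close>

definition \<nu> where "\<nu> = (m - 1) / (k - 1) - 2"
definition \<theta> where "\<theta> = (k - 1) * \<kappa>"

definition D where "D f F r = \<alpha> * f r - \<beta> * r * spow m (F r)"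
definition Y where "Y F r = r * \<bar>F r\<bar> powr (k - 1)"
definition J where "J f F r = \<kappa> * F r + r * D f F r - r * \<bar>F r\<bar> powr k"

definition sol where
  "sol a T f F \<longleftrightarrow> ivp d \<alpha> \<beta> (spow m) (\<lambda>x. \<bar>x\<bar> powr k) a T f F"

definition flow where
  "flow a T f F \<longleftrightarrow> 0 < a \<and> sol a T f F \<and> (\<forall>r. 0 < r \<and> r < T \<longrightarrow> 0 < F r)"

text \<open>Truncating the flux at height \<open>M\<close> makes the nonlinearities globally Lipschitz. If \<open>\<alpha> a < M\<^sup>k\<close>, the
  truncation is inactive as long as \<open>D > 0\<close>.\<close>

definition tsol where
  "tsol M a f F \<longleftrightarrow>
     (\<forall>T. ivp d \<alpha> \<beta> (\<lambda>x. spow m (trunc_at M x)) (\<lambda>x. \<bar>trunc_at M x\<bar> powr k) a T f F)"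

lemma m_gt: "1 < m" "k < m" using k_gt_1 k_lt by auto

lemma \<mu>_pos: "0 < \<mu>" using k_gt_1 k_lt by (simp add: \<mu>_def less_divide_eq)

lemma \<alpha>_pos: "0 < \<alpha>" using \<beta>_pos \<mu>_pos by (simp add: \<alpha>_def)

lemma \<nu>_pos: "0 < \<nu>" using k_gt_1 k_lt by (simp add: \<nu>_def less_divide_eq)

text \<open>Both upper bounds are combined: \<open>k - 1\<close> is less than
  \<open>(m - 1) / 2\<close>, and \<open>d * (m - 1) < 2\<close>.\<close>

lemma \<kappa>_pos: "0 < \<kappa>"
proof -
  have "real d * (k - 1) \<le> real d * ((m - 1) / 2)" using k_lt by (intro mult_left_mono) auto
  then have "real d * (k - 1) < 1" using d_lt by simp
  then show ?thesis using k_gt_1 by (simp add: \<kappa>_def less_divide_eq)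
qed

lemma \<theta>_pos: "0 < \<theta>" using \<kappa>_pos k_gt_1 by (simp add: \<theta>_def)

lemma \<alpha>_plus_\<beta>: "\<alpha> + \<beta> = \<beta> * m / (k - 1)" by (simp add: \<alpha>_def \<mu>_def algebra_simps)

lemma exponents: "m / (k - 1) = \<mu> + 1" "(m - 1) / (k - 1) = \<nu> + 2"
  by (simp_all add: \<mu>_def \<nu>_def)

lemma flow_pos: "flow a T f F \<Longrightarrow> 0 < r \<Longrightarrow> r < T \<Longrightarrow> 0 < F r"
  by (simp add: flow_def)

lemma flow_continuous:
  assumes "flow a T f F"
  shows "continuous_on {0..<T} f" "continuous_on {0..<T} F"
  using assms by (auto simp: flow_def sol_def ivp_def)

lemma flow_continuous_atLeast:
  assumes "\<And>T. flow a T f F" shows "continuous_on {0..} f" "continuous_on {0..} F"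
proof -
  have "continuous_on {0..b} f \<and> continuous_on {0..b} F" for b
    using flow_continuous[OF assms[of "b + 1"]] by (auto elim: continuous_on_subset)
  then show "continuous_on {0..} f" "continuous_on {0..} F" by (auto intro: continuous_on_atLeast_0I)
qed

lemma flow_init: "flow a T f F \<Longrightarrow> f 0 = a" "flow a T f F \<Longrightarrow> F 0 = 0" "flow a T f F \<Longrightarrow> 0 < a"
  by (auto simp: flow_def sol_def ivp_def)

lemma flow_deriv:
  assumes "flow a T f F" "0 < r" "r < T"
  shows "(f has_real_derivative - (F r powr m)) (at r)"
    "(F has_real_derivative D f F r - F r powr k - d / r * F r) (at r)"
proof -
  have F: "0 < F r" and 1: "(f has_real_derivative - spow m (F r)) (at r)"
    "(F has_real_derivative \<alpha> * f r - \<beta> * r * spow m (F r) - \<bar>F r\<bar> powr k - d / r * F r) (at r)"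
    using assms unfolding flow_def sol_def ivp_def by auto
  then show "(f has_real_derivative - (F r powr m)) (at r)"
    "(F has_real_derivative D f F r - F r powr k - d / r * F r) (at r)"
    by (simp_all add: spow_pos D_def)
qed

lemma J_eq: "0 < F r \<Longrightarrow> J f F r = r * D f F r + F r * (\<kappa> - Y F r)"
proof -
  assume "0 < F r"
  then have "F r powr k = F r powr (k - 1) * F r" using powr_add[of "F r" "k - 1" 1] by simp
  then show ?thesis using \<open>0 < F r\<close> by (simp add: J_def Y_def algebra_simps)
qed

lemma continuous_D:
  assumes "continuous_on S f" "continuous_on S F"
  shows "continuous_on S (D f F)"
  unfolding D_def
  by (intro continuous_intros assms continuous_on_compose2[OF continuous_on_spow[OF m_gt(1)] assms(2)]) auto

lemma continuous_Y:
  assumes "continuous_on S F" shows "continuous_on S (Y F)"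
  unfolding Y_def using k_gt_1 by (intro continuous_intros continuous_on_powr' assms) auto

lemma flow_DY_continuous:
  assumes "flow a T f F" shows "continuous_on {0..<T} (D f F)" "continuous_on {0..<T} (Y F)"
  using assms flow_continuous continuous_D continuous_Y by blast+

lemma flow_DY_init:
  assumes "flow a T f F" shows "D f F 0 = \<alpha> * a" "Y F 0 = 0"
  using flow_init[OF assms] by (auto simp: D_def Y_def)

text \<open>\<open>J\<close> equals \<open>F / (k - 1) + r * F'\<close>. The terms of
  \<open>D'\<close> without \<open>F'\<close> sum to
  \<open>- (\<alpha> + \<beta>) * F powr m\<close>, and
  \<open>\<alpha> + \<beta> = \<beta> * m / (k - 1)\<close> gives them the same factor as the term
  with \<open>F'\<close>. In \<open>Y'\<close> this combination appears directly.\<close>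

lemma flow_D_deriv:
  assumes "flow a T f F" "0 < r" "r < T"
  shows "(D f F has_real_derivative - (\<beta> * m * F r powr (m - 1) * J f F r)) (at r)"
proof -
  note F = flow_pos[OF assms]
  let ?F' = "D f F r - F r powr k - d / r * F r"
  have "((\<lambda>r. spow m (F r)) has_real_derivative m * F r powr (m - 1) * ?F') (at r)"
    using DERIV_chain2[OF DERIV_spow[OF m_gt(1)] flow_deriv(2)[OF assms]] F by simp
  then have "(D f F has_real_derivative
      \<alpha> * (- (F r powr m)) - (\<beta> * 1 * spow m (F r) + \<beta> * r * (m * F r powr (m - 1) * ?F'))) (at r)"
    unfolding D_def[of f F, abs_def]
    by (auto intro!: derivative_eq_intros flow_deriv(1)[OF assms])
  moreover have "\<alpha> * (- (F r powr m)) - (\<beta> * 1 * spow m (F r) + \<beta> * r * (m * F r powr (m - 1) * ?F'))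
      = - (\<beta> * m * F r powr (m - 1) * J f F r)"
  proof -
    have "F r powr m = F r powr (m - 1) * F r" using powr_add[of "F r" "m - 1" 1] F by simp
    then have "\<alpha> * (- (F r powr m)) - \<beta> * 1 * spow m (F r) = - ((\<alpha> + \<beta>) * F r powr (m - 1) * F r)"
      using F by (simp add: spow_pos algebra_simps)
    also have "\<dots> = - (\<beta> * m * F r powr (m - 1) * (F r / (k - 1)))"
      by (simp add: \<alpha>_plus_\<beta>)
    finally have *: "\<alpha> * (- (F r powr m)) - \<beta> * 1 * spow m (F r)
      = - (\<beta> * m * F r powr (m - 1) * (F r / (k - 1)))" .
    define F' where "F' = ?F'"
    have J: "J f F r = F r / (k - 1) + r * F'"
      using F assms(2) by (simp add: J_def \<kappa>_def F'_def algebra_simps)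
    have "\<alpha> * (- (F r powr m)) - (\<beta> * 1 * spow m (F r) + \<beta> * r * (m * F r powr (m - 1) * F'))
      = (\<alpha> * (- (F r powr m)) - \<beta> * 1 * spow m (F r)) - \<beta> * m * F r powr (m - 1) * (r * F')"
      by (simp add: algebra_simps)
    then show ?thesis unfolding * J F'_def[symmetric] by (simp add: algebra_simps)
  qed
  ultimately show ?thesis by simp
qed

lemma flow_Y_deriv:
  assumes "flow a T f F" "0 < r" "r < T"
  shows "(Y F has_real_derivative (k - 1) * F r powr (k - 2) * J f F r) (at r)"
proof (rule has_field_derivative_transform_within_open[where S = "{0<..<T}"])
  note F = flow_pos[OF assms]
  let ?F' = "D f F r - F r powr k - d / r * F r"
  have "((\<lambda>r. F r powr (k - 1)) has_real_derivative (k - 1) * F r powr (k - 1 - 1) * ?F') (at r)"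
    by (rule DERIV_chain2[OF has_real_derivative_powr[OF F] flow_deriv(2)[OF assms]])
  then have "((\<lambda>r. F r powr (k - 1)) has_real_derivative (k - 1) * F r powr (k - 2) * ?F') (at r)"
    by simp
  from DERIV_mult[OF DERIV_ident this]
  have "((\<lambda>r. r * F r powr (k - 1)) has_real_derivative
      F r powr (k - 1) + r * ((k - 1) * F r powr (k - 2) * ?F')) (at r)"
    by (simp add: mult.commute)
  moreover have "F r powr (k - 1) + r * ((k - 1) * F r powr (k - 2) * ?F') = (k - 1) * F r powr (k - 2) * J f F r"
  proof -
    have p: "F r powr (k - 1) = F r powr (k - 2) * F r" using powr_add[of "F r" "k - 2" 1] F by simp
    define F' where "F' = ?F'"
    have "J f F r = F r / (k - 1) + r * F'"
      using F assms(2) by (simp add: J_def \<kappa>_def F'_def algebra_simps)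
    then have "(k - 1) * J f F r = F r + (k - 1) * (r * F')" using k_gt_1 by (simp add: distrib_left)
    then have "F r powr (k - 2) * ((k - 1) * J f F r) = F r powr (k - 2) * (F r + (k - 1) * (r * F'))"
      by simp
    then show ?thesis unfolding F'_def[symmetric] p by (simp add: algebra_simps)
  qed
  ultimately show "((\<lambda>r. r * F r powr (k - 1)) has_real_derivative (k - 1) * F r powr (k - 2) * J f F r) (at r)"
    by simp
qed (use assms flow_pos[OF assms(1)] in \<open>auto simp: Y_def abs_of_pos\<close>)

text \<open>The pair \<open>D = 0\<close>, \<open>Y = \<kappa>\<close> characterises the explicit singular solution, so it is never
  attained by a regular one.\<close>

lemma flow_nondegenerate:
  assumes flow: "flow a T f F" and r: "0 < r" "r < T"
  shows "D f F r \<noteq> 0 \<or> Y F r \<noteq> \<kappa>"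
proof -
  have "0 < D f F 0" using flow_DY_init[OF flow] \<alpha>_pos flow_init(3)[OF flow] by simp
  then obtain b where b: "0 < b" "b < T" "\<forall>s\<in>{0..b}. 0 < D f F s"
    using pos_beyond[OF flow_DY_continuous(1)[OF flow]] r by (metis order.refl less_trans)
  \<comment> \<open>The comparison starts at a positive radius: for \<open>k < 2\<close> the
    coefficient \<open>F powr (k - 2)\<close> is singular at the centre.\<close>
  define r0 where "r0 = min b r"
  have r0: "0 < r0" "r0 \<le> r" "0 < D f F r0" using b r by (auto simp: r0_def min_def)
  \<comment> \<open>\<open>J\<close> is linear in \<open>D\<close> and \<open>\<kappa> - Y\<close>,
    so \<open>E' \<ge> - C * E\<close> with a bound \<open>C\<close> for the coefficients; a
    positive \<open>E\<close> then cannot reach 0.\<close>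
  define E where "E s = (D f F s)\<^sup>2 + (\<kappa> - Y F s)\<^sup>2" for s
  define p q where "p s = \<beta> * m * F s powr (m - 1)" and "q s = (k - 1) * F s powr (k - 2)" for s
  have Fpos: "0 < F s" if "s \<in> {r0..r}" for s using flow_pos[OF flow] that r r0 by auto
  have cF: "continuous_on {r0..r} F"
    by (rule continuous_on_subset[OF flow_continuous(2)[OF flow]]) (use r r0 in auto)
  have "continuous_on {r0..r} (\<lambda>s. s\<^sup>2 + (F s)\<^sup>2 + (p s)\<^sup>2 + (q s)\<^sup>2)"
    unfolding p_def q_def using Fpos
    by (intro continuous_intros cF continuous_on_powr) force+
  then have "bdd_above ((\<lambda>s. s\<^sup>2 + (F s)\<^sup>2 + (p s)\<^sup>2 + (q s)\<^sup>2) ` {r0..r})"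
    by (intro bounded_imp_bdd_above compact_imp_bounded compact_continuous_image) auto
  then obtain C where "\<forall>x \<in> (\<lambda>s. s\<^sup>2 + (F s)\<^sup>2 + (p s)\<^sup>2 + (q s)\<^sup>2) ` {r0..r}. x \<le> C"
    unfolding bdd_above_def by blast
  then have C: "s\<^sup>2 + (F s)\<^sup>2 + (p s)\<^sup>2 + (q s)\<^sup>2 \<le> C" if "s \<in> {r0..r}" for s using that by simp
  have CS: "(x * u + y * v)\<^sup>2 \<le> (x\<^sup>2 + y\<^sup>2) * (u\<^sup>2 + v\<^sup>2)" for x y u v :: real
    using zero_le_power2[of "x * v - y * u"] by (simp add: power2_eq_square algebra_simps)
  have "E r0 * exp (C * r0) \<le> E r * exp (C * r)"
  proof (rule DERIV_nonneg_imp_nondecreasing[OF r0(2)])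
    fix s assume "r0 \<le> s" "s \<le> r"
    then have s: "s \<in> {r0..r}" "0 < s" "s < T" using r r0 by auto
    let ?D = "D f F s" and ?w = "\<kappa> - Y F s"
    define A B where "A = s * ?D + F s * ?w" and "B = p s * ?D + q s * ?w"
    have J: "J f F s = A" using J_eq[of F s f] Fpos[OF s(1)] by (simp add: A_def)
    have dE: "(E has_real_derivative - 2 * A * B) (at s)"
      unfolding E_def using flow_D_deriv[OF flow s(2,3)] flow_Y_deriv[OF flow s(2,3)]
      by (auto intro!: derivative_eq_intros simp: J B_def p_def q_def algebra_simps)
    have "A\<^sup>2 \<le> (s\<^sup>2 + (F s)\<^sup>2) * E s" "B\<^sup>2 \<le> ((p s)\<^sup>2 + (q s)\<^sup>2) * E s"
      unfolding A_def B_def E_def by (rule CS)+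
    then have "A\<^sup>2 + B\<^sup>2 \<le> (s\<^sup>2 + (F s)\<^sup>2 + (p s)\<^sup>2 + (q s)\<^sup>2) * E s" by (simp add: algebra_simps)
    also have "\<dots> \<le> C * E s" using C[OF s(1)] by (intro mult_right_mono) (auto simp: E_def)
    finally have "0 \<le> (- 2 * A * B) + C * E s"
      using zero_le_power2[of "A - B"] by (simp add: power2_diff)
    then have "0 \<le> ((- 2 * A * B) + C * E s) * exp (C * s)" by simp
    moreover have "((\<lambda>s. E s * exp (C * s)) has_real_derivative ((- 2 * A * B) + C * E s) * exp (C * s)) (at s)"
      by (rule DERIV_cong[OF DERIV_mult[OF dE]]) (auto intro!: derivative_eq_intros simp: algebra_simps)
    ultimately show "\<exists>y. ((\<lambda>s. E s * exp (C * s)) has_real_derivative y) (at s) \<and> 0 \<le> y" by blast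
  qed
  moreover have "0 < E r0 * exp (C * r0)" using r0(3)
    unfolding E_def by (intro mult_pos_pos add_pos_nonneg) auto
  ultimately have "0 < E r * exp (C * r)" by linarith
  then have "E r \<noteq> 0" by auto
  then show ?thesis by (auto simp: E_def)
qed

text \<open>Both summands of \<open>J\<close> are positive inside the region, which fixes the signs
  of \<open>D'\<close> and \<open>Y'\<close>.\<close>

lemma flow_Q0_monotone:
  assumes flow: "flow a T f F"
    and Q0: "\<And>s. x < s \<Longrightarrow> s < y \<Longrightarrow> 0 < D f F s \<and> Y F s < \<kappa>"
    and xy: "0 \<le> x" "x < y" "y < T"
  shows "D f F y < D f F x" "Y F x < Y F y"
proof -
  have J: "0 < J f F s" if "x < s" "s < y" for s
    using Q0[OF that] flow_pos[OF flow, of s] that xy by (auto simp: J_eq intro!: add_pos_pos mult_pos_pos)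
  have cont: "continuous_on {x..y} (D f F)" "continuous_on {x..y} (Y F)"
    by (rule continuous_on_subset[OF flow_DY_continuous(1)[OF flow]], use xy in auto)
      (rule continuous_on_subset[OF flow_DY_continuous(2)[OF flow]], use xy in auto)
  show "D f F y < D f F x"
  proof (rule DERIV_neg_imp_decreasing_open[OF xy(2) _ cont(1)])
    fix s assume s: "x < s" "s < y"
    show "\<exists>z. (D f F has_real_derivative z) (at s) \<and> z < 0"
      using J[OF s] s xy \<beta>_pos m_gt flow_pos[OF flow, of s]
      by (intro exI[of _ "- (\<beta> * m * F s powr (m - 1) * J f F s)"] conjI flow_D_deriv[OF flow]) auto
  qed
  show "Y F x < Y F y"
  proof (rule DERIV_pos_imp_increasing_open[OF xy(2) _ cont(2)])
    fix s assume s: "x < s" "s < y"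
    show "\<exists>z. (Y F has_real_derivative z) (at s) \<and> 0 < z"
      using J[OF s] s xy k_gt_1 flow_pos[OF flow, of s]
      by (intro exI[of _ "(k - 1) * F s powr (k - 2) * J f F s"] conjI flow_Y_deriv[OF flow]) auto
  qed
qed

text \<open>On this part of the boundary only \<open>F * (\<kappa> - Y)\<close> is left of
  \<open>J\<close>, so \<open>D' < 0\<close> and the crossing is transversal.\<close>

lemma flow_beyond_D:
  assumes flow: "flow a T f F" and c: "0 < c" "c < T" "D f F c = 0" "Y F c < \<kappa>"
  shows "\<exists>r. c < r \<and> r < T \<and> D f F r < 0 \<and> (\<forall>s\<in>{c..r}. Y F s < \<kappa>)"
proof -
  have "0 < J f F c" using flow_pos[OF flow c(1,2)] c by (simp add: J_eq)
  then have "- (\<beta> * m * F c powr (m - 1) * J f F c) < 0"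
    using \<beta>_pos m_gt flow_pos[OF flow c(1,2)] by simp
  from DERIV_neg_dec_right[OF flow_D_deriv[OF flow c(1,2)] this]
  obtain e where e: "0 < e" "\<And>h. 0 < h \<Longrightarrow> h < e \<Longrightarrow> D f F (c + h) < 0" using c by auto
  have "continuous_on {0..<T} (\<lambda>s. \<kappa> - Y F s)"
    by (intro continuous_intros flow_DY_continuous[OF flow])
  then obtain b where b: "c < b" "b < T" "\<forall>s\<in>{c..b}. 0 < \<kappa> - Y F s"
    using pos_beyond[of T _ c] c by fastforce
  define h where "h = min (e/2) (b - c)"
  have "0 < h" "h < e" "c + h \<le> b" using e b by (auto simp: h_def)
  then show ?thesis using e(2)[of h] b by (intro exI[of _ "c + h"]) auto
qed

text \<open>On this part of the boundary only \<open>r * D\<close> is left of \<open>J\<close>, so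
  \<open>Y' > 0\<close> and the crossing is transversal.\<close>

lemma flow_beyond_Y:
  assumes flow: "flow a T f F" and c: "0 < c" "c < T" "0 < D f F c" "Y F c = \<kappa>"
  shows "\<exists>r. c < r \<and> r < T \<and> \<kappa> < Y F r \<and> (\<forall>s\<in>{c..r}. 0 < D f F s)"
proof -
  have "0 < J f F c" using flow_pos[OF flow c(1,2)] c by (simp add: J_eq)
  then have "0 < (k - 1) * F c powr (k - 2) * J f F c"
    using k_gt_1 flow_pos[OF flow c(1,2)] by simp
  from DERIV_pos_inc_right[OF flow_Y_deriv[OF flow c(1,2)] this]
  obtain e where e: "0 < e" "\<And>h. 0 < h \<Longrightarrow> h < e \<Longrightarrow> \<kappa> < Y F (c + h)" using c by auto
  obtain b where b: "c < b" "b < T" "\<forall>s\<in>{c..b}. 0 < D f F s"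
    using pos_beyond[OF flow_DY_continuous(1)[OF flow], of c] c by auto
  define h where "h = min (e/2) (b - c)"
  have "0 < h" "h < e" "c + h \<le> b" using e b by (auto simp: h_def)
  then show ?thesis using e(2)[of h] b by (intro exI[of _ "c + h"]) auto
qed

text \<open>At a first contact with the boundary exactly one of \<open>D\<close> and
  \<open>\<kappa> - Y\<close> vanishes, by nondegeneracy; the remaining term of \<open>J\<close>
  drives the vanishing one back inside.\<close>

lemma flow_trapped_below:
  assumes flow: "flow a T f F" and r0: "0 < r0" "D f F r0 < 0" "Y F r0 < \<kappa>" and r: "r0 \<le> r" "r < T"
  shows "D f F r < 0 \<and> Y F r < \<kappa>"
proof (rule ccontr)
  define g where "g s = min (- D f F s) (\<kappa> - Y F s)" for s
  assume "\<not> (D f F r < 0 \<and> Y F r < \<kappa>)"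
  then have "g r \<le> 0" by (auto simp: g_def)
  moreover have "continuous_on {r0..r} g"
    unfolding g_def
    by (intro continuous_intros continuous_on_subset[OF flow_DY_continuous(1)[OF flow]]
        continuous_on_subset[OF flow_DY_continuous(2)[OF flow]]) (use r r0 in auto)
  moreover have "0 < g r0" using r0 by (simp add: g_def)
  ultimately obtain c where c: "r0 < c" "c \<le> r" "g c = 0" "\<And>s. r0 \<le> s \<Longrightarrow> s < c \<Longrightarrow> 0 < g s"
    using first_zero[OF r(1)] by metis
  have cT: "0 < c" "c < T" using c r r0 by auto
  note F = flow_pos[OF flow cT]
  note nd = flow_nondegenerate[OF flow cT]
  show False
  proof (cases "D f F c = 0")
    case True
    then have Y: "Y F c < \<kappa>" using nd c(3) by (auto simp: g_def min_def split: if_splits)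
    have "((\<lambda>s. - D f F s) has_real_derivative \<beta> * m * F c powr (m - 1) * J f F c) (at c)"
      using flow_D_deriv[OF flow cT] DERIV_minus by fastforce
    then have "\<beta> * m * F c powr (m - 1) * J f F c \<le> 0"
      by (rule deriv_at_first_zero_nonpos[of _ _ _ r0]) (use c True in \<open>auto simp: g_def\<close>)
    moreover have "0 < \<beta> * m * F c powr (m - 1) * J f F c"
      using \<beta>_pos m_gt F Y True by (auto simp: J_eq intro!: mult_pos_pos)
    ultimately show False by linarith
  next
    case False
    then have Y: "Y F c = \<kappa>" "D f F c < 0" using c(3) by (auto simp: g_def min_def split: if_splits)
    have "((\<lambda>s. \<kappa> - Y F s) has_real_derivative - ((k - 1) * F c powr (k - 2) * J f F c)) (at c)"
      using flow_Y_deriv[OF flow cT] by (auto intro!: derivative_eq_intros)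
    then have "- ((k - 1) * F c powr (k - 2) * J f F c) \<le> 0"
      by (rule deriv_at_first_zero_nonpos[of _ _ _ r0]) (use c Y in \<open>auto simp: g_def\<close>)
    moreover have "(k - 1) * F c powr (k - 2) * J f F c < 0"
      using k_gt_1 F Y cT by (auto simp: J_eq intro!: mult_pos_neg)
    ultimately show False by linarith
  qed
qed

text \<open>The same contact argument with the signs of \<open>D\<close> and
  \<open>\<kappa> - Y\<close> reversed.\<close>

lemma flow_trapped_above:
  assumes flow: "flow a T f F" and r0: "0 < r0" "0 < D f F r0" "\<kappa> < Y F r0" and r: "r0 \<le> r" "r < T"
  shows "0 < D f F r \<and> \<kappa> < Y F r"
proof (rule ccontr)
  define g where "g s = min (D f F s) (Y F s - \<kappa>)" for s
  assume "\<not> (0 < D f F r \<and> \<kappa> < Y F r)"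
  then have "g r \<le> 0" by (auto simp: g_def)
  moreover have "continuous_on {r0..r} g"
    unfolding g_def
    by (intro continuous_intros continuous_on_subset[OF flow_DY_continuous(1)[OF flow]]
        continuous_on_subset[OF flow_DY_continuous(2)[OF flow]]) (use r r0 in auto)
  moreover have "0 < g r0" using r0 by (simp add: g_def)
  ultimately obtain c where c: "r0 < c" "c \<le> r" "g c = 0" "\<And>s. r0 \<le> s \<Longrightarrow> s < c \<Longrightarrow> 0 < g s"
    using first_zero[OF r(1)] by metis
  have cT: "0 < c" "c < T" using c r r0 by auto
  note F = flow_pos[OF flow cT]
  note nd = flow_nondegenerate[OF flow cT]
  show False
  proof (cases "D f F c = 0")
    case True
    then have Y: "\<kappa> < Y F c" using nd c(3) by (auto simp: g_def min_def split: if_splits)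
    have "- (\<beta> * m * F c powr (m - 1) * J f F c) \<le> 0"
      by (rule deriv_at_first_zero_nonpos[OF flow_D_deriv[OF flow cT], of r0])
        (use c True in \<open>auto simp: g_def\<close>)
    moreover have "\<beta> * m * F c powr (m - 1) * J f F c < 0"
      using \<beta>_pos m_gt F Y True by (auto simp: J_eq intro!: mult_pos_neg mult_pos_pos)
    ultimately show False by linarith
  next
    case False
    then have Y: "Y F c = \<kappa>" "0 < D f F c" using c(3) by (auto simp: g_def min_def split: if_splits)
    have "((\<lambda>s. Y F s - \<kappa>) has_real_derivative (k - 1) * F c powr (k - 2) * J f F c) (at c)"
      using flow_Y_deriv[OF flow cT] by (auto intro!: derivative_eq_intros)
    then have "(k - 1) * F c powr (k - 2) * J f F c \<le> 0"
      by (rule deriv_at_first_zero_nonpos[of _ _ _ r0]) (use c Y in \<open>auto simp: g_def\<close>)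
    moreover have "0 < (k - 1) * F c powr (k - 2) * J f F c"
      using k_gt_1 F Y cT by (auto simp: J_eq intro!: mult_pos_pos)
    ultimately show False by linarith
  qed
qed

end

section \<open>Truncated solutions\<close>

context profile_ode
begin

text \<open>\<open>\<bar>x\<bar> powr k\<close> is the absolute value of a signed power, so the
  reverse triangle inequality transfers the bound. Adding the two constants gives one that serves
  both functions.\<close>

lemma trunc_nonlinearities:
  assumes "0 \<le> M"
  defines "L \<equiv> m * M powr (m - 1) + k * M powr (k - 1)"
  shows "0 \<le> L"
    and "\<bar>spow m (trunc_at M x) - spow m (trunc_at M y)\<bar> \<le> L * \<bar>x - y\<bar>"
    and "\<bar>\<bar>trunc_at M x\<bar> powr k - \<bar>trunc_at M y\<bar> powr k\<bar> \<le> L * \<bar>x - y\<bar>"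
proof -
  have nn: "0 \<le> m * M powr (m - 1)" "0 \<le> k * M powr (k - 1)" using m_gt k_gt_1 by auto
  show "0 \<le> L" using nn by (simp add: L_def)
  have le: "m * M powr (m - 1) * \<bar>x - y\<bar> \<le> L * \<bar>x - y\<bar>" "k * M powr (k - 1) * \<bar>x - y\<bar> \<le> L * \<bar>x - y\<bar>"
    using nn unfolding L_def by (auto intro!: mult_right_mono)
  show "\<bar>spow m (trunc_at M x) - spow m (trunc_at M y)\<bar> \<le> L * \<bar>x - y\<bar>"
    using spow_trunc_at_lipschitz[OF m_gt(1) assms(1)] le(1) by (rule order_trans)
  have "\<bar>\<bar>trunc_at M x\<bar> powr k - \<bar>trunc_at M y\<bar> powr k\<bar> \<le> \<bar>spow k (trunc_at M x) - spow k (trunc_at M y)\<bar>"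
    unfolding abs_spow[symmetric] by (rule abs_triangle_ineq3)
  also have "\<dots> \<le> k * M powr (k - 1) * \<bar>x - y\<bar>"
    by (rule spow_trunc_at_lipschitz[OF k_gt_1 assms(1)])
  also note le(2)
  finally show "\<bar>\<bar>trunc_at M x\<bar> powr k - \<bar>trunc_at M y\<bar> powr k\<bar> \<le> L * \<bar>x - y\<bar>" .
qed

lemma ex_tsol:
  assumes "0 \<le> M" shows "\<exists>f F. tsol M a f F"
proof -
  have "trunc_at M 0 = 0" using assms by (simp add: trunc_at_def)
  then interpret volterra d \<alpha> \<beta> a "m * M powr (m - 1) + k * M powr (k - 1)"
    "\<lambda>x. spow m (trunc_at M x)" "\<lambda>x. \<bar>trunc_at M x\<bar> powr k"
    using trunc_nonlinearities[OF assms] \<alpha>_pos \<beta>_pos by unfold_locales auto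
  show ?thesis using ex_solution unfolding tsol_def .
qed

lemma tsol_continuous:
  assumes "tsol M a f F" shows "continuous_on {0..<T} f" "continuous_on {0..<T} F"
  using assms by (auto simp: tsol_def ivp_def)

lemma continuous_trunc: "continuous_on UNIV (trunc_at M)"
  unfolding trunc_at_def by (intro continuous_intros)

lemma tsol_pos:
  assumes sol: "tsol M a f F" and "0 \<le> M" "0 < a" "0 < r"
    and D: "\<And>s. 0 < s \<Longrightarrow> s \<le> r \<Longrightarrow> 0 < D f F s"
  shows "0 < F r"
proof (rule ivp_flux_pos[where F = F and r = r])
  show "ivp d \<alpha> \<beta> (\<lambda>x. spow m (trunc_at M x)) (\<lambda>x. \<bar>trunc_at M x\<bar> powr k) a (r + 1) f F"
    using sol by (simp add: tsol_def)
  show "continuous_on UNIV (\<lambda>x. spow m (trunc_at M x))"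
    by (rule continuous_on_compose2[OF continuous_on_spow[OF m_gt(1)] continuous_trunc]) auto
  show "continuous_on UNIV (\<lambda>x. \<bar>trunc_at M x\<bar> powr k)"
    using k_gt_1 by (intro continuous_on_powr' continuous_intros continuous_trunc) auto
  show "spow m (trunc_at M 0) = 0" "\<bar>trunc_at M 0\<bar> powr k = 0"
    using assms(2) by (auto simp: trunc_at_def)
  \<comment> \<open>\<open>D\<close> is formed with the untruncated power, but that part vanishes at
    a zero of \<open>F\<close>.\<close>
  show "0 < f s" if "0 < s" "s \<le> r" "F s = 0" for s
    using D[OF that(1,2)] that(3) \<alpha>_pos by (simp add: D_def zero_less_mult_iff)
qed (use assms \<alpha>_pos in auto)

lemma tsol_less:
  assumes sol: "tsol M a f F" and M: "0 < M" "\<alpha> * a < M powr k"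
    and r: "0 < r" and F: "\<And>s. 0 < s \<Longrightarrow> s \<le> r \<Longrightarrow> 0 \<le> F s"
  shows "F r < M"
proof (rule ivp_flux_less[where F = F and r = r])
  show "ivp d \<alpha> \<beta> (\<lambda>x. spow m (trunc_at M x)) (\<lambda>x. \<bar>trunc_at M x\<bar> powr k) a (r + 1) f F"
    using sol by (simp add: tsol_def)
  show "\<alpha> * a < \<bar>trunc_at M M\<bar> powr k" using M by (simp add: trunc_at_eq)
  show "0 \<le> spow m (trunc_at M x)" if "0 \<le> x" "x \<le> M" for x
    using that by (simp add: trunc_at_eq spow_def)
qed (use \<alpha>_pos \<beta>_pos M r F in auto)

lemma tsol_flow:
  assumes sol: "tsol M a f F" and a: "0 < a" and M: "0 < M"
    and F: "\<And>s. 0 < s \<Longrightarrow> s < T \<Longrightarrow> 0 < F s \<and> F s \<le> M"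
  shows "flow a T f F"
proof -
  have ivp: "ivp d \<alpha> \<beta> (\<lambda>x. spow m (trunc_at M x)) (\<lambda>x. \<bar>trunc_at M x\<bar> powr k) a T f F"
    using sol by (simp add: tsol_def)
  have "trunc_at M (F s) = F s" if "0 < s" "s < T" for s using F[OF that] by (simp add: trunc_at_eq)
  then have "ivp d \<alpha> \<beta> (spow m) (\<lambda>x. \<bar>x\<bar> powr k) a T f F"
    using ivp unfolding ivp_def by metis
  then show ?thesis using F a unfolding flow_def sol_def by blast
qed

lemma tsol_flow_D:
  assumes sol: "tsol M a f F" and a: "0 < a" and M: "0 < M" "\<alpha> * a < M powr k"
    and D: "\<And>s. 0 < s \<Longrightarrow> s < T \<Longrightarrow> 0 < D f F s"
  shows "flow a T f F"
proof (rule tsol_flow[OF sol a M(1)])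
  fix s assume s: "0 < s" "s < T"
  have pos: "0 < F u" if "0 < u" "u \<le> s" for u
    using tsol_pos[OF sol _ a] M D that s by auto
  then show "0 < F s \<and> F s \<le> M" using tsol_less[OF sol M s(1)] s by (auto simp: less_imp_le)
qed

definition in_Q0 where "in_Q0 f F r \<longleftrightarrow> 0 < D f F r \<and> Y F r < \<kappa>"

text \<open>Strict inequalities at \<open>r\<close> and on the compact \<open>{0..r}\<close>: in
  this form openness in the central value follows from joint continuity.\<close>

definition exits_below where
  "exits_below f F \<longleftrightarrow> (\<exists>r>0. D f F r < 0 \<and> (\<forall>s\<in>{0..r}. Y F s < \<kappa>))"

definition exits_above where
  "exits_above f F \<longleftrightarrow> (\<exists>r>0. \<kappa> < Y F r \<and> (\<forall>s\<in>{0..r}. 0 < D f F s))"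

text \<open>At the smaller of the two radii the conditions contradict each other.\<close>

lemma exits_disjoint: "\<not> (exits_below f F \<and> exits_above f F)"
  unfolding exits_below_def exits_above_def
  by (metis atLeastAtMost_iff less_asym less_imp_le linorder_le_cases)

text \<open>The first zero of the minimum of \<open>D\<close> and \<open>\<kappa> - Y\<close> is the
  exit point; nondegeneracy tells on which part of the boundary it lies, and the crossing lemmas
  continue strictly past it. The radius \<open>c\<close> is kept because the estimates for small and
  large central values locate it.\<close>

lemma flow_exit_cases:
  assumes flow: "flow a T f F" and r: "0 < r" "r < T" "\<not> in_Q0 f F r"
  obtains c where "0 < c" "c \<le> r" "\<And>s. 0 \<le> s \<Longrightarrow> s < c \<Longrightarrow> in_Q0 f F s"
    "D f F c = 0 \<and> Y F c < \<kappa> \<and> exits_below f F \<or> 0 < D f F c \<and> Y F c = \<kappa> \<and> exits_above f F"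
proof -
  define g where "g s = min (D f F s) (\<kappa> - Y F s)" for s
  have "continuous_on {0..r} g"
    unfolding g_def
    by (intro continuous_intros continuous_on_subset[OF flow_DY_continuous(1)[OF flow]]
        continuous_on_subset[OF flow_DY_continuous(2)[OF flow]]) (use r in auto)
  moreover have "0 < g 0"
    using flow_DY_init[OF flow] \<kappa>_pos \<alpha>_pos flow_init(3)[OF flow] by (simp add: g_def)
  moreover have "g r \<le> 0" using r by (auto simp: g_def in_Q0_def)
  ultimately obtain c where c: "0 < c" "c \<le> r" "g c = 0" "\<And>s. 0 \<le> s \<Longrightarrow> s < c \<Longrightarrow> 0 < g s"
    using first_zero[of 0 r g] r by auto
  have cT: "c < T" using c r by auto
  have Q0: "in_Q0 f F s" if "0 \<le> s" "s < c" for s using c(4)[OF that] by (simp add: g_def in_Q0_def)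
  show thesis
  proof (rule that[OF c(1,2) Q0])
    show "D f F c = 0 \<and> Y F c < \<kappa> \<and> exits_below f F \<or> 0 < D f F c \<and> Y F c = \<kappa> \<and> exits_above f F"
    proof (cases "D f F c = 0")
      case True
      then have "Y F c < \<kappa>" using flow_nondegenerate[OF flow c(1) cT] c(3)
        by (auto simp: g_def min_def split: if_splits)
      moreover have "exits_below f F"
      proof -
        obtain r where "c < r" "D f F r < 0" "\<forall>s\<in>{c..r}. Y F s < \<kappa>"
          using flow_beyond_D[OF flow c(1) cT True \<open>Y F c < \<kappa>\<close>] by blast
        then show ?thesis unfolding exits_below_def using Q0 c(1)
          by (intro exI[of _ r]) (auto simp: in_Q0_def not_less)
      qed
      ultimately show ?thesis using True by blast
    next
      case False
      then have Y: "Y F c = \<kappa>" "0 < D f F c" using c(3) by (auto simp: g_def min_def split: if_splits)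
      have "exits_above f F"
      proof -
        obtain r where "c < r" "\<kappa> < Y F r" "\<forall>s\<in>{c..r}. 0 < D f F s"
          using flow_beyond_Y[OF flow c(1) cT Y(2,1)] by blast
        then show ?thesis unfolding exits_above_def using Q0 c(1)
          by (intro exI[of _ r]) (auto simp: in_Q0_def not_less)
      qed
      then show ?thesis using Y by blast
    qed
  qed
qed

text \<open>A truncated solution is a genuine one as long as \<open>0 < F \<le> M\<close>. Inside
  the region \<open>Y\<close> increases, which keeps the flux from vanishing at \<open>c\<close>,
  and \<open>F c < M\<close> holds strictly; so both bounds persist a little beyond.\<close>

lemma tsol_extends:
  assumes sol: "tsol M a f F" and a: "0 < a" and M: "0 < M" "\<alpha> * a < M powr k"
    and c: "0 < c" and Q0: "\<And>s. 0 < s \<Longrightarrow> s < c \<Longrightarrow> in_Q0 f F s"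
  shows "\<exists>T>c. flow a T f F"
proof -
  have flow: "flow a c f F" using Q0 by (intro tsol_flow_D[OF sol a M]) (auto simp: in_Q0_def)
  have cont: "continuous_on {0..<c + 1} F" by (rule tsol_continuous[OF sol])
  have Fc: "F c \<noteq> 0"
  proof -
    have "continuous_on {0..c} (Y F)"
      by (intro continuous_Y continuous_on_subset[OF cont]) auto
    have "Y F (c / 2) \<le> Y F c"
    proof (rule DERIV_nonneg_imp_increasing_open[where f = "Y F"])
      fix s assume s: "c / 2 < s" "s < c"
      then have "0 < J f F s"
        using Q0[of s] c flow_pos[OF flow, of s]
        by (auto simp: J_eq in_Q0_def intro!: add_pos_pos mult_pos_pos)
      then show "\<exists>y. (Y F has_real_derivative y) (at s) \<and> 0 \<le> y"
        using s c k_gt_1 flow_pos[OF flow, of s]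
        by (intro exI[of _ "(k - 1) * F s powr (k - 2) * J f F s"] conjI flow_Y_deriv[OF flow]) auto
    qed (use c \<open>continuous_on {0..c} (Y F)\<close> in \<open>auto elim: continuous_on_subset\<close>)
    moreover have "0 < Y F (c / 2)" using flow_pos[OF flow, of "c/2"] c by (simp add: Y_def)
    ultimately show ?thesis by (auto simp: Y_def)
  qed
  have "0 < F c"
  proof (rule ccontr)
    assume "\<not> 0 < F c"
    moreover have "continuous_on {c/2..c} F" by (rule continuous_on_subset[OF cont]) (use c in auto)
    moreover have "0 < F (c/2)" using flow_pos[OF flow, of "c/2"] c by simp
    ultimately obtain u where "c/2 < u" "u \<le> c" "F u = 0" using first_zero[of "c/2" c F] c by auto
    then show False using flow_pos[OF flow, of u] Fc c by (cases "u = c") auto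
  qed
  moreover have "F c < M"
    using tsol_less[OF sol M c] flow_pos[OF flow] \<open>0 < F c\<close> by (metis less_eq_real_def)
  ultimately have "0 < min (F c) (M - F c)" by simp
  moreover have "continuous_on {0..<c + 1} (\<lambda>s. min (F s) (M - F s))"
    by (intro continuous_intros cont)
  ultimately have "\<exists>b. c < b \<and> b < c + 1 \<and> (\<forall>s\<in>{c..b}. 0 < min (F s) (M - F s))"
    using c by (intro pos_beyond) auto
  then obtain T where T: "c < T" "\<forall>s\<in>{c..T}. 0 < min (F s) (M - F s)" by blast
  have "flow a T f F"
  proof (rule tsol_flow[OF sol a M(1)])
    fix s assume s: "0 < s" "s < T"
    have pos: "0 < F u" if "0 < u" "u < T" for u
      using flow_pos[OF flow, of u] T(2) that by (cases "u < c") auto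
    then have "F s < M" using tsol_less[OF sol M s(1)] s by (auto simp: less_imp_le)
    then show "0 < F s \<and> F s \<le> M" using pos s by auto
  qed
  then show ?thesis using T by blast
qed

text \<open>The first zero of the minimum of \<open>D\<close> and \<open>\<kappa> - Y\<close> is
  found for the truncated solution, where the sign of the flux does not matter; only after extending
  the flow past it can the exit be classified.\<close>

lemma tsol_cases:
  assumes sol: "tsol M a f F" and a: "0 < a" and M: "0 < M" "\<alpha> * a < M powr k"
  obtains (stays) "\<And>T. flow a T f F" "\<And>s. 0 \<le> s \<Longrightarrow> in_Q0 f F s"
  | (exits) c T where "0 < c" "c < T" "flow a T f F" "\<And>s. 0 \<le> s \<Longrightarrow> s < c \<Longrightarrow> in_Q0 f F s"
      "D f F c = 0 \<and> Y F c < \<kappa> \<and> exits_below f F \<or> 0 < D f F c \<and> Y F c = \<kappa> \<and> exits_above f F"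
proof (cases "\<forall>s\<ge>0. in_Q0 f F s")
  case True
  then have "flow a T f F" for T by (intro tsol_flow_D[OF sol a M]) (auto simp: in_Q0_def)
  then show thesis using stays True by blast
next
  case False
  then obtain r where r: "0 \<le> r" "\<not> in_Q0 f F r" by blast
  define g where "g s = min (D f F s) (\<kappa> - Y F s)" for s
  have c0: "continuous_on {0..r} f" "continuous_on {0..r} F"
    using tsol_continuous[OF sol, of "r + 1"] by (auto elim: continuous_on_subset)
  have "continuous_on {0..r} g"
    unfolding g_def by (intro continuous_intros continuous_D continuous_Y c0)
  moreover have "f 0 = a" "F 0 = 0" using sol by (auto simp: tsol_def ivp_def)
  then have "0 < g 0" using \<alpha>_pos \<kappa>_pos a by (simp add: g_def D_def Y_def)
  moreover have "g r \<le> 0" using r by (auto simp: g_def in_Q0_def)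
  ultimately obtain c where c: "0 < c" "g c = 0" "\<And>s. 0 \<le> s \<Longrightarrow> s < c \<Longrightarrow> 0 < g s"
    using first_zero[of 0 r g] r by auto
  then have Q0: "in_Q0 f F s" if "0 \<le> s" "s < c" for s using that by (auto simp: g_def in_Q0_def)
  have nQ: "\<not> in_Q0 f F c" using c(2) by (auto simp: g_def in_Q0_def)
  obtain T where T: "c < T" "flow a T f F" using tsol_extends[OF sol a M c(1)] Q0 by auto
  obtain c' where c': "0 < c'" "c' \<le> c" "\<And>s. 0 \<le> s \<Longrightarrow> s < c' \<Longrightarrow> in_Q0 f F s"
    "D f F c' = 0 \<and> Y F c' < \<kappa> \<and> exits_below f F \<or> 0 < D f F c' \<and> Y F c' = \<kappa> \<and> exits_above f F"
    using flow_exit_cases[OF T(2) c(1) T(1) nQ] by metis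
  then show thesis using exits[of c' T] T by auto
qed

end

section \<open>Trapped solutions and their decay\<close>

context profile_ode
begin

text \<open>\<open>Y = \<kappa>\<close> means
  \<open>F powr m = \<kappa> powr (\<mu> + 1) * r powr (- \<mu> - 1)\<close>; integrating
  \<open>f' = - F powr m\<close> from infinity gives this coefficient, which is
  \<open>K_star\<close>.\<close>

definition K where "K = \<kappa> powr (\<mu> + 1) / \<mu>"

lemma flow_F_powr_m:
  assumes flow: "flow a T f F" and r: "0 < r" "r < T"
  shows "F r powr m = Y F r powr (\<mu> + 1) * r powr (- \<mu> - 1)"
proof -
  have F: "0 < F r" by (rule flow_pos[OF flow r])
  have "F r powr m = (F r powr (k - 1)) powr (\<mu> + 1)"
    using k_gt_1 by (simp add: powr_powr exponents(1)[symmetric])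
  also have "F r powr (k - 1) = Y F r / r" using F r by (simp add: Y_def)
  also have "(Y F r / r) powr (\<mu> + 1) = Y F r powr (\<mu> + 1) / r powr (\<mu> + 1)"
    by (rule powr_divide)
  also have "\<dots> = Y F r powr (\<mu> + 1) * r powr (- (\<mu> + 1))"
    by (simp only: powr_minus_divide) simp
  finally show ?thesis by simp
qed

text \<open>The sign of this derivative is that of \<open>\<kappa> - Y\<close>, so the region
  decides whether the profile can approach the singular one from below or from above.\<close>

lemma flow_singular_difference_deriv:
  assumes flow: "flow a T f F" and r: "0 < r" "r < T"
  shows "((\<lambda>r. f r - K * r powr (- \<mu>)) has_real_derivative
    (\<kappa> powr (\<mu> + 1) - Y F r powr (\<mu> + 1)) * r powr (- \<mu> - 1)) (at r)"
proof -
  have "((\<lambda>r. f r - K * r powr (- \<mu>)) has_real_derivative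
     - (F r powr m) - K * (- \<mu> * r powr (- \<mu> - 1))) (at r)"
    by (intro DERIV_diff DERIV_cmult has_real_derivative_powr flow_deriv(1)[OF flow r]) (use r in auto)
  moreover have "K * \<mu> = \<kappa> powr (\<mu> + 1)" using \<mu>_pos by (simp add: K_def)
  then have "- (F r powr m) - K * (- \<mu> * r powr (- \<mu> - 1))
      = (\<kappa> powr (\<mu> + 1) - Y F r powr (\<mu> + 1)) * r powr (- \<mu> - 1)"
    unfolding flow_F_powr_m[OF flow r] by (simp add: left_diff_distrib mult.assoc[symmetric])
  ultimately show ?thesis by simp
qed

end

locale trapped_profile = profile_ode +
  fixes a :: real and f F :: "real \<Rightarrow> real"
  assumes flow: "\<And>T. flow a T f F" and Q0: "\<And>s. 0 < s \<Longrightarrow> in_Q0 f F s"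
begin

definition W where "W r = \<kappa> - Y F r"
text \<open>The scale-free form of \<open>D\<close>, for which
  \<open>J = F * (X + W)\<close>.\<close>

definition X where "X r = r * D f F r / F r"
definition \<xi> where "\<xi> r = X r / W r"

lemma F_pos: "0 < r \<Longrightarrow> 0 < F r" using flow_pos[OF flow, of r "r + 1"] by simp

lemma D_pos: "0 < r \<Longrightarrow> 0 < D f F r" and W_pos: "0 < r \<Longrightarrow> 0 < W r"
  using Q0 by (auto simp: in_Q0_def W_def)

lemma Y_pos: "0 < r \<Longrightarrow> 0 < Y F r" using F_pos[of r] by (simp add: Y_def)

lemma Y_le: "0 < r \<Longrightarrow> Y F r \<le> \<kappa>" using W_pos[of r] by (simp add: W_def)

lemma X_pos: "0 < r \<Longrightarrow> 0 < X r" using D_pos F_pos by (simp add: X_def)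

lemma \<xi>_pos: "0 < r \<Longrightarrow> 0 < \<xi> r" using X_pos W_pos by (simp add: \<xi>_def)

lemma F_powr_k: "0 < r \<Longrightarrow> F r powr (k - 1) = Y F r / r" using F_pos[of r] by (simp add: Y_def)

lemma F_powr: "0 < r \<Longrightarrow> F r powr e = (Y F r / r) powr (e / (k - 1))"
  using F_pos[of r] k_gt_1 by (simp add: F_powr_k[symmetric] powr_powr)

lemma J_XW: "0 < r \<Longrightarrow> J f F r = F r * (X r + W r)"
  using F_pos[of r] by (simp add: J_eq X_def W_def algebra_simps)

lemma W_deriv:
  assumes r: "0 < r"
  shows "(W has_real_derivative - ((k - 1) * Y F r * (X r + W r) / r)) (at r)"
proof -
  have "F r powr (k - 2) * F r = Y F r / r"
    using powr_add[of "F r" "k - 2" 1] F_pos[OF r] F_powr_k[OF r] by simp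
  then have "(k - 1) * F r powr (k - 2) * J f F r = (k - 1) * Y F r * (X r + W r) / r"
    unfolding J_XW[OF r] by (metis (no_types, lifting) mult.assoc times_divide_eq_left times_divide_eq_right)
  moreover have "(Y F has_real_derivative (k - 1) * F r powr (k - 2) * J f F r) (at r)"
    using flow_Y_deriv[OF flow r, of "r + 1"] by simp
  ultimately show ?thesis unfolding W_def[abs_def] by (auto intro!: derivative_eq_intros)
qed

lemma X_deriv:
  assumes r: "0 < r"
  shows "(X has_real_derivative
    (X r * (1 + d + Y F r - X r) - \<beta> * m * (r\<^sup>2 * F r powr (m - 1)) * (X r + W r)) / r) (at r)"
proof -
  note F = F_pos[OF r]
  let ?F' = "D f F r - F r powr k - d / r * F r" and ?D' = "- (\<beta> * m * F r powr (m - 1) * J f F r)"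
  have "((\<lambda>r. r * D f F r / F r) has_real_derivative
     ((1 * D f F r + ?D' * r) * F r - (r * D f F r) * ?F') / (F r * F r)) (at r)"
    by (intro DERIV_divide DERIV_mult DERIV_ident flow_D_deriv[OF flow r, of "r + 1"]
        flow_deriv(2)[OF flow r, of "r + 1"]) (use F in auto)
  moreover have "?F' = F r * (X r - Y F r - d) / r"
  proof -
    have "F r powr k = Y F r / r * F r"
      using powr_add[of "F r" "k - 1" 1] F F_powr_k[OF r] by simp
    then show ?thesis using r F by (simp add: X_def field_simps)
  qed
  moreover have "D f F r = X r * F r / r" using r F by (simp add: X_def)
  ultimately have *: "(X has_real_derivative ((1 * (X r * F r / r) + ?D' * r) * F r
      - (r * (X r * F r / r)) * (F r * (X r - Y F r - d) / r)) / (F r * F r)) (at r)"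
    unfolding X_def[abs_def] by simp
  show ?thesis
    by (rule DERIV_cong[OF *])
      (use r F in \<open>simp add: J_XW[OF r] field_simps power2_eq_square\<close>)
qed

lemma \<xi>_deriv:
  assumes r: "0 < r"
  defines "V \<equiv> r\<^sup>2 * F r powr (m - 1)"
  shows "(\<xi> has_real_derivative
    (\<xi> r * (1 + d + Y F r - \<xi> r * W r) - \<beta> * m * V * (1 + \<xi> r) + (k - 1) * Y F r * (1 + \<xi> r) * \<xi> r) / r) (at r)"
proof -
  have X: "X r = \<xi> r * W r" using W_pos[OF r] by (simp add: \<xi>_def)
  let ?X' = "(X r * (1 + d + Y F r - X r) - \<beta> * m * V * (X r + W r)) / r"
  have "(\<xi> has_real_derivative (?X' * W r - X r * - ((k - 1) * Y F r * (X r + W r) / r)) / (W r * W r)) (at r)"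
    unfolding \<xi>_def[abs_def] V_def
    by (intro DERIV_divide X_deriv W_deriv r) (use W_pos[OF r] in auto)
  then show ?thesis
    by (rule DERIV_cong) (use r W_pos[OF r] in \<open>simp add: X field_simps\<close>)
qed

text \<open>This is the coefficient of the damping in the equation for \<open>X\<close>; it vanishes
  at infinity because \<open>\<nu> > 0\<close> and \<open>Y\<close> is bounded.\<close>

lemma V_eq:
  assumes "0 < r" shows "r\<^sup>2 * F r powr (m - 1) = r powr (- \<nu>) * Y F r powr (\<nu> + 2)"
proof -
  have "F r powr (m - 1) = (Y F r / r) powr (\<nu> + 2)"
    using F_powr[OF assms, of "m - 1"] exponents by simp
  also have "\<dots> = Y F r powr (\<nu> + 2) / (r powr \<nu> * r\<^sup>2)"
    using assms Y_pos[OF assms] by (simp add: powr_divide powr_add)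
  finally show ?thesis using assms by (simp add: powr_minus_divide)
qed

lemma Y_mono:
  assumes "0 < r" "r \<le> s" shows "Y F r \<le> Y F s"
proof (cases "r = s")
  case False
  show ?thesis
    using flow_Q0_monotone(2)[OF flow, of r s "s + 1"] assms False Q0 by (auto simp: in_Q0_def less_imp_le)
qed simp

text \<open>A lower bound for \<open>(k - 1) * Y\<close> from radius 1 on, because \<open>Y\<close>
  increases.\<close>

definition c\<^sub>1 where "c\<^sub>1 = (k - 1) * Y F 1"

lemma c1_pos: "0 < c\<^sub>1" using Y_pos[of 1] k_gt_1 by (simp add: c\<^sub>1_def)

text \<open>Dropping \<open>X > 0\<close> from the equation for \<open>W\<close> leaves
  \<open>r * W' \<le> - c\<^sub>1 * W\<close>. The exponent is not sharp, but it makes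
  \<open>W / r\<close> integrable, which is enough to find the true rate later.\<close>

lemma W_decay: "1 \<le> r \<Longrightarrow> W r \<le> \<kappa> * r powr (- c\<^sub>1)"
proof -
  assume r: "1 \<le> r"
  have "W r * r powr c\<^sub>1 \<le> W 1 * 1 powr c\<^sub>1"
  proof (rule DERIV_nonpos_imp_nonincreasing[OF r])
    fix s :: real assume "1 \<le> s" "s \<le> r"
    then have s: "0 < s" "1 \<le> s" by auto
    let ?l = "- ((k - 1) * Y F s * (X s + W s) / s)"
    have "((\<lambda>r. W r * r powr c\<^sub>1) has_real_derivative
        ?l * s powr c\<^sub>1 + c\<^sub>1 * s powr (c\<^sub>1 - 1) * W s) (at s)"
      by (rule DERIV_mult[OF W_deriv[OF s(1)] has_real_derivative_powr[OF s(1)]])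
    moreover have "?l * s powr c\<^sub>1 + c\<^sub>1 * s powr (c\<^sub>1 - 1) * W s \<le> 0"
    proof -
      have "c\<^sub>1 * W s \<le> (k - 1) * Y F s * (X s + W s)"
        unfolding c\<^sub>1_def using Y_mono[of 1 s] s k_gt_1 X_pos[OF s(1)] W_pos[OF s(1)] Y_pos[of 1]
        by (intro mult_mono) auto
      then have h: "(c\<^sub>1 * W s - (k - 1) * Y F s * (X s + W s)) * s powr (c\<^sub>1 - 1) \<le> 0"
        by (intro mult_nonpos_nonneg) auto
      have "s powr c\<^sub>1 / s = s powr (c\<^sub>1 - 1)" using s by (simp add: powr_diff)
      then have h': "?l * s powr c\<^sub>1 = - ((k - 1) * Y F s * (X s + W s)) * s powr (c\<^sub>1 - 1)"
        by (metis minus_mult_left times_divide_eq_left times_divide_eq_right)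
      show ?thesis unfolding h' using h by (simp add: algebra_simps)
    qed
    ultimately show "\<exists>y. ((\<lambda>r. W r * r powr c\<^sub>1) has_real_derivative y) (at s) \<and> y \<le> 0" by blast
  qed
  also have "\<dots> \<le> \<kappa>" using Y_pos[of 1] by (simp add: W_def)
  finally show ?thesis using r by (simp add: powr_minus_divide le_divide_eq)
qed

definition B where "B = \<beta> * m * \<kappa> powr (\<nu> + 2)"

lemma B_pos: "0 < B" using \<beta>_pos m_gt \<kappa>_pos by (simp add: B_def)

lemma V_bound:
  assumes "0 < r" shows "\<beta> * m * (r\<^sup>2 * F r powr (m - 1)) \<le> B * r powr (- \<nu>)"
proof -
  have "Y F r powr (\<nu> + 2) \<le> \<kappa> powr (\<nu> + 2)"
    using Y_pos[OF assms] Y_le[OF assms] \<nu>_pos by (intro powr_mono2) auto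
  then have "\<beta> * m * (r powr (- \<nu>) * Y F r powr (\<nu> + 2)) \<le> \<beta> * m * (r powr (- \<nu>) * \<kappa> powr (\<nu> + 2))"
    using \<beta>_pos m_gt by (intro mult_left_mono) auto
  then show ?thesis unfolding V_eq[OF assms] by (simp add: B_def mult_ac)
qed

text \<open>The decay of \<open>W\<close> in the denominator of \<open>\<xi>\<close> supplies at
  least \<open>c\<^sub>1 * \<xi>\<^sup>2\<close>, of which \<open>W \<le> c\<^sub>1 / 2\<close>
  costs half. Half of the linear term pays for the damping, whose coefficient is at most 1/2 for
  large \<open>r\<close>.\<close>

lemma \<xi>_riccati:
  obtains r\<^sub>1 \<xi>' where "1 \<le> r\<^sub>1" "\<And>r. r\<^sub>1 \<le> r \<Longrightarrow> (\<xi> has_real_derivative \<xi>' r) (at r)"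
    "\<And>r. r\<^sub>1 \<le> r \<Longrightarrow> \<xi> r / 2 - B * r powr (- \<nu>) + c\<^sub>1 / 2 * (\<xi> r)\<^sup>2 \<le> r * \<xi>' r"
proof -
  have t: "((\<lambda>r. \<kappa> * r powr (- c\<^sub>1)) \<longlongrightarrow> 0) at_top" "((\<lambda>r. B * r powr (- \<nu>)) \<longlongrightarrow> 0) at_top"
    by (intro tendsto_mult_right_zero tendsto_powr_neg_at_top c1_pos \<nu>_pos)+
  have "\<forall>\<^sub>F r in at_top. \<kappa> * r powr (- c\<^sub>1) < c\<^sub>1 / 2"
    by (rule order_tendstoD(2)[OF t(1)]) (use c1_pos in simp)
  moreover have "\<forall>\<^sub>F r in at_top. B * r powr (- \<nu>) < 1 / 2"
    by (rule order_tendstoD(2)[OF t(2)]) simp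
  ultimately have "\<forall>\<^sub>F r in at_top. \<kappa> * r powr (- c\<^sub>1) < c\<^sub>1 / 2 \<and> B * r powr (- \<nu>) < 1 / 2"
    by eventually_elim blast
  then obtain r0 where r0: "\<forall>r\<ge>r0. \<kappa> * r powr (- c\<^sub>1) < c\<^sub>1 / 2 \<and> B * r powr (- \<nu>) < 1 / 2"
    unfolding eventually_at_top_linorder by blast
  define r1 where "r1 = max 1 r0"
  define \<xi>' where "\<xi>' r = (\<xi> r * (1 + d + Y F r - \<xi> r * W r)
    - \<beta> * m * (r\<^sup>2 * F r powr (m - 1)) * (1 + \<xi> r) + (k - 1) * Y F r * (1 + \<xi> r) * \<xi> r) / r" for r
  show thesis
  proof
    show "1 \<le> r1" by (simp add: r1_def)
    fix r assume "r1 \<le> r"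
    then have r: "0 < r" "1 \<le> r" "r0 \<le> r" by (auto simp: r1_def)
    show "(\<xi> has_real_derivative \<xi>' r) (at r)" unfolding \<xi>'_def by (rule \<xi>_deriv[OF r(1)])
    define x y w v where "x = \<xi> r" and "y = Y F r" and "w = W r" and "v = \<beta> * m * (r\<^sup>2 * F r powr (m - 1))"
    have x: "0 < x" using \<xi>_pos[OF r(1)] by (simp add: x_def)
    have w: "0 < w" "w \<le> c\<^sub>1 / 2"
      using W_pos[OF r(1)] W_decay[OF r(2)] r0 r(3) by (auto simp: w_def dest!: spec[of _ r])
    have v: "v \<le> B * r powr (- \<nu>)" "v \<le> 1 / 2"
      using V_bound[OF r(1)] r0 r(3) by (auto simp: v_def dest!: spec[of _ r])
    have y: "c\<^sub>1 \<le> (k - 1) * y" "0 < y"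
      using Y_mono[of 1 r] r k_gt_1 Y_pos[OF r(1)] by (auto simp: y_def c\<^sub>1_def)
    have eq: "r * \<xi>' r = x * (1 + d + y - x * w) - v * (1 + x) + (k - 1) * y * (1 + x) * x"
      using r unfolding \<xi>'_def x_def y_def w_def v_def by simp
    have "x * x * w \<le> x * x * (c\<^sub>1 / 2)" using w by (intro mult_left_mono) auto
    moreover have "v * x \<le> 1 / 2 * x" using v x by (intro mult_right_mono) auto
    moreover have "c\<^sub>1 * (x * x) \<le> (k - 1) * y * (x * x)" using y by (intro mult_right_mono) auto
    moreover have "0 \<le> x * (d + y)" "0 \<le> (k - 1) * y * x" using x y k_gt_1 by auto
    ultimately have "x / 2 - B * r powr (- \<nu>) + c\<^sub>1 / 2 * (x * x) \<le> r * \<xi>' r"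
      unfolding eq using v(1) by (simp add: algebra_simps)
    then show "\<xi> r / 2 - B * r powr (- \<nu>) + c\<^sub>1 / 2 * (\<xi> r)\<^sup>2 \<le> r * \<xi>' r"
      by (simp add: x_def power2_eq_square)
  qed
qed

text \<open>If \<open>\<xi>\<close> were not \<open>O(r\<^sup>-\<^sup>\<nu>)\<close>, it would grow like \<open>r\<^sup>1\<^sup>/\<^sup>2\<close>, and then the quadratic term
  of the Riccati inequality would make it blow up at a finite radius.\<close>

lemma \<xi>_decay: "\<exists>c r\<^sub>1. 0 \<le> c \<and> 1 \<le> r\<^sub>1 \<and> (\<forall>r\<ge>r\<^sub>1. \<xi> r \<le> c * r powr (- \<nu>))"
proof -
  obtain r1 \<xi>' where r1: "1 \<le> r1" and d\<xi>: "\<And>r. r1 \<le> r \<Longrightarrow> (\<xi> has_real_derivative \<xi>' r) (at r)"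
    and ric: "\<And>r. r1 \<le> r \<Longrightarrow> \<xi> r / 2 - B * r powr (- \<nu>) + c\<^sub>1 / 2 * (\<xi> r)\<^sup>2 \<le> r * \<xi>' r"
    by (rule \<xi>_riccati) (rule that; assumption?)
  \<comment> \<open>Chosen so that \<open>c * r powr (- \<nu>)\<close> solves the linear equation
    \<open>r * u' = u / 2 - B * r powr (- \<nu>)\<close>.\<close>
  define c where "c = B / (\<nu> + 1/2)"
  have c: "0 < c" "c * (\<nu> + 1/2) = B" using B_pos \<nu>_pos by (auto simp: c_def)
  \<comment> \<open>The difference to that solution times the integrating factor
    \<open>r powr (- 1/2)\<close>; the quadratic term only helps to make it nondecreasing.\<close>
  define Z where "Z r = r powr (- 1/2) * \<xi> r - c * r powr (- \<nu> - 1/2)" for r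
  have Zmono: "Z x \<le> Z y" if xy: "r1 \<le> x" "x \<le> y" for x y
  proof (rule DERIV_nonneg_imp_nondecreasing[OF xy(2)])
    fix r assume "x \<le> r" "r \<le> y"
    then have r: "r1 \<le> r" "0 < r" using xy r1 by auto
    have dZ: "(Z has_real_derivative (- 1/2 * r powr (- 1/2 - 1) * \<xi> r + \<xi>' r * r powr (- 1/2))
        - c * ((- \<nu> - 1/2) * r powr (- \<nu> - 1/2 - 1))) (at r)"
      unfolding Z_def
      by (intro DERIV_diff DERIV_mult DERIV_cmult has_real_derivative_powr d\<xi> r)
    have p: "r powr (- 1/2) = r powr (- 3/2) * r" "r powr (- \<nu> - 1/2 - 1) = r powr (- 3/2) * r powr (- \<nu>)"
      using r powr_add[of r "- 3/2" 1] powr_add[of r "- 3/2" "- \<nu>"] by (simp_all add: algebra_simps)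
    have "(- 1/2 * r powr (- 1/2 - 1) * \<xi> r + \<xi>' r * r powr (- 1/2)) - c * ((- \<nu> - 1/2) * r powr (- \<nu> - 1/2 - 1))
       = r powr (- 3/2) * (r * \<xi>' r - \<xi> r / 2 + (c * (\<nu> + 1/2)) * r powr (- \<nu>))"
      unfolding p by (simp add: algebra_simps)
    also have "\<dots> \<ge> 0"
    proof (rule mult_nonneg_nonneg)
      have "0 \<le> c\<^sub>1 / 2 * (\<xi> r)\<^sup>2" using c1_pos by simp
      then show "0 \<le> r * \<xi>' r - \<xi> r / 2 + c * (\<nu> + 1/2) * r powr (- \<nu>)"
        using ric[OF r(1)] unfolding c(2) by linarith
    qed simp
    finally show "\<exists>z. (Z has_real_derivative z) (at r) \<and> 0 \<le> z" using dZ by blast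
  qed
  have "Z r3 \<le> 0" if r3: "r1 \<le> r3" for r3
  proof (rule ccontr)
    assume "\<not> Z r3 \<le> 0"
    then have z: "0 < Z r3" by simp
    have big: "Z r3 * r powr (1/2) \<le> \<xi> r" if "r3 \<le> r" for r
    proof -
      have r: "0 < r" using that r3 r1 by simp
      have "Z r3 \<le> r powr (- 1/2) * \<xi> r" using Zmono[OF r3 that] c by (auto simp: Z_def intro: order_trans)
      then have "Z r3 * r powr (1/2) \<le> r powr (- 1/2) * \<xi> r * r powr (1/2)" by (rule mult_right_mono) simp
      also have "\<dots> = \<xi> r" using powr_add[of r "- 1/2" "1/2"] r by (simp add: mult_ac)
      finally show ?thesis .
    qed
    have "((\<lambda>r. B * r powr (- \<nu>)) \<longlongrightarrow> 0) at_top"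
      by (intro tendsto_mult_right_zero tendsto_powr_neg_at_top \<nu>_pos)
    then have "\<forall>\<^sub>F r in at_top. B * r powr (- \<nu>) < Z r3 / 2"
      by (rule order_tendstoD(2)) (use z in simp)
    then obtain r0 where r0: "\<forall>r\<ge>r0. B * r powr (- \<nu>) < Z r3 / 2"
      unfolding eventually_at_top_linorder by blast
    define r4 where "r4 = max r0 r3"
    have r4: "r1 \<le> r4" "0 < r4" using r3 r1 by (auto simp: r4_def)
    \<comment> \<open>\<open>\<xi>' / \<xi>\<^sup>2 \<ge> c\<^sub>1 / (2 * s)\<close> integrates to
      a logarithm, which would push \<open>1 / \<xi>\<close> below 0.\<close>
    have mono: "c\<^sub>1 / 2 * ln r + 1 / \<xi> r \<le> c\<^sub>1 / 2 * ln r4 + 1 / \<xi> r4" if "r4 \<le> r" for r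
    proof (rule DERIV_nonpos_imp_nonincreasing[OF that])
      fix s assume "r4 \<le> s" "s \<le> r"
      then have s: "r1 \<le> s" "0 < s" "r0 \<le> s" "r3 \<le> s" "1 \<le> s" using r4 r1 by (auto simp: r4_def)
      have \<xi>s: "0 < \<xi> s" by (rule \<xi>_pos[OF s(2)])
      have "Z r3 * 1 \<le> Z r3 * s powr (1/2)" using z s(5) by (intro mult_left_mono ge_one_powr_ge_zero) auto
      then have "B * s powr (- \<nu>) \<le> \<xi> s / 2" using r0 s(3) big[OF s(4)] by (auto dest!: spec[of _ s])
      then have "c\<^sub>1 / 2 * (\<xi> s)\<^sup>2 \<le> s * \<xi>' s" using ric[OF s(1)] by linarith
      then have "c\<^sub>1 / 2 * (1 / s) - \<xi>' s / (\<xi> s)\<^sup>2 \<le> 0" using s(2) \<xi>s by (simp add: field_simps)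
      moreover have "((\<lambda>r. c\<^sub>1 / 2 * ln r + 1 / \<xi> r) has_real_derivative c\<^sub>1 / 2 * (1 / s) - \<xi>' s / (\<xi> s)\<^sup>2) (at s)"
        using s(2) \<xi>s d\<xi>[OF s(1)] by (auto intro!: derivative_eq_intros simp: power2_eq_square)
      ultimately show "\<exists>y. ((\<lambda>r. c\<^sub>1 / 2 * ln r + 1 / \<xi> r) has_real_derivative y) (at s) \<and> y \<le> 0" by blast
    qed
    have "filterlim (\<lambda>r. c\<^sub>1 / 2 * ln r) at_top at_top"
      using c1_pos by (intro filterlim_tendsto_pos_mult_at_top[OF tendsto_const] ln_at_top) auto
    then have "\<forall>\<^sub>F r in at_top. c\<^sub>1 / 2 * ln r4 + 1 / \<xi> r4 < c\<^sub>1 / 2 * ln r"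
      unfolding filterlim_at_top_dense by blast
    then have "\<forall>\<^sub>F r in at_top. c\<^sub>1 / 2 * ln r4 + 1 / \<xi> r4 < c\<^sub>1 / 2 * ln r \<and> r4 \<le> r"
      using eventually_ge_at_top by (rule eventually_conj)
    then obtain r where "c\<^sub>1 / 2 * ln r4 + 1 / \<xi> r4 < c\<^sub>1 / 2 * ln r" "r4 \<le> r"
      using eventually_happens'[OF trivial_limit_at_top_linorder] by blast
    moreover have "0 < 1 / \<xi> r" using \<xi>_pos[of r] r4 \<open>r4 \<le> r\<close> by simp
    ultimately show False using mono[of r] by linarith
  qed
  then have "\<xi> r \<le> c * r powr (- \<nu>)" if "r1 \<le> r" for r
  proof -
    have r: "0 < r" using that r1 by simp
    have "r powr (- 1/2) * \<xi> r \<le> r powr (- 1/2) * (c * r powr (- \<nu>))"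
      using \<open>\<And>r3. r1 \<le> r3 \<Longrightarrow> Z r3 \<le> 0\<close>[OF that] powr_add[of r "- \<nu>" "- 1/2"] by (simp add: Z_def mult_ac)
    then show ?thesis using r by (simp add: mult_le_cancel_left_pos)
  qed
  then show ?thesis using c(1) r1 by (intro exI[of _ c] exI[of _ r1]) auto
qed

text \<open>With \<open>\<theta> = (k - 1) * \<kappa>\<close> the derivative of
  \<open>ln (W * r powr \<theta>)\<close> is \<open>(k - 1) * (W - Y * \<xi>) / r\<close>. Both
  terms are bounded by decaying powers, so the logarithm converges; its finite limit is what makes
  \<open>A\<close> positive.\<close>

lemma W_rate: "\<exists>A>0. ((\<lambda>r. W r * r powr \<theta>) \<longlongrightarrow> A) at_top"
proof -
  obtain c r1 where c: "0 \<le> c" "1 \<le> r1" and \<xi>c: "\<forall>r\<ge>r1. \<xi> r \<le> c * r powr (- \<nu>)"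
    using \<xi>_decay by blast
  define L where "L r = ln (W r) + \<theta> * ln r" for r
  define e where "e = min c\<^sub>1 \<nu>"
  have e: "0 < e" "e \<le> c\<^sub>1" "e \<le> \<nu>" using c1_pos \<nu>_pos by (auto simp: e_def)
  have "\<exists>l. (L \<longlongrightarrow> l) at_top"
  proof (rule converges_of_deriv_bound[of r1 e])
    fix r assume "r1 \<le> r"
    then have r: "0 < r" "1 \<le> r" "r1 \<le> r" using c by auto
    have W: "0 < W r" by (rule W_pos[OF r(1)])
    have X: "X r = \<xi> r * W r" using W by (simp add: \<xi>_def)
    have "(L has_real_derivative
        1 / W r * - ((k - 1) * Y F r * (X r + W r) / r) + \<theta> * (1 / r)) (at r)"
      unfolding L_def
      by (intro DERIV_add DERIV_cmult DERIV_chain2[OF DERIV_ln_divide W_deriv] DERIV_ln_divide W r)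
    then show "(L has_real_derivative (k - 1) * (W r - Y F r * \<xi> r) / r) (at r)"
      by (rule DERIV_cong) (use r W in \<open>simp add: X \<theta>_def, simp add: W_def field_simps\<close>)
    have "r powr (- c\<^sub>1) \<le> r powr (- e)" "r powr (- \<nu>) \<le> r powr (- e)"
      using e r by (auto intro!: powr_mono)
    then have 1: "W r \<le> \<kappa> * r powr (- e)" "\<xi> r \<le> c * r powr (- e)"
      using W_decay[OF r(2)] \<xi>c r(3) \<kappa>_pos c(1) by (auto intro: order_trans mult_left_mono)
    have 2: "Y F r * \<xi> r \<le> \<kappa> * (c * r powr (- e))"
      using Y_le[OF r(1)] Y_pos[OF r(1)] 1(2) \<xi>_pos[OF r(1)] \<kappa>_pos by (intro mult_mono) auto
    have 3: "0 < Y F r * \<xi> r" using Y_pos[OF r(1)] \<xi>_pos[OF r(1)] by simp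
    have "\<bar>W r - Y F r * \<xi> r\<bar> \<le> \<kappa> * r powr (- e) + \<kappa> * (c * r powr (- e))"
      using 1(1) 2 3 W by linarith
    then have "(k - 1) * \<bar>W r - Y F r * \<xi> r\<bar> / r \<le> (k - 1) * (\<kappa> * r powr (- e) + \<kappa> * (c * r powr (- e))) / r"
      using k_gt_1 r by (intro divide_right_mono mult_left_mono) auto
    also have "\<dots> = ((k - 1) * \<kappa> * (1 + c)) * r powr (- e - 1)"
      using r by (simp add: powr_diff field_simps)
    finally show "\<bar>(k - 1) * (W r - Y F r * \<xi> r) / r\<bar> \<le> ((k - 1) * \<kappa> * (1 + c)) * r powr (- e - 1)"
      using k_gt_1 r by (simp add: abs_mult)
  qed (use c e in auto)
  then obtain l where "(L \<longlongrightarrow> l) at_top" by blast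
  then have "((\<lambda>r. exp (L r)) \<longlongrightarrow> exp l) at_top" by (intro tendsto_exp)
  moreover have "\<forall>\<^sub>F r in at_top. exp (L r) = W r * r powr \<theta>"
    using eventually_gt_at_top[of 0]
  proof eventually_elim
    case (elim r)
    then show ?case using W_pos[of r] by (simp add: L_def exp_add powr_def)
  qed
  ultimately have "((\<lambda>r. W r * r powr \<theta>) \<longlongrightarrow> exp l) at_top" by (rule Lim_transform_eventually)
  then show ?thesis by (intro exI[of _ "exp l"]) auto
qed

lemma f_pos: "0 < r \<Longrightarrow> 0 < f r"
proof -
  assume r: "0 < r"
  have "\<alpha> * f r = D f F r + \<beta> * r * F r powr m" using F_pos[OF r] by (simp add: D_def spow_pos)
  also have "\<dots> > 0" using D_pos[OF r] \<beta>_pos r by (intro add_pos_nonneg) auto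
  finally show ?thesis using \<alpha>_pos by (simp add: zero_less_mult_iff)
qed

text \<open>Monotonicity alone would not exclude a positive limit. Here \<open>\<alpha> * f\<close>
  is written as \<open>D + \<beta> * r * F powr m\<close> with \<open>D = \<xi> * W * F / r\<close>,
  and \<open>Y \<le> \<kappa>\<close> bounds both parts by decaying powers.\<close>

lemma f_tendsto_0: "(f \<longlongrightarrow> 0) at_top"
proof -
  obtain c r1 where c: "0 \<le> c" "1 \<le> r1" and \<xi>c: "\<forall>r\<ge>r1. \<xi> r \<le> c * r powr (- \<nu>)"
    using \<xi>_decay by blast
  define e where "e = 1 / (k - 1)"
  have e: "0 < e" using k_gt_1 by (simp add: e_def)
  define u where "u r = (c * \<kappa> * (\<kappa> powr e * r powr (- e)) + \<beta> * (\<kappa> powr (\<mu> + 1) * r powr (- \<mu>))) / \<alpha>" for r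
  have "f r \<le> u r" if "r1 \<le> r" for r
  proof -
    have r: "0 < r" "1 \<le> r" using c that by auto
    have "\<alpha> * f r = \<xi> r * W r * (F r / r) + \<beta> * (r * F r powr m)"
      using F_pos[OF r(1)] W_pos[OF r(1)] r by (simp add: \<xi>_def X_def D_def spow_pos)
    also have "\<dots> \<le> c * \<kappa> * (\<kappa> powr e * r powr (- e)) + \<beta> * (\<kappa> powr (\<mu> + 1) * r powr (- \<mu>))"
    proof -
      have "c * r powr (- \<nu>) \<le> c * 1" using c \<nu>_pos r powr_mono[of "- \<nu>" 0 r] by (intro mult_left_mono) auto
      then have 1: "\<xi> r \<le> c" using \<xi>c that by (auto dest!: spec[of _ r])
      have 2: "W r \<le> \<kappa>" using Y_pos[OF r(1)] by (simp add: W_def)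
      have "F r = (Y F r / r) powr e" using F_powr[OF r(1), of 1] F_pos[OF r(1)] by (simp add: e_def)
      also have "\<dots> \<le> (\<kappa> / r) powr e"
        using e Y_le[OF r(1)] Y_pos[OF r(1)] r by (intro powr_mono2 divide_right_mono) auto
      also have "\<dots> = \<kappa> powr e * r powr (- e)" using \<kappa>_pos r by (simp add: powr_divide powr_minus_divide)
      finally have "F r \<le> \<kappa> powr e * r powr (- e)" .
      moreover have "F r / r \<le> F r" using F_pos[OF r(1)] r by (simp add: divide_le_eq)
      ultimately have 3: "F r / r \<le> \<kappa> powr e * r powr (- e)" by linarith
      have "r * r powr (- \<mu> - 1) = r powr (- \<mu>)" using powr_add[of r 1 "- \<mu> - 1"] r by simp
      then have "r * F r powr m = Y F r powr (\<mu> + 1) * r powr (- \<mu>)"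
        unfolding flow_F_powr_m[OF flow r(1) less_add_one] by (simp add: mult_ac)
      also have "\<dots> \<le> \<kappa> powr (\<mu> + 1) * r powr (- \<mu>)"
        using Y_le[OF r(1)] Y_pos[OF r(1)] \<mu>_pos by (intro mult_right_mono powr_mono2) auto
      finally have 4: "r * F r powr m \<le> \<kappa> powr (\<mu> + 1) * r powr (- \<mu>)" .
      have "\<xi> r * W r \<le> c * \<kappa>"
        using 1 2 c W_pos[OF r(1)] by (intro mult_mono) auto
      then have "\<xi> r * W r * (F r / r) \<le> c * \<kappa> * (\<kappa> powr e * r powr (- e))"
        by (rule mult_mono[OF _ 3]) (use c \<kappa>_pos F_pos[OF r(1)] r in auto)
      moreover have "\<beta> * (r * F r powr m) \<le> \<beta> * (\<kappa> powr (\<mu> + 1) * r powr (- \<mu>))"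
        using 4 \<beta>_pos by (intro mult_left_mono) auto
      ultimately show ?thesis by (rule add_mono)
    qed
    finally show ?thesis using \<alpha>_pos by (simp add: u_def le_divide_eq mult.commute)
  qed
  then have up: "\<forall>\<^sub>F r in at_top. f r \<le> u r"
    unfolding eventually_at_top_linorder by blast
  have lo: "\<forall>\<^sub>F r in at_top. 0 \<le> f r"
    using eventually_gt_at_top[of 0] by (rule eventually_mono) (simp add: f_pos less_imp_le)
  have "(u \<longlongrightarrow> (c * \<kappa> * (\<kappa> powr e * 0) + \<beta> * (\<kappa> powr (\<mu> + 1) * 0)) / \<alpha>) at_top"
    unfolding u_def
    by (intro tendsto_intros tendsto_powr_neg_at_top e \<mu>_pos) (use \<alpha>_pos in auto)
  then have "(u \<longlongrightarrow> 0) at_top" by simp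
  then show ?thesis by (rule tendsto_sandwich[OF lo up tendsto_const])
qed

lemma W_tendsto_0: "(W \<longlongrightarrow> 0) at_top"
proof (rule tendsto_sandwich[OF _ _ tendsto_const])
  show "\<forall>\<^sub>F r in at_top. 0 \<le> W r"
    using eventually_gt_at_top[of 0] by (rule eventually_mono) (simp add: W_pos less_imp_le)
  show "\<forall>\<^sub>F r in at_top. W r \<le> \<kappa> * r powr (- c\<^sub>1)"
    using eventually_ge_at_top[of 1] by (rule eventually_mono) (rule W_decay)
  show "((\<lambda>r. \<kappa> * r powr (- c\<^sub>1)) \<longlongrightarrow> 0) at_top"
    by (intro tendsto_mult_right_zero tendsto_powr_neg_at_top c1_pos)
qed

text \<open>The quotient of \<open>f - K * r powr (- \<mu>)\<close> and
  \<open>r powr (- (\<mu> + \<theta>))\<close> is found from the derivatives, where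
  \<open>\<kappa> powr (\<mu> + 1) - Y powr (\<mu> + 1)\<close> is to first order
  \<open>(\<mu> + 1) * \<kappa> powr \<mu> * W\<close>. The minus sign comes from the decreasing
  denominator.\<close>

lemma asymptotics: "\<exists>A>0. ((\<lambda>r. (r powr \<mu> * f r - K) * r powr \<theta>) \<longlongrightarrow> - A) at_top"
proof -
  obtain A0 where A0: "0 < A0" "((\<lambda>r. W r * r powr \<theta>) \<longlongrightarrow> A0) at_top" using W_rate by blast
  define A where "A = (\<mu> + 1) * \<kappa> powr \<mu> * A0 / (\<mu> + \<theta>)"
  have A: "0 < A" using A0(1) \<mu>_pos \<theta>_pos \<kappa>_pos by (simp add: A_def)
  define g h where "g r = f r - K * r powr (- \<mu>)" and "h r = r powr (- (\<mu> + \<theta>))" for r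
  define g' where "g' r = (\<kappa> powr (\<mu> + 1) - Y F r powr (\<mu> + 1)) * r powr (- \<mu> - 1)" for r
  define h' where "h' r = - (\<mu> + \<theta>) * r powr (- (\<mu> + \<theta>) - 1)" for r
  have "((\<lambda>r. g r / h r) \<longlongrightarrow> - A) at_top"
  proof (rule lhospital_0_0_at_top[of 1])
    fix r :: real assume "1 \<le> r"
    then have r: "0 < r" by simp
    show "(g has_real_derivative g' r) (at r)"
      unfolding g_def g'_def by (rule flow_singular_difference_deriv[OF flow r less_add_one])
    show "(h has_real_derivative h' r) (at r)"
      unfolding h_def h'_def by (rule has_real_derivative_powr[OF r])
    show "h' r < 0" using r \<mu>_pos \<theta>_pos by (simp add: h'_def mult_neg_pos)
    show "0 < h r" using r by (simp add: h_def)
  next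
    have "(g \<longlongrightarrow> 0 - K * 0) at_top"
      unfolding g_def by (intro tendsto_intros f_tendsto_0 tendsto_powr_neg_at_top \<mu>_pos)
    then show "(g \<longlongrightarrow> 0) at_top" by simp
    show "(h \<longlongrightarrow> 0) at_top"
      unfolding h_def by (intro tendsto_powr_neg_at_top) (use \<mu>_pos \<theta>_pos in simp)
    \<comment> \<open>The difference quotient of \<open>x powr (\<mu> + 1)\<close> at
      \<open>\<kappa>\<close>, taken along the increment \<open>- W\<close>, which is not 0 for
      positive radii.\<close>
    have "((\<lambda>x. ((\<kappa> + x) powr (\<mu> + 1) - \<kappa> powr (\<mu> + 1)) / x) \<longlongrightarrow> (\<mu> + 1) * \<kappa> powr (\<mu> + 1 - 1)) (at 0)"
      using has_real_derivative_powr[OF \<kappa>_pos, of "\<mu> + 1"] by (simp add: DERIV_def)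
    moreover have "filterlim (\<lambda>r. - W r) (at 0) at_top"
    proof (rule filterlim_atI)
      show "((\<lambda>r. - W r) \<longlongrightarrow> 0) at_top" using tendsto_minus[OF W_tendsto_0] by simp
      show "\<forall>\<^sub>F r in at_top. - W r \<noteq> 0"
        using eventually_gt_at_top[of 0] by (rule eventually_mono) (use W_pos in force)
    qed
    ultimately have "((\<lambda>r. ((\<kappa> + - W r) powr (\<mu> + 1) - \<kappa> powr (\<mu> + 1)) / - W r)
        \<longlongrightarrow> (\<mu> + 1) * \<kappa> powr (\<mu> + 1 - 1)) at_top"
      by (rule filterlim_compose)
    then have t: "((\<lambda>r. ((\<kappa> + - W r) powr (\<mu> + 1) - \<kappa> powr (\<mu> + 1)) / - W r * (W r * r powr \<theta>) * (- 1 / (\<mu> + \<theta>)))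
        \<longlongrightarrow> (\<mu> + 1) * \<kappa> powr (\<mu> + 1 - 1) * A0 * (- 1 / (\<mu> + \<theta>))) at_top"
      by (intro tendsto_mult[OF _ tendsto_const] tendsto_mult[OF _ A0(2)])
    have A_eq: "(\<mu> + 1) * \<kappa> powr (\<mu> + 1 - 1) * A0 * (- 1 / (\<mu> + \<theta>)) = - A" by (simp add: A_def)
    have ev: "\<forall>\<^sub>F r in at_top. ((\<kappa> + - W r) powr (\<mu> + 1) - \<kappa> powr (\<mu> + 1)) / - W r
        * (W r * r powr \<theta>) * (- 1 / (\<mu> + \<theta>)) = g' r / h' r"
      using eventually_gt_at_top[of 0]
    proof eventually_elim
      case (elim r)
      have cancel: "x / - w * (w * t) * (- 1 / n) = - x * (t * q) / (- n * q)"
        if "w \<noteq> 0" "q \<noteq> 0" "n \<noteq> 0" for x w t q n :: real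
        using that by (simp add: field_simps)
      have "W r \<noteq> 0" "r powr (- (\<mu> + \<theta>) - 1) \<noteq> 0" "\<mu> + \<theta> \<noteq> 0"
        using W_pos[OF elim] \<mu>_pos \<theta>_pos elim by auto
      note * = cancel[OF this]
      have "r powr (- \<mu> - 1) = r powr \<theta> * r powr (- (\<mu> + \<theta>) - 1)"
        unfolding powr_add[symmetric] by simp
      moreover have "\<kappa> + - W r = Y F r" by (simp add: W_def)
      ultimately show ?case unfolding g'_def h'_def * by simp
    qed
    show "((\<lambda>r. g' r / h' r) \<longlongrightarrow> - A) at_top"
      using Lim_transform_eventually[OF t ev] unfolding A_eq .
  qed
  moreover have "\<forall>\<^sub>F r in at_top. g r / h r = (r powr \<mu> * f r - K) * r powr \<theta>"
    using eventually_gt_at_top[of 0]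
  proof eventually_elim
    case (elim r)
    have "g r / h r = g r * (r powr \<mu> * r powr \<theta>)"
      unfolding h_def powr_minus powr_add by (simp add: divide_inverse)
    also have "\<dots> = (r powr \<mu> * f r - K * (r powr (- \<mu>) * r powr \<mu>)) * r powr \<theta>"
      by (simp add: g_def algebra_simps)
    also have "r powr (- \<mu>) * r powr \<mu> = 1" using elim by (simp add: powr_add[symmetric])
    finally show ?case by simp
  qed
  ultimately have "((\<lambda>r. (r powr \<mu> * f r - K) * r powr \<theta>) \<longlongrightarrow> - A) at_top"
    by (rule Lim_transform_eventually)
  then show ?thesis using A by blast
qed

end

section \<open>Small central values\<close>

context profile_ode
begin

lemma flow_f_le:
  assumes flow: "flow a T f F" and r: "0 \<le> r" "r < T"
  shows "f r \<le> a"
proof -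
  have "f r \<le> f 0"
  proof (rule DERIV_nonpos_imp_decreasing_open[where f = f, OF r(1)])
    show "continuous_on {0..r} f"
      by (rule continuous_on_subset[OF flow_continuous(1)[OF flow]]) (use r in auto)
    show "\<exists>y. (f has_real_derivative y) (at s) \<and> y \<le> 0" if "0 < s" "s < r" for s
      using that r by (intro exI[of _ "- (F s powr m)"] conjI flow_deriv(1)[OF flow]) auto
  qed
  then show ?thesis by (simp add: flow_init[OF flow])
qed

lemma flow_D_le:
  assumes flow: "flow a T f F" and r: "0 \<le> r" "r < T"
  shows "D f F r \<le> \<alpha> * a"
proof -
  have "0 \<le> F r" using flow_pos[OF flow, of r] flow_init(2)[OF flow] r by (cases "r = 0") auto
  then have "0 \<le> \<beta> * r * spow m (F r)" using \<beta>_pos r by (simp add: spow_def)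
  moreover have "\<alpha> * f r \<le> \<alpha> * a" using flow_f_le[OF flow r] \<alpha>_pos by simp
  ultimately show ?thesis unfolding D_def by linarith
qed

text \<open>The factor 2 makes the inequality \<open>\<alpha> * a < M powr k\<close> strict.\<close>

lemma flow_F_le:
  assumes flow: "flow a T f F" and r: "0 < r" "r < T"
  shows "F r \<le> (2 * \<alpha> * a) powr (1 / k)"
proof (rule less_imp_le, rule ivp_flux_less[OF _ _ _ _ _ _ r])
  show "ivp d \<alpha> \<beta> (spow m) (\<lambda>x. \<bar>x\<bar> powr k) a T f F"
    using flow by (simp add: flow_def sol_def)
  have "0 < \<alpha> * a" using \<alpha>_pos flow_init(3)[OF flow] by simp
  then show "0 < (2 * \<alpha> * a) powr (1 / k)" "\<alpha> * a < \<bar>(2 * \<alpha> * a) powr (1 / k)\<bar> powr k"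
    using k_gt_1 by (auto simp: powr_powr)
  show "0 \<le> F s" if "0 < s" "s \<le> r" for s using flow_pos[OF flow, of s] that r by auto
qed (use \<alpha>_pos \<beta>_pos in \<open>auto simp: spow_def\<close>)

lemma flow_flux_deriv:
  assumes flow: "flow a T f F" and r: "0 < r" "r < T"
  shows "((\<lambda>r. r ^ d * F r) has_real_derivative r ^ d * (D f F r - F r powr k)) (at r)"
  using ivp_flux_deriv[of d \<alpha> \<beta> "spow m" "\<lambda>x. \<bar>x\<bar> powr k" a T f F r] flow r flow_pos[OF flow r]
  by (simp add: flow_def sol_def D_def)

text \<open>For small \<open>a\<close> the solution reaches \<open>Y = \<kappa>\<close> at a radius of order \<open>a\<^bsup>-(k-1)/k\<^esup>\<close>; up to there
  \<open>D\<close> loses only \<open>o(a)\<close>.\<close>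

lemma flow_D_ge:
  assumes flow: "flow a T f F" and r: "0 < r" "r < T" "r \<le> \<rho>"
    and Q0: "\<And>s. 0 < s \<Longrightarrow> s < r \<Longrightarrow> in_Q0 f F s"
  defines "M \<equiv> (2 * \<alpha> * a) powr (1 / k)"
  shows "\<alpha> * a - \<rho> * (\<beta> * m * (\<kappa> * M powr m + \<rho> * (\<alpha> * a) * M powr (m - 1))) \<le> D f F r"
proof -
  define C where "C = \<beta> * m * (\<kappa> * M powr m + \<rho> * (\<alpha> * a) * M powr (m - 1))"
  have a: "0 < \<alpha> * a" using \<alpha>_pos flow_init(3)[OF flow] by simp
  have C: "0 \<le> C" unfolding C_def using \<beta>_pos m_gt \<kappa>_pos a r by auto
  have "D f F 0 + C * 0 \<le> D f F r + C * r"
  proof (rule DERIV_nonneg_imp_increasing_open[where f = "\<lambda>s. D f F s + C * s"])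
    fix s assume s: "0 < s" "s < r"
    then have sT: "s < T" using r by simp
    have F: "0 < F s" "F s \<le> M"
      using flow_pos[OF flow s(1) sT] flow_F_le[OF flow s(1) sT] by (auto simp: M_def)
    have "0 < D f F s" using Q0[OF s] by (simp add: in_Q0_def)
    have D: "D f F s \<le> \<alpha> * a" using flow_D_le[OF flow, of s] s sT by simp
    have "s * D f F s \<le> \<rho> * (\<alpha> * a)"
      using s r D \<open>0 < D f F s\<close> by (intro mult_mono) auto
    moreover have "0 \<le> s * \<bar>F s\<bar> powr k" using s by simp
    ultimately have "J f F s \<le> \<kappa> * F s + \<rho> * (\<alpha> * a)" unfolding J_def by linarith
    then have "F s powr (m - 1) * J f F s \<le> F s powr (m - 1) * (\<kappa> * F s + \<rho> * (\<alpha> * a))"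
      by (intro mult_left_mono) auto
    also have "\<dots> = \<kappa> * F s powr m + \<rho> * (\<alpha> * a) * F s powr (m - 1)"
      using powr_add[of "F s" "m - 1" 1] F by (simp add: algebra_simps)
    also have "\<dots> \<le> \<kappa> * M powr m + \<rho> * (\<alpha> * a) * M powr (m - 1)"
      using F m_gt \<kappa>_pos a r by (intro add_mono mult_left_mono powr_mono2) auto
    finally have "\<beta> * m * (F s powr (m - 1) * J f F s) \<le> C"
      unfolding C_def using \<beta>_pos m_gt by (intro mult_left_mono) auto
    then have "0 \<le> - (\<beta> * m * F s powr (m - 1) * J f F s) + C" by (simp add: mult.assoc)
    moreover have "((\<lambda>s. D f F s + C * s) has_real_derivative - (\<beta> * m * F s powr (m - 1) * J f F s) + C) (at s)"
      using flow_D_deriv[OF flow s(1) sT] by (auto intro!: derivative_eq_intros)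
    ultimately show "\<exists>y. ((\<lambda>s. D f F s + C * s) has_real_derivative y) (at s) \<and> 0 \<le> y" by blast
  next
    show "continuous_on {0..r} (\<lambda>s. D f F s + C * s)"
      by (intro continuous_intros continuous_on_subset[OF flow_DY_continuous(1)[OF flow]]) (use r in auto)
  qed (use r in auto)
  moreover have "C * r \<le> C * \<rho>" using C r by (intro mult_left_mono) auto
  ultimately show ?thesis using flow_DY_init(1)[OF flow] by (simp add: C_def mult.commute)
qed

text \<open>For \<open>a = b powr k\<close> the natural size of the flux is \<open>b\<close>. On the
  second half of the interval \<open>Y < \<kappa>\<close> keeps the absorption below
  \<open>\<alpha> * a / 4\<close>, so the flux grows to at least
  \<open>R * \<alpha> / (8 * 2 ^ d) * b\<close>; for large \<open>R\<close> this exceeds what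
  \<open>Y < \<kappa>\<close> allows at \<open>\<rho>\<close>.\<close>

lemma flow_contradiction_small:
  assumes flow: "flow a T f F" and T: "0 < R" "\<rho> < T"
    and Q0: "\<And>s. 0 < s \<Longrightarrow> s \<le> \<rho> \<Longrightarrow> in_Q0 f F s"
    and b: "0 < b" "a = b powr k" "\<rho> = R * b powr (1 - k)"
    and D: "\<And>s. 0 < s \<Longrightarrow> s \<le> \<rho> \<Longrightarrow> \<alpha> * a / 2 \<le> D f F s"
    and R: "(2 * \<kappa> / R) powr (k / (k - 1)) \<le> \<alpha> / 4" "(\<kappa> / R) powr (1 / (k - 1)) < R * \<alpha> / (8 * 2 ^ d)"
  shows False
proof -
  have \<rho>: "0 < \<rho>" using T b by simp
  have a: "0 < a" using b by simp
  have \<rho>b: "c / \<rho> = c / R * b powr (k - 1)" for c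
    using powr_minus_divide[of b "k - 1"] unfolding b(3) by simp
  have Fk: "F s powr (k - 1) = Y F s / s" if "0 < s" "s \<le> \<rho>" for s
    using flow_pos[OF flow, of s] that T by (simp add: Y_def)
  have F: "F s powr e \<le> (\<kappa> / s) powr (e / (k - 1))" if "0 < s" "s \<le> \<rho>" "0 \<le> e" for s e
  proof -
    have le: "F s powr (k - 1) \<le> \<kappa> / s"
      unfolding Fk[OF that(1,2)] using that Q0[OF that(1,2)]
      by (intro divide_right_mono) (auto simp: in_Q0_def)
    have "F s powr e = (F s powr (k - 1)) powr (e / (k - 1))" using k_gt_1 by (simp add: powr_powr)
    also have "\<dots> \<le> (\<kappa> / s) powr (e / (k - 1))"
      using that k_gt_1 by (intro powr_mono2 le) auto
    finally show ?thesis .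
  qed
  have Fk4: "F s powr k \<le> \<alpha> * a / 4" if s: "\<rho> / 2 \<le> s" "s \<le> \<rho>" for s
  proof -
    have "\<kappa> / s \<le> 2 * \<kappa> / \<rho>" using s \<rho> \<kappa>_pos by (simp add: field_simps)
    then have "(\<kappa> / s) powr (k / (k - 1)) \<le> (2 * \<kappa> / \<rho>) powr (k / (k - 1))"
      using k_gt_1 \<kappa>_pos s \<rho> by (intro powr_mono2) auto
    also have "\<dots> = (2 * \<kappa> / R) powr (k / (k - 1)) * b powr k"
      unfolding \<rho>b using T \<kappa>_pos k_gt_1 by (subst powr_mult) (auto simp: powr_powr)
    also have "\<dots> \<le> \<alpha> / 4 * b powr k" using R by (intro mult_right_mono) auto
    finally show ?thesis using F[of s k] s \<rho> k_gt_1 b by auto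
  qed
  \<comment> \<open>The weight \<open>(\<rho> / 2) ^ d\<close>, the gain
    \<open>\<alpha> * a / 4\<close> and the length \<open>\<rho> / 2\<close> together produce the
    \<open>8 * 2 ^ d\<close>.\<close>
  define C where "C = (\<rho> / 2) ^ d * (\<alpha> * a / 4)"
  have "(\<rho> / 2) ^ d * F (\<rho> / 2) - C * (\<rho> / 2) \<le> \<rho> ^ d * F \<rho> - C * \<rho>"
  proof (rule DERIV_nonneg_imp_nondecreasing[where f = "\<lambda>s. s ^ d * F s - C * s"])
    fix s assume s: "\<rho> / 2 \<le> s" "s \<le> \<rho>"
    have sT: "0 < s" "s < T" using s \<rho> T by auto
    have "C \<le> s ^ d * (D f F s - F s powr k)"
      unfolding C_def using s \<rho> D[OF sT(1) s(2)] Fk4[OF s] \<alpha>_pos a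
      by (intro mult_mono power_mono) auto
    then show "\<exists>y. ((\<lambda>s. s ^ d * F s - C * s) has_real_derivative y) (at s) \<and> 0 \<le> y"
      using DERIV_diff[OF flow_flux_deriv[OF flow sT] DERIV_cmult_Id[of C]]
      by (intro exI[of _ "s ^ d * (D f F s - F s powr k) - C"]) auto
  qed (use \<rho> in auto)
  moreover have "0 \<le> (\<rho> / 2) ^ d * F (\<rho> / 2)"
    using flow_pos[OF flow, of "\<rho> / 2"] \<rho> T by (simp add: less_imp_le)
  ultimately have "C * (\<rho> / 2) \<le> \<rho> ^ d * F \<rho>" by linarith
  moreover have "C * (\<rho> / 2) = \<rho> ^ d * (\<alpha> * (\<rho> * a) / (8 * 2 ^ d))"
    by (simp add: C_def power_divide)
  ultimately have "\<rho> ^ d * (\<alpha> * (\<rho> * a) / (8 * 2 ^ d)) \<le> \<rho> ^ d * F \<rho>" by (simp only:)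
  then have "\<alpha> * (\<rho> * a) / (8 * 2 ^ d) \<le> F \<rho>"
    using \<rho> by (simp only: mult_le_cancel_left_pos zero_less_power)
  moreover have "\<rho> * a = R * b" using b by (simp add: powr_add[symmetric])
  moreover have "F \<rho> \<le> (\<kappa> / R) powr (1 / (k - 1)) * b"
  proof -
    have "F \<rho> \<le> (\<kappa> / R * b powr (k - 1)) powr (1 / (k - 1))"
      using F[of \<rho> 1] flow_pos[OF flow \<rho> T(2)] \<rho> by (simp add: \<rho>b)
    also have "\<dots> = (\<kappa> / R) powr (1 / (k - 1)) * b"
      using T \<kappa>_pos k_gt_1 b by (subst powr_mult) (auto simp: powr_powr)
    finally show ?thesis .
  qed
  ultimately have "R * \<alpha> / (8 * 2 ^ d) * b \<le> (\<kappa> / R) powr (1 / (k - 1)) * b" by (simp add: mult_ac)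
  then show False using mult_strict_right_mono[OF R(2) b(1)] by linarith
qed

text \<open>\<open>R\<close> is fixed first. Up to \<open>\<rho>\<close> the loss of
  \<open>D\<close> is at most \<open>C * b powr (m + 1 - 2 * k) * a\<close>, with a positive
  exponent because \<open>q < p / 2\<close>. So for small \<open>a\<close> the boundary
  \<open>D = 0\<close> is not met up to \<open>\<rho>\<close>, while staying in the region up to
  \<open>\<rho>\<close> is contradictory.\<close>

lemma exits_above_small:
  "\<exists>a0>0. \<forall>a M f F. 0 < a \<longrightarrow> a < a0 \<longrightarrow> 0 < M \<longrightarrow> \<alpha> * a < M powr k \<longrightarrow> tsol M a f F \<longrightarrow> exits_above f F"
proof -
  have "\<forall>\<^sub>F R in at_top. (2 * \<kappa> / R) powr (k / (k - 1)) < \<alpha> / 4"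
    by (rule order_tendstoD(2)[OF powr_div_tendsto_0]) (use \<kappa>_pos k_gt_1 \<alpha>_pos in auto)
  moreover have "\<forall>\<^sub>F R in at_top. (\<kappa> / R) powr (1 / (k - 1)) < \<alpha> / (8 * 2 ^ d)"
    by (rule order_tendstoD(2)[OF powr_div_tendsto_0]) (use \<kappa>_pos k_gt_1 \<alpha>_pos in auto)
  ultimately have "\<forall>\<^sub>F R in at_top. (2 * \<kappa> / R) powr (k / (k - 1)) < \<alpha> / 4 \<and>
      (\<kappa> / R) powr (1 / (k - 1)) < \<alpha> / (8 * 2 ^ d) \<and> 1 \<le> R"
    using eventually_ge_at_top[of 1] by eventually_elim blast
  then obtain R where R: "(2 * \<kappa> / R) powr (k / (k - 1)) < \<alpha> / 4"
      "(\<kappa> / R) powr (1 / (k - 1)) < \<alpha> / (8 * 2 ^ d)" "1 \<le> R"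
    using eventually_happens'[OF trivial_limit_at_top_linorder] by blast
  have R': "(\<kappa> / R) powr (1 / (k - 1)) < R * \<alpha> / (8 * 2 ^ d)"
  proof -
    have "\<alpha> / (8 * 2 ^ d) * 1 \<le> \<alpha> / (8 * 2 ^ d) * R" using R(3) \<alpha>_pos by (intro mult_left_mono) auto
    then show ?thesis using R(2) by (simp add: mult.commute)
  qed
  define C where "C = R * (\<beta> * m * (\<kappa> * (2 * \<alpha>) powr (m / k) + R * \<alpha> * (2 * \<alpha>) powr ((m - 1) / k)))"
  have C: "0 < C" unfolding C_def
    using R \<beta>_pos m_gt \<kappa>_pos \<alpha>_pos by (intro mult_pos_pos add_pos_pos) auto
  \<comment> \<open>The solution of
    \<open>C * b0 powr (m + 1 - 2 * k) = \<alpha> / 2\<close>.\<close>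
  define b0 where "b0 = (\<alpha> / (2 * C)) powr (1 / (m + 1 - 2 * k))"
  have b0: "0 < b0" using \<alpha>_pos C by (simp add: b0_def)
  have "exits_above f F"
    if a: "0 < a" "a < b0 powr k" and M: "0 < M" "\<alpha> * a < M powr k" and sol: "tsol M a f F" for a M f F
  proof -
    define b where "b = a powr (1 / k)"
    define \<rho> where "\<rho> = R * b powr (1 - k)"
    have b: "0 < b" "a = b powr k" using a k_gt_1 by (auto simp: b_def powr_powr)
    have \<rho>: "0 < \<rho>" using R b by (simp add: \<rho>_def)
    have "b < b0"
    proof (rule ccontr)
      assume "\<not> b < b0"
      then have "b0 powr k \<le> b powr k" using b0 k_gt_1 by (intro powr_mono2) auto
      then show False using a b by simp
    qed
    then have "b powr (m + 1 - 2 * k) < b0 powr (m + 1 - 2 * k)" using b k_lt by (intro powr_less_mono2) auto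
    also have "\<dots> = \<alpha> / (2 * C)" using k_lt \<alpha>_pos C by (simp add: b0_def powr_powr)
    finally have bC: "C * b powr (m + 1 - 2 * k) < \<alpha> / 2" using C by (simp add: field_simps)
    \<comment> \<open>The a priori bound for the flux, not the truncation height
      \<open>M\<close>.\<close>
    define M' where "M' = (2 * \<alpha> * a) powr (1 / k)"
    have M': "M' powr e = (2 * \<alpha>) powr (e / k) * b powr e" for e
      using \<alpha>_pos a k_gt_1 b by (simp add: M'_def powr_mult powr_powr)
    have "\<rho> * (\<alpha> * a) = R * \<alpha> * b" using b(1) by (simp add: \<rho>_def b(2) powr_add[symmetric])
    then have "\<rho> * (\<beta> * m * (\<kappa> * M' powr m + \<rho> * (\<alpha> * a) * M' powr (m - 1)))
        = R * b powr (1 - k) * (\<beta> * m * (\<kappa> * ((2 * \<alpha>) powr (m / k) * b powr m)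
            + R * \<alpha> * b * ((2 * \<alpha>) powr ((m - 1) / k) * b powr (m - 1))))"
      unfolding M' by (simp add: \<rho>_def)
    also have "\<dots> = C * (b powr (1 - k) * b powr m)"
      using powr_add[of b 1 "m - 1"] b by (simp add: C_def algebra_simps)
    also have "\<dots> = C * b powr (m + 1 - 2 * k) * a"
      unfolding b(2) mult.assoc powr_add[symmetric] by (simp add: algebra_simps)
    also have "\<dots> < \<alpha> / 2 * a" using bC a by simp
    finally have small: "\<rho> * (\<beta> * m * (\<kappa> * M' powr m + \<rho> * (\<alpha> * a) * M' powr (m - 1))) < \<alpha> / 2 * a" .
    have D: "\<alpha> * a / 2 \<le> D f F r"
      if "flow a T f F" "0 < r" "r < T" "r \<le> \<rho>" "\<And>s. 0 < s \<Longrightarrow> s < r \<Longrightarrow> in_Q0 f F s" for T r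
      using flow_D_ge[OF that] small unfolding M'_def by simp
    have no: False if flow: "flow a T f F" and "\<rho> < T" and Q0: "\<And>s. 0 < s \<Longrightarrow> s \<le> \<rho> \<Longrightarrow> in_Q0 f F s" for T
      by (rule flow_contradiction_small[OF flow _ that(2) Q0 b \<rho>_def])
        (use R R' D[OF flow] that in auto)
    show "exits_above f F"
    proof (cases rule: tsol_cases[OF sol a(1) M])
      case 1
      then show ?thesis using no[of "\<rho> + 1"] by auto
    next
      case (2 c T)
      \<comment> \<open>An exit through \<open>D = 0\<close> could only happen beyond
        \<open>\<rho>\<close>, but then the solution would stay in the region up to
        \<open>\<rho>\<close>.\<close>
      have "\<not> (D f F c = 0)"
      proof
        assume D0: "D f F c = 0"
        have "\<rho> < c"
        proof (rule ccontr)
          assume "\<not> \<rho> < c"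
          then have "\<alpha> * a / 2 \<le> D f F c" using 2 by (intro D[OF 2(3)]) auto
          then show False using D0 \<alpha>_pos a by (simp add: mult_le_0_iff)
        qed
        then show False using no[OF 2(3)] 2 by auto
      qed
      then show ?thesis using 2 by blast
    qed
  qed
  moreover have "0 < b0 powr k" using b0 by simp
  ultimately show ?thesis by blast
qed

end

section \<open>Large central values and shooting\<close>

context profile_ode
begin

text \<open>While \<open>Y \<le> \<epsilon>\<close>, the flux \<open>F\<close> is squeezed between powers of \<open>r\<close>. If \<open>Y = \<epsilon>\<close> were reached at a small
  radius \<open>r\<close>, the drop of \<open>D\<close> on \<open>[r/2, r]\<close> would exceed \<open>D (r/2)\<close>; and for large \<open>a\<close> it is reached
  before any fixed radius.\<close>

context
  fixes a T f F \<epsilon> r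
  assumes flow: "flow a T f F" and r: "0 < r" "r < T" and \<epsilon>: "0 < \<epsilon>" "\<epsilon> \<le> 1"
    and Q0: "\<And>s. 0 < s \<Longrightarrow> s < r \<Longrightarrow> in_Q0 f F s"
    and Y_le: "\<And>s. 0 < s \<Longrightarrow> s < r \<Longrightarrow> Y F s \<le> \<epsilon>"
begin

lemma small_Y_F_deriv:
  assumes s: "0 < s" "s < r"
  shows "(F has_real_derivative D f F s - (Y F s + d) * F s / s) (at s)"
proof -
  note F = flow_pos[OF flow s(1)]
  have "F s powr k = F s powr (k - 1) * F s" using powr_add[of "F s" "k - 1" 1] F s r by simp
  then have "F s powr k = Y F s * F s / s" using F s r by (simp add: Y_def)
  then have "D f F s - F s powr k - d / s * F s = D f F s - (Y F s + d) * F s / s"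
    by (simp add: add_divide_distrib algebra_simps)
  then show ?thesis by (rule DERIV_cong[OF flow_deriv(2)[OF flow s(1)], rotated]) (use s r in simp)
qed

lemma small_Y_F_pos: "0 < s \<Longrightarrow> s \<le> r \<Longrightarrow> 0 < F s" using flow_pos[OF flow] r by simp

lemma small_Y_D_pos: "0 < s \<Longrightarrow> s < r \<Longrightarrow> 0 < D f F s" using Q0 by (simp add: in_Q0_def)

lemma small_Y_continuous: "continuous_on {x..y} F" "continuous_on {x..y} (D f F)" if "0 \<le> x" "y \<le> r"
  by (rule continuous_on_subset[OF flow_continuous(2)[OF flow]], use that r in force)
    (rule continuous_on_subset[OF flow_DY_continuous(1)[OF flow]], use that r in force)

text \<open>\<open>D\<close> decreases and \<open>F' \<ge> D - e * F / s\<close>, hence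
  \<open>P' \<le> - e * P / s\<close> for \<open>P = s * D - (e + 1) * F\<close>. The factor
  \<open>s powr e\<close> turns this into monotonicity, starting from 0.\<close>

lemma small_Y_D_upper:
  assumes x: "0 < x" "x < r"
  shows "x * D f F x \<le> (d + 1 + \<epsilon>) * F x"
proof -
  define e where "e = d + \<epsilon>"
  have e: "0 < e" using \<epsilon> by (simp add: e_def)
  define P where "P s = s * D f F s - (e + 1) * F s" for s
  have "x powr e * P x \<le> 0 powr e * P 0"
  proof (rule DERIV_nonpos_imp_decreasing_open[where f = "\<lambda>s. s powr e * P s"])
    fix s assume "0 < s" "s < x"
    then have s: "0 < s" "s < r" "s < T" using x r by auto
    let ?D' = "- (\<beta> * m * F s powr (m - 1) * J f F s)"
    let ?P' = "D f F s + s * ?D' - (e + 1) * (D f F s - (Y F s + d) * F s / s)"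
    have "(P has_real_derivative (1 * D f F s + ?D' * s) - (e + 1) * (D f F s - (Y F s + d) * F s / s)) (at s)"
      unfolding P_def
      by (intro DERIV_diff DERIV_mult DERIV_cmult DERIV_ident flow_D_deriv[OF flow] small_Y_F_deriv s)
    then have dP: "(P has_real_derivative ?P') (at s)" by (rule DERIV_cong) simp
    have J: "0 < J f F s"
      using small_Y_D_pos[OF s(1,2)] Q0[OF s(1,2)] small_Y_F_pos[of s] s
      by (auto simp: J_eq in_Q0_def intro!: add_pos_pos)
    have D': "s * ?D' \<le> 0" using J s \<beta>_pos m_gt by (intro mult_nonneg_nonpos) auto
    have "(Y F s + d) * F s / s \<le> e * F s / s"
      using Y_le[OF s(1,2)] small_Y_F_pos[of s] s unfolding e_def
      by (intro divide_right_mono mult_right_mono) auto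
    then have "(e + 1) * ((Y F s + d) * F s / s) \<le> (e + 1) * (e * F s / s)"
      using e by (intro mult_left_mono) auto
    then have "?P' \<le> - e * (P s / s)"
      using D' s by (simp add: P_def algebra_simps diff_divide_distrib add_divide_distrib)
    then have "s powr e * ?P' \<le> s powr e * (- e * (P s / s))" by (rule mult_left_mono) simp
    moreover have "s powr (e - 1) = s powr e / s" using s by (simp add: powr_diff)
    ultimately have "e * s powr (e - 1) * P s + ?P' * s powr e \<le> 0" by (simp add: algebra_simps)
    moreover have "((\<lambda>s. s powr e * P s) has_real_derivative e * s powr (e - 1) * P s + ?P' * s powr e) (at s)"
      by (intro DERIV_mult dP has_real_derivative_powr s)
    ultimately show "\<exists>y. ((\<lambda>s. s powr e * P s) has_real_derivative y) (at s) \<and> y \<le> 0" by blast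
  next
    show "continuous_on {0..x} (\<lambda>s. s powr e * P s)"
      unfolding P_def using e x
      by (intro continuous_intros continuous_on_powr' small_Y_continuous) auto
  qed (use x in auto)
  then have "x powr e * P x \<le> 0" by simp
  then have "P x \<le> 0" using x by (simp add: mult_le_0_iff)
  then show ?thesis by (simp add: P_def e_def algebra_simps)
qed

text \<open>The exponent outweighs the damping rate \<open>Y + d\<close> of the flux, and
  \<open>D\<close> is positive.\<close>

lemma small_Y_F_lower:
  assumes xy: "0 < x" "x \<le> y" "y \<le> r"
  shows "x powr (d + \<epsilon>) * F x \<le> y powr (d + \<epsilon>) * F y"
proof (rule DERIV_nonneg_imp_increasing_open[OF xy(2)])
  fix s assume "x < s" "s < y"
  then have s: "0 < s" "s < r" using xy by auto
  let ?F' = "D f F s - (Y F s + d) * F s / s"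
  have "((\<lambda>s. s powr (d + \<epsilon>) * F s) has_real_derivative
      (d + \<epsilon>) * s powr (d + \<epsilon> - 1) * F s + ?F' * s powr (d + \<epsilon>)) (at s)"
    by (intro DERIV_mult small_Y_F_deriv has_real_derivative_powr s)
  moreover have "s powr (d + \<epsilon> - 1) = s powr (d + \<epsilon>) / s" using s by (simp add: powr_diff)
  then have "(d + \<epsilon>) * s powr (d + \<epsilon> - 1) * F s + ?F' * s powr (d + \<epsilon>)
      = s powr (d + \<epsilon>) * (D f F s + (\<epsilon> - Y F s) * F s / s)"
    by (simp add: algebra_simps add_divide_distrib diff_divide_distrib)
  moreover have "0 \<le> s powr (d + \<epsilon>) * (D f F s + (\<epsilon> - Y F s) * F s / s)"
    using small_Y_D_pos[OF s] Y_le[OF s] small_Y_F_pos[of s] s by (intro mult_nonneg_nonneg add_nonneg_nonneg) auto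
  ultimately show "\<exists>z. ((\<lambda>s. s powr (d + \<epsilon>) * F s) has_real_derivative z) (at s) \<and> 0 \<le> z" by metis
next
  show "continuous_on {x..y} (\<lambda>s. s powr (d + \<epsilon>) * F s)"
    using xy by (intro continuous_intros small_Y_continuous) auto
qed

text \<open>The upper bound on \<open>D\<close> gives
  \<open>s * F' \<le> (1 + \<epsilon>) * F\<close>, and \<open>\<epsilon> \<le> 1\<close>.\<close>

lemma small_Y_F_upper:
  assumes xy: "0 < x" "x \<le> y" "y \<le> r"
  shows "y powr (- 2) * F y \<le> x powr (- 2) * F x"
proof (rule DERIV_nonpos_imp_decreasing_open[where f = "\<lambda>s. s powr (- 2) * F s", OF xy(2)])
  fix s assume "x < s" "s < y"
  then have s: "0 < s" "s < r" using xy by auto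
  let ?F' = "D f F s - (Y F s + d) * F s / s"
  have der: "((\<lambda>s. s powr (- 2) * F s) has_real_derivative
      - 2 * s powr (- 2 - 1) * F s + ?F' * s powr (- 2)) (at s)"
    by (intro DERIV_mult small_Y_F_deriv has_real_derivative_powr s)
  have F: "0 < F s" using small_Y_F_pos s by simp
  have "s * ?F' = s * D f F s - (Y F s + d) * F s" using s by (simp add: field_simps)
  also have "\<dots> \<le> (d + 1 + \<epsilon>) * F s - d * F s"
  proof -
    have "0 \<le> Y F s * F s" using F s by (simp add: Y_def)
    then show ?thesis using small_Y_D_upper[OF s] by (simp add: algebra_simps)
  qed
  also have "\<dots> \<le> 2 * F s" using \<epsilon> F by (simp add: algebra_simps)
  finally have "s powr (- 3) * (s * ?F') \<le> s powr (- 3) * (2 * F s)" by (rule mult_left_mono) simp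
  moreover have "s powr (- 2) = s powr (- 3) * s" using powr_add[of s "- 3" 1] s by simp
  ultimately have "- 2 * s powr (- 2 - 1) * F s + ?F' * s powr (- 2) \<le> 0" by (simp add: algebra_simps)
  then show "\<exists>z. ((\<lambda>s. s powr (- 2) * F s) has_real_derivative z) (at s) \<and> z \<le> 0" using der by blast
next
  show "continuous_on {x..y} (\<lambda>s. s powr (- 2) * F s)"
    using xy by (intro continuous_intros small_Y_continuous) auto
qed

text \<open>On the right half of the interval the flux is at least a quarter of \<open>F r\<close>
  and \<open>J\<close> at least \<open>F * \<kappa> / 2\<close>, so \<open>D\<close> drops by a
  definite amount, which cannot exceed its value at \<open>r / 2\<close>. This bounds
  \<open>r\<^sup>2 * F powr (m - 1)\<close>, which for \<open>Y = \<epsilon>\<close> is the left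
  side: the radius cannot be too small.\<close>

lemma small_Y_radius:
  assumes \<epsilon>\<kappa>: "\<epsilon> \<le> \<kappa> / 2" and Yr: "Y F r = \<epsilon>"
  shows "\<epsilon> powr (\<nu> + 2) * r powr (- \<nu>) \<le> (d + 2) * 2 ^ (d + 4) * 4 powr m / (\<beta> * m * \<kappa>)"
proof -
  define G where "G = F r"
  have G: "0 < G" using small_Y_F_pos r by (simp add: G_def)
  define x where "x = r / 2"
  have x: "0 < x" "x < r" using r by (auto simp: x_def)
  \<comment> \<open>A lower bound for \<open>- D'\<close> on the right half of the interval, from
    \<open>F \<ge> G / 4\<close> and \<open>\<kappa> - Y \<ge> \<kappa> / 2\<close>.\<close>
  define C where "C = \<beta> * m * (G / 4) powr m * (\<kappa> / 2)"
  have C: "0 < C" using \<beta>_pos m_gt G \<kappa>_pos by (simp add: C_def)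
  have D_drop: "D f F r + C * r \<le> D f F x + C * x"
  proof (rule DERIV_nonpos_imp_decreasing_open[where f = "\<lambda>s. D f F s + C * s"])
    fix s assume sx: "x < s" "s < r"
    then have s: "0 < s" "s < r" "s < T" using x r by auto
    have F: "0 < F s" using small_Y_F_pos s by simp
    have "G / 4 \<le> F s"
    proof -
      have "r powr (- 2) * G \<le> s powr (- 2) * F s"
        unfolding G_def using s by (intro small_Y_F_upper) auto
      also have "\<dots> \<le> (r / 2) powr (- 2) * F s"
        using F sx r unfolding x_def by (intro mult_right_mono powr_mono2') auto
      also have "\<dots> = r powr (- 2) * (4 * F s)"
        using r by (simp add: powr_minus powr_numeral power_divide field_simps)
      finally show ?thesis using r by (simp add: mult_le_cancel_left_pos)
    qed
    then have "(G / 4) powr m \<le> F s powr m" using G m_gt by (intro powr_mono2) auto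
    moreover have "F s * (\<kappa> / 2) \<le> J f F s"
    proof -
      have "F s * (\<kappa> / 2) \<le> F s * (\<kappa> - Y F s)" using F Y_le[OF s(1,2)] \<epsilon>\<kappa> by (intro mult_left_mono) auto
      then show ?thesis using F small_Y_D_pos[OF s(1,2)] s by (simp add: J_eq add_increasing)
    qed
    then have "F s powr (m - 1) * (F s * (\<kappa> / 2)) \<le> F s powr (m - 1) * J f F s" by (rule mult_left_mono) simp
    moreover have "F s powr (m - 1) * F s = F s powr m" using powr_add[of "F s" "m - 1" 1] F by simp
    ultimately have "(G / 4) powr m * (\<kappa> / 2) \<le> F s powr (m - 1) * J f F s"
      using \<kappa>_pos by (smt (verit, best) mult.assoc mult_right_mono half_gt_zero)
    then have "C \<le> \<beta> * m * (F s powr (m - 1) * J f F s)"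
      unfolding C_def using \<beta>_pos m_gt by (simp add: mult.assoc)
    then have "- (\<beta> * m * F s powr (m - 1) * J f F s) + C \<le> 0" by (simp add: mult.assoc)
    moreover have "((\<lambda>s. D f F s + C * s) has_real_derivative - (\<beta> * m * F s powr (m - 1) * J f F s) + C) (at s)"
      by (intro DERIV_add flow_D_deriv[OF flow s(1,3)] DERIV_cmult_Id)
    ultimately show "\<exists>y. ((\<lambda>s. D f F s + C * s) has_real_derivative y) (at s) \<and> y \<le> 0" by blast
  next
    show "continuous_on {x..r} (\<lambda>s. D f F s + C * s)"
      using x by (intro continuous_intros small_Y_continuous) auto
  qed (use x in auto)
  have Dr: "0 \<le> D f F r"
  proof (rule ccontr)
    assume "\<not> 0 \<le> D f F r"
    moreover have "continuous_on {x..r} (D f F)" using x by (intro small_Y_continuous) auto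
    moreover have "0 < D f F x" by (rule small_Y_D_pos[OF x])
    ultimately obtain u where "x < u" "u \<le> r" "D f F u = 0" using first_zero[of x r "D f F"] x by auto
    then show False using small_Y_D_pos[of u] x \<open>\<not> 0 \<le> D f F r\<close> by (cases "u = r") auto
  qed
  have Fx: "F x \<le> 2 ^ (d + 1) * G"
  proof -
    have "x powr (d + \<epsilon>) * F x \<le> r powr (d + \<epsilon>) * G"
      unfolding G_def using x by (intro small_Y_F_lower) auto
    also have "r powr (d + \<epsilon>) = 2 powr (d + \<epsilon>) * x powr (d + \<epsilon>)"
      using r by (simp add: x_def powr_divide)
    finally have "F x \<le> 2 powr (d + \<epsilon>) * G" using x by (simp add: mult_ac)
    also have "\<dots> \<le> 2 powr (real (d + 1)) * G" using \<epsilon> G by (intro mult_right_mono powr_mono) auto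
    finally show ?thesis by (simp only: powr_realpow zero_less_numeral)
  qed
  have "x * D f F x \<le> (d + 2) * (2 ^ (d + 1) * G)"
  proof -
    have "x * D f F x \<le> (d + 1 + \<epsilon>) * F x" by (rule small_Y_D_upper[OF x])
    also have "\<dots> \<le> (d + 2) * (2 ^ (d + 1) * G)"
      using \<epsilon> Fx small_Y_F_pos[of x] x by (intro mult_mono) auto
    finally show ?thesis .
  qed
  moreover have "x * (C * x) \<le> x * D f F x"
    using D_drop Dr x by (intro mult_left_mono) (auto simp: x_def)
  ultimately have "C * x\<^sup>2 \<le> (d + 2) * (2 ^ (d + 1) * G)" by (simp add: power2_eq_square mult_ac)
  moreover have "G powr m = G powr (m - 1) * G" using powr_add[of G "m - 1" 1] G by simp
  ultimately have "\<beta> * m * \<kappa> * (r\<^sup>2 * G powr (m - 1)) * G / (8 * 4 powr m) \<le> (d + 2) * 2 ^ (d + 1) * G"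
    using G by (simp add: C_def x_def powr_divide power_divide field_simps)
  then have "\<beta> * m * \<kappa> * (r\<^sup>2 * G powr (m - 1)) \<le> (d + 2) * 2 ^ (d + 1) * (8 * 4 powr m)"
    using G by (simp add: divide_le_eq mult_ac)
  also have "\<dots> = (d + 2) * 2 ^ (d + 4) * 4 powr m" by (simp add: power_add)
  finally have *: "r\<^sup>2 * G powr (m - 1) \<le> (d + 2) * 2 ^ (d + 4) * 4 powr m / (\<beta> * m * \<kappa>)"
    using \<beta>_pos m_gt \<kappa>_pos by (simp add: le_divide_eq mult_ac)
  have "G powr (k - 1) = \<epsilon> / r" using Yr r G by (simp add: Y_def G_def field_simps)
  then have "G powr (m - 1) = (\<epsilon> / r) powr ((m - 1) / (k - 1))"
    using powr_powr[of G "k - 1" "(m - 1) / (k - 1)"] k_gt_1 by simp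
  then have "G powr (m - 1) = \<epsilon> powr (\<nu> + 2) / (r powr \<nu> * r\<^sup>2)"
    unfolding exponents using \<epsilon> r by (simp add: powr_divide powr_add)
  then have "r\<^sup>2 * G powr (m - 1) = \<epsilon> powr (\<nu> + 2) * r powr (- \<nu>)"
    using r by (simp add: powr_minus_divide)
  then show ?thesis using * by simp
qed

text \<open>\<open>A\<close> is the slope of the flux at the centre. Under the bound on
  \<open>x\<close> the losses in \<open>D\<close> are at most
  \<open>(\<alpha> + \<beta>) * A * x\<^sub>0\<close>, and \<open>x\<^sub>0\<close> is chosen to
  make this \<open>\<alpha> * a / 2\<close>; absorption takes at most another
  \<open>\<alpha> * a / 4\<close>. So \<open>F x \<ge> A / 4 * x\<close>, and
  \<open>small_Y_F_lower\<close> carries this to \<open>r\<close>.\<close>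

lemma small_Y_flux_growth:
  assumes \<epsilon>4: "\<epsilon> \<le> 1 / 4"
  defines "A \<equiv> \<alpha> * a / (d + 1)" and "x\<^sub>0 \<equiv> (d + 1) / (2 * (\<alpha> + \<beta>))"
  assumes x: "0 < x" "x < r" "x powr (m + 1) * A powr (m - 1) \<le> x\<^sub>0"
  shows "A / 4 * x powr (d + 1 + \<epsilon>) \<le> r powr (d + \<epsilon>) * F r"
proof -
  have a: "0 < \<alpha> * a" using \<alpha>_pos flow_init(3)[OF flow] by simp
  have "real d + 1 \<noteq> 0" by linarith
  then have A3: "A * (d + 1) = \<alpha> * a" by (simp add: A_def)
  have A1: "0 < A" using a by (simp add: A_def)
  have "A * 1 \<le> A * (d + 1)" using A1 by (intro mult_left_mono) auto
  then have A: "0 < A" "A \<le> \<alpha> * a" "A * (d + 1) = \<alpha> * a" unfolding A3 using A1 A3 by simp_all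
  have flux: "continuous_on {0..s} (\<lambda>s. s ^ d * F s - c * s ^ (d + 1))" if "s \<le> x" for s c
    using that x by (intro continuous_intros small_Y_continuous) auto
  have flux': "((\<lambda>s. s ^ d * F s - c * s ^ (d + 1)) has_real_derivative
      s ^ d * (D f F s - F s powr k - c * (d + 1))) (at s)" if "0 < s" "s \<le> x" for s c
    by (rule DERIV_cong[OF DERIV_diff[OF flow_flux_deriv[OF flow] DERIV_cmult[OF DERIV_pow]]])
      (use that x r in \<open>auto simp: algebra_simps\<close>)
  have F_le: "F s \<le> A * s" if s: "0 < s" "s \<le> x" for s
  proof -
    have "s ^ d * F s - A * s ^ (d + 1) \<le> 0 ^ d * F 0 - A * 0 ^ (d + 1)"
    proof (rule DERIV_nonpos_imp_decreasing_open[where f = "\<lambda>s. s ^ d * F s - A * s ^ (d + 1)"])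
      fix u assume u: "0 < u" "u < s"
      have "D f F u \<le> \<alpha> * a" using flow_D_le[OF flow, of u] u s x r by simp
      moreover have "0 \<le> F u powr k" by simp
      ultimately have "D f F u - F u powr k - A * (d + 1) \<le> 0" unfolding A(3) by linarith
      then have "u ^ d * (D f F u - F u powr k - A * (d + 1)) \<le> 0"
        using u by (intro mult_nonneg_nonpos) auto
      then show "\<exists>y. ((\<lambda>s. s ^ d * F s - A * s ^ (d + 1)) has_real_derivative y) (at u) \<and> y \<le> 0"
        using flux'[OF u(1) order_trans[OF less_imp_le[OF u(2)] s(2)], of A] by blast
    qed (use s flux[of s A] in auto)
    then have "s ^ d * F s \<le> s ^ d * (A * s)" using flow_init(2)[OF flow] by (simp add: mult_ac)
    then show ?thesis using s by (simp only: mult_le_cancel_left_pos zero_less_power)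
  qed
  have Fm: "s * F s powr m \<le> A * x\<^sub>0" if s: "0 < s" "s \<le> x" for s
  proof -
    have "F s powr m \<le> (A * s) powr m"
      using F_le[OF s] small_Y_F_pos[of s] s x m_gt by (intro powr_mono2) auto
    then have "s * F s powr m \<le> s * (A * s) powr m" using s by (intro mult_left_mono) auto
    also have "\<dots> = A * (s powr (m + 1) * A powr (m - 1))"
      using powr_add[of s m 1] powr_add[of A "m - 1" 1] A s by (simp add: powr_mult mult_ac)
    also have "\<dots> \<le> A * (x powr (m + 1) * A powr (m - 1))"
      using A s m_gt by (intro mult_left_mono mult_right_mono powr_mono2) auto
    also have "\<dots> \<le> A * x\<^sub>0" using x A by (intro mult_left_mono) auto
    finally show ?thesis .
  qed
  have f_ge: "a - A * x\<^sub>0 \<le> f s" if s: "0 < s" "s \<le> x" for s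
  proof -
    have "f 0 + A powr m * 0 powr (m + 1) \<le> f s + A powr m * s powr (m + 1)"
    proof (rule DERIV_nonneg_imp_increasing_open[where f = "\<lambda>s. f s + A powr m * s powr (m + 1)"])
      fix u assume u: "0 < u" "u < s"
      have "F u powr m \<le> (A * u) powr m"
        using F_le[of u] small_Y_F_pos[of u] u s x m_gt by (intro powr_mono2) auto
      also have "\<dots> = A powr m * u powr m * 1" using A u by (simp add: powr_mult)
      also have "\<dots> \<le> A powr m * u powr m * (m + 1)" using m_gt by (intro mult_left_mono) auto
      finally have "0 \<le> - (F u powr m) + A powr m * ((m + 1) * u powr (m + 1 - 1))" by (simp add: mult_ac)
      moreover have "((\<lambda>s. f s + A powr m * s powr (m + 1)) has_real_derivative
          - (F u powr m) + A powr m * ((m + 1) * u powr (m + 1 - 1))) (at u)"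
        by (intro DERIV_add DERIV_cmult flow_deriv(1)[OF flow] has_real_derivative_powr) (use u s x r in auto)
      ultimately show "\<exists>y. ((\<lambda>s. f s + A powr m * s powr (m + 1)) has_real_derivative y) (at u) \<and> 0 \<le> y"
        by blast
    next
      show "continuous_on {0..s} (\<lambda>s. f s + A powr m * s powr (m + 1))"
        by (intro continuous_intros continuous_on_powr' continuous_on_subset[OF flow_continuous(1)[OF flow]])
          (use s x r m_gt in auto)
    qed (use s in auto)
    then have "a - A powr m * s powr (m + 1) \<le> f s" using flow_init(1)[OF flow] by simp
    moreover have "A powr m * s powr (m + 1) = A * (s powr (m + 1) * A powr (m - 1))"
      using powr_add[of A "m - 1" 1] A by (simp add: mult_ac)
    moreover have "\<dots> \<le> A * (x powr (m + 1) * A powr (m - 1))"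
      using A s m_gt by (intro mult_left_mono mult_right_mono powr_mono2) auto
    moreover have "\<dots> \<le> A * x\<^sub>0" using x A by (intro mult_left_mono) auto
    ultimately show ?thesis by linarith
  qed
  have "0 ^ d * F 0 - A / 4 * 0 ^ (d + 1) \<le> x ^ d * F x - A / 4 * x ^ (d + 1)"
  proof (rule DERIV_nonneg_imp_increasing_open[where f = "\<lambda>s. s ^ d * F s - A / 4 * s ^ (d + 1)"])
    fix s assume s: "0 < s" "s < x"
    then have F: "0 < F s" "F s \<le> A * s" using small_Y_F_pos[of s] F_le[of s] x by auto
    have "\<alpha> * (a - A * x\<^sub>0) \<le> \<alpha> * f s" using f_ge[of s] s \<alpha>_pos by (intro mult_left_mono) auto
    moreover have "\<beta> * (s * F s powr m) \<le> \<beta> * (A * x\<^sub>0)" using Fm[of s] s \<beta>_pos by (intro mult_left_mono) auto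
    moreover have "(\<alpha> + \<beta>) * (A * x\<^sub>0) = \<alpha> * a / 2"
    proof -
      have "x\<^sub>0 * (\<alpha> + \<beta>) = (d + 1) / 2"
        using \<alpha>_pos \<beta>_pos unfolding x\<^sub>0_def by (simp add: field_simps)
      then have "(\<alpha> + \<beta>) * (A * x\<^sub>0) = A * (d + 1) / 2"
        by (metis mult.assoc mult.commute times_divide_eq_right)
      then show ?thesis unfolding A(3) .
    qed
    ultimately have "\<alpha> * a / 2 \<le> D f F s" using F by (simp add: D_def spow_pos algebra_simps)
    moreover have "F s powr k \<le> \<alpha> * a / 4"
    proof -
      have "F s powr k = F s powr (k - 1) * F s" using powr_add[of "F s" "k - 1" 1] F by simp
      also have "\<dots> = Y F s * (F s / s)" using s F by (simp add: Y_def)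
      also have "\<dots> \<le> 1 / 4 * A"
        using Y_le[of s] \<epsilon>4 F s x by (intro mult_mono) (auto simp: divide_le_eq)
      finally show ?thesis using A by simp
    qed
    ultimately have "0 \<le> D f F s - F s powr k - A / 4 * (d + 1)" using A(3) by (simp add: algebra_simps)
    then have "0 \<le> s ^ d * (D f F s - F s powr k - A / 4 * (d + 1))" using s by (intro mult_nonneg_nonneg) auto
    then show "\<exists>y. ((\<lambda>s. s ^ d * F s - A / 4 * s ^ (d + 1)) has_real_derivative y) (at s) \<and> 0 \<le> y"
      using flux'[OF s(1) less_imp_le[OF s(2)], of "A / 4"] by blast
  qed (use x flux[of x "A / 4"] in auto)
  then have "x ^ d * (A / 4 * x) \<le> x ^ d * F x" using flow_init(2)[OF flow] by (simp add: mult_ac)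
  then have "A / 4 * x \<le> F x" using x by (simp only: mult_le_cancel_left_pos zero_less_power)
  then have "x powr (d + \<epsilon>) * (A / 4 * x) \<le> x powr (d + \<epsilon>) * F x" by (rule mult_left_mono) simp
  also have "\<dots> \<le> r powr (d + \<epsilon>) * F r" using x by (intro small_Y_F_lower) auto
  also have "x powr (d + \<epsilon>) * (A / 4 * x) = A / 4 * x powr (d + 1 + \<epsilon>)"
    using powr_add[of x "d + \<epsilon>" 1] x by (simp add: algebra_simps)
  finally show ?thesis .
qed

end

text \<open>Below \<open>\<rho>\<^sub>1\<close> the level \<open>Y = \<epsilon>\<close> is not
  reached inside the region. Staying inside up to \<open>\<rho>\<close> would thus keep
  \<open>\<rho> powr (d + \<epsilon>) * F \<rho>\<close> below a constant \<open>B\<close>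
  independent of \<open>a\<close>, whereas it has to be at least \<open>c * A powr \<delta>\<close>.
  Only the exit through \<open>D = 0\<close> is left.\<close>

lemma exits_below_large:
  "\<exists>a0>0. \<forall>a M f F. a0 < a \<longrightarrow> 0 < M \<longrightarrow> \<alpha> * a < M powr k \<longrightarrow> tsol M a f F \<longrightarrow> exits_below f F"
proof -
  \<comment> \<open>The last bound keeps \<open>(d + \<epsilon>) * (m - 1) < 2\<close>, which is
    possible because \<open>p > p_crit N\<close>.\<close>
  define \<epsilon> where "\<epsilon> = min (min (\<kappa> / 2) (1 / 4)) ((2 - d * (m - 1)) / (2 * (m - 1)))"
  have "0 < \<epsilon>" using \<kappa>_pos m_gt d_lt by (simp add: \<epsilon>_def)
  moreover have "\<epsilon> \<le> 1 / 4" "\<epsilon> \<le> \<kappa> / 2" unfolding \<epsilon>_def by linarith+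
  ultimately have \<epsilon>: "0 < \<epsilon>" "\<epsilon> \<le> 1 / 4" "\<epsilon> \<le> 1" "\<epsilon> \<le> \<kappa> / 2" by linarith+
  have \<epsilon>d: "(d + \<epsilon>) * (m - 1) < 2"
  proof -
    have "\<epsilon> * (m - 1) \<le> (2 - d * (m - 1)) / (2 * (m - 1)) * (m - 1)"
      using m_gt by (intro mult_right_mono) (auto simp: \<epsilon>_def)
    also have "\<dots> = (2 - d * (m - 1)) / 2"
      using m_gt by (simp only: times_divide_eq_left mult_divide_mult_cancel_right)
    finally show ?thesis using d_lt by (simp add: distrib_right)
  qed
  define C where "C = (d + 2) * 2 ^ (d + 4) * 4 powr m / (\<beta> * m * \<kappa>) / \<epsilon> powr (\<nu> + 2)"
  have C: "0 < C" unfolding C_def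
    using \<beta>_pos m_gt \<kappa>_pos \<epsilon> by (intro divide_pos_pos mult_pos_pos) (auto intro: add_pos_nonneg)
  \<comment> \<open>The radius at which the bound of \<open>small_Y_radius\<close> holds with
    equality.\<close>
  define \<rho>\<^sub>1 where "\<rho>\<^sub>1 = C powr (- 1 / \<nu>)"
  have \<rho>1: "0 < \<rho>\<^sub>1" "\<rho>\<^sub>1 powr (- \<nu>) = C" using C \<nu>_pos by (auto simp: \<rho>\<^sub>1_def powr_powr)
  define \<rho> where "\<rho> = \<rho>\<^sub>1 / 2"
  have \<rho>: "0 < \<rho>" "\<rho> < \<rho>\<^sub>1" using \<rho>1 by (auto simp: \<rho>_def)
  have small: "Y F r < \<epsilon>"
    if flow: "flow a T f F" and r: "0 < r" "r < T" "r < \<rho>\<^sub>1" and Q0: "\<And>s. 0 < s \<Longrightarrow> s < r \<Longrightarrow> in_Q0 f F s"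
    for a T f F r
  proof (rule ccontr)
    assume "\<not> Y F r < \<epsilon>"
    then have "\<epsilon> - Y F r \<le> 0" by simp
    moreover have "continuous_on {0..r} (\<lambda>s. \<epsilon> - Y F s)"
      by (intro continuous_intros continuous_on_subset[OF flow_DY_continuous(2)[OF flow]]) (use r in auto)
    moreover have "0 < \<epsilon> - Y F 0" using \<epsilon> flow_DY_init(2)[OF flow] by simp
    ultimately obtain c where c: "0 < c" "c \<le> r" "\<epsilon> - Y F c = 0" "\<And>s. 0 \<le> s \<Longrightarrow> s < c \<Longrightarrow> 0 < \<epsilon> - Y F s"
      using first_zero[of 0 r "\<lambda>s. \<epsilon> - Y F s"] r by (metis (no_types, lifting) less_imp_le)
    have "\<epsilon> powr (\<nu> + 2) * c powr (- \<nu>) \<le> (d + 2) * 2 ^ (d + 4) * 4 powr m / (\<beta> * m * \<kappa>)"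
    proof (rule small_Y_radius[OF flow c(1) _ \<epsilon>(1,3) _ _ \<epsilon>(4)])
      show "in_Q0 f F s" if "0 < s" "s < c" for s using Q0 that c by auto
      show "Y F s \<le> \<epsilon>" if "0 < s" "s < c" for s using c(4)[of s] that by auto
    qed (use c r in auto)
    moreover have "0 < \<epsilon> powr (\<nu> + 2)" using \<epsilon> by simp
    ultimately have "c powr (- \<nu>) \<le> C"
      unfolding C_def by (simp only: pos_le_divide_eq mult.commute[of "c powr (- \<nu>)"])
    moreover have "\<rho>\<^sub>1 powr (- \<nu>) < c powr (- \<nu>)"
      by (rule powr_less_mono2_neg) (use \<nu>_pos c r in auto)
    ultimately show False using \<rho>1 by simp
  qed
  define x\<^sub>0 where "x\<^sub>0 = (d + 1) / (2 * (\<alpha> + \<beta>))"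
  have x0: "0 < x\<^sub>0" using \<alpha>_pos \<beta>_pos by (simp add: x\<^sub>0_def)
  define e where "e = (m - 1) / (m + 1)"
  have e: "0 < e" using m_gt by (simp add: e_def)
  \<comment> \<open>The net power of \<open>A\<close> in the lower bound for the flux;
    \<open>(m - 1) * (d + 1 + \<epsilon>) < m + 1\<close> makes it positive.\<close>
  define \<delta> where "\<delta> = 1 - e * (d + 1 + \<epsilon>)"
  have \<delta>: "0 < \<delta>"
  proof -
    have "(m - 1) * (d + 1 + \<epsilon>) < m + 1" using \<epsilon>d by (simp add: algebra_simps)
    then show ?thesis using m_gt by (simp add: \<delta>_def e_def divide_less_eq)
  qed
  define X where "X A = x\<^sub>0 powr (1 / (m + 1)) * A powr (- e)" for A :: real
  define B where "B = \<rho> powr (d + \<epsilon>) * (\<epsilon> / \<rho>) powr (1 / (k - 1))"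
  define c where "c = x\<^sub>0 powr ((d + 1 + \<epsilon>) / (m + 1)) / 4"
  have c: "0 < c" using x0 by (simp add: c_def)
  have "\<forall>\<^sub>F A in at_top. X A < \<rho>"
    unfolding X_def
    by (rule order_tendstoD(2)[OF tendsto_mult_right_zero[OF tendsto_powr_neg_at_top[OF e]] \<rho>(1)])
  moreover have "\<forall>\<^sub>F A in at_top. B * A powr (- \<delta>) < c"
    by (rule order_tendstoD(2)[OF tendsto_mult_right_zero[OF tendsto_powr_neg_at_top[OF \<delta>]] c])
  ultimately have "\<forall>\<^sub>F A in at_top. X A < \<rho> \<and> B * A powr (- \<delta>) < c" by (rule eventually_conj)
  then obtain A0 where A0: "\<forall>A\<ge>A0. X A < \<rho> \<and> B * A powr (- \<delta>) < c"
    unfolding eventually_at_top_linorder by blast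
  define a0 where "a0 = max 1 A0 * (d + 1) / \<alpha>"
  have a0: "0 < a0" using \<alpha>_pos by (simp add: a0_def)
  have no: False
    if flow: "flow a T f F" and T: "\<rho> < T" and a: "a0 < a" and Q0: "\<And>s. 0 < s \<Longrightarrow> s < \<rho> \<Longrightarrow> in_Q0 f F s"
    for a T f F
  proof -
    define A where "A = \<alpha> * a / (d + 1)"
    have "real d + 1 > 0" by linarith
    then have "max 1 A0 < A" using a \<alpha>_pos by (simp add: A_def a0_def less_divide_eq divide_less_eq mult.commute)
    then have A: "0 < A" "A0 \<le> A" by auto
    have Y: "Y F s \<le> \<epsilon>" if "0 < s" "s < \<rho>" for s
      by (rule less_imp_le, rule small[OF flow]) (use that T \<rho> Q0 in auto)
    have "A / 4 * X A powr (d + 1 + \<epsilon>) \<le> \<rho> powr (d + \<epsilon>) * F \<rho>"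
      unfolding A_def
    proof (rule small_Y_flux_growth[OF flow \<rho>(1) T \<epsilon>(1,3) Q0 Y \<epsilon>(2)])
      show "0 < X (\<alpha> * a / real (d + 1))" unfolding A_def[symmetric] X_def using x0 A by simp
      show "X (\<alpha> * a / real (d + 1)) < \<rho>" unfolding A_def[symmetric] using A0 A by blast
      have "X A powr (m + 1) = x\<^sub>0 * A powr (- (m - 1))"
        using x0 A m_gt by (simp add: X_def powr_mult powr_powr e_def)
      then have "X A powr (m + 1) * A powr (m - 1) = x\<^sub>0"
        using A by (simp add: powr_add[symmetric])
      then show "X (\<alpha> * a / real (d + 1)) powr (m + 1) * (\<alpha> * a / real (d + 1)) powr (m - 1)
          \<le> real (d + 1) / (2 * (\<alpha> + \<beta>))"
        unfolding A_def[symmetric] x\<^sub>0_def[symmetric] by simp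
    qed
    also have "\<rho> powr (d + \<epsilon>) * F \<rho> \<le> B"
    proof -
      have F: "0 < F \<rho>" by (rule flow_pos[OF flow \<rho>(1) T])
      have "Y F \<rho> \<le> \<epsilon>" by (rule less_imp_le, rule small[OF flow]) (use T \<rho> Q0 in auto)
      then have "F \<rho> powr (k - 1) \<le> \<epsilon> / \<rho>" using \<rho> F by (simp add: Y_def le_divide_eq mult.commute)
      then have "(F \<rho> powr (k - 1)) powr (1 / (k - 1)) \<le> (\<epsilon> / \<rho>) powr (1 / (k - 1))"
        using k_gt_1 by (intro powr_mono2) auto
      then have "F \<rho> \<le> (\<epsilon> / \<rho>) powr (1 / (k - 1))" using F k_gt_1 by (simp add: powr_powr)
      then show ?thesis unfolding B_def by (rule mult_left_mono) simp
    qed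
    also have "A / 4 * X A powr (d + 1 + \<epsilon>) = c * A powr \<delta>"
      using x0 A powr_add[of A 1 "- (e * (d + 1 + \<epsilon>))"]
      by (simp add: X_def c_def \<delta>_def powr_mult powr_powr mult_ac)
    finally have "c * A powr \<delta> * A powr (- \<delta>) \<le> B * A powr (- \<delta>)" by (rule mult_right_mono) simp
    moreover have "A powr \<delta> * A powr (- \<delta>) = 1" using A by (simp add: powr_add[symmetric])
    ultimately have "c \<le> B * A powr (- \<delta>)" by (simp add: mult.assoc)
    then show False using A0 A by (meson not_less)
  qed
  have "exits_below f F"
    if a: "a0 < a" and M: "0 < M" "\<alpha> * a < M powr k" and sol: "tsol M a f F" for a M f F
  proof -
    have "0 < a" using a a0 by simp
    show ?thesis
    proof (cases rule: tsol_cases[OF sol \<open>0 < a\<close> M])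
      case 1
      then show ?thesis using no[of a "\<rho> + 1" f F] a by auto
    next
      case (2 c T)
      have "\<not> Y F c = \<kappa>"
      proof
        assume Yc: "Y F c = \<kappa>"
        have "\<rho>\<^sub>1 \<le> c"
        proof (rule ccontr)
          assume "\<not> \<rho>\<^sub>1 \<le> c"
          then have "Y F c < \<epsilon>" using 2 by (intro small[OF 2(3)]) auto
          then show False using Yc \<epsilon> \<kappa>_pos by simp
        qed
        then show False using no[OF 2(3)] 2 a \<rho> by auto
      qed
      then show ?thesis using 2 by blast
    qed
  qed
  then show ?thesis using a0 by blast
qed

text \<open>\<open>ivp_difference\<close> gives Lipschitz dependence on \<open>a\<close>, uniformly
  on bounded radii; with continuity in the radius this yields joint continuity. Composing with
  \<open>max 0\<close> extends everything to negative radii, so that no domain has to be carried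
  along.\<close>

lemma tsol_family_continuous:
  assumes "0 \<le> M" and sol: "\<And>a. tsol M a (f a) (F a)"
  shows "continuous_on UNIV (\<lambda>p. f (fst p) (max 0 (snd p)))"
    and "continuous_on UNIV (\<lambda>p. F (fst p) (max 0 (snd p)))"
proof -
  define L where "L = m * M powr (m - 1) + k * M powr (k - 1)"
  note lip = trunc_nonlinearities[OF assms(1), folded L_def]
  define E where "E T = exp ((3 * L + \<alpha> + 2 * \<beta> * T * L) * T)" for T
  have diff: "\<bar>f a s - f b s\<bar> \<le> \<bar>a - b\<bar> * sqrt (E T) \<and> \<bar>F a s - F b s\<bar> \<le> \<bar>a - b\<bar> * sqrt (E T)"
    if s: "0 \<le> s" "s < T" for a b s T
  proof -
    have "(f a s - f b s)\<^sup>2 + (F a s - F b s)\<^sup>2 \<le> (a - b)\<^sup>2 * exp ((3 * L + \<alpha> + 2 * \<beta> * T * L) * s)"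
      by (rule ivp_difference[of d \<alpha> \<beta> "\<lambda>x. spow m (trunc_at M x)" "\<lambda>x. \<bar>trunc_at M x\<bar> powr k" a T _ _ b])
        (use sol \<alpha>_pos \<beta>_pos lip s in \<open>auto simp: tsol_def\<close>)
    also have "\<dots> \<le> (a - b)\<^sup>2 * E T"
      unfolding E_def using lip(1) \<alpha>_pos \<beta>_pos s by (intro mult_left_mono) (auto intro!: mult_left_mono)
    finally have "(f a s - f b s)\<^sup>2 \<le> (a - b)\<^sup>2 * E T" "(F a s - F b s)\<^sup>2 \<le> (a - b)\<^sup>2 * E T"
      using zero_le_power2[of "f a s - f b s"] zero_le_power2[of "F a s - F b s"] by linarith+
    from this[THEN real_sqrt_le_mono] show ?thesis by (simp add: real_sqrt_mult)
  qed
  have general: "continuous_on UNIV (\<lambda>p. g (fst p) (max 0 (snd p)))"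
    if g: "\<And>a T. continuous_on {0..<T} (g a)"
      and gd: "\<And>a b s T. 0 \<le> s \<Longrightarrow> s < T \<Longrightarrow> \<bar>g a s - g b s\<bar> \<le> \<bar>a - b\<bar> * sqrt (E T)"
    for g :: "real \<Rightarrow> real \<Rightarrow> real"
  proof (rule continuous_at_imp_continuous_on, rule ballI)
    fix p :: "real \<times> real"
    obtain a0 s0 where p: "p = (a0, s0)" by force
    define h where "h s = g a0 (max 0 s)" for s
    have "continuous_on {..<T} h" for T
      unfolding h_def by (rule continuous_on_compose2[OF g[of "max 1 T" a0]]) (auto intro!: continuous_intros)
    then have "isCont h s0"
      using continuous_on_eq_continuous_at[of "{..<s0 + 1}" h] by auto
    have fst': "((\<lambda>x. fst x) \<longlongrightarrow> a0) (at p)" and snd': "((\<lambda>x. snd x) \<longlongrightarrow> s0) (at p)"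
      using tendsto_fst[OF tendsto_ident_at[of p UNIV]] tendsto_snd[OF tendsto_ident_at[of p UNIV]] p by auto
    have h: "((\<lambda>x. h (snd x)) \<longlongrightarrow> h s0) (at p)"
      by (rule isCont_tendsto_compose[OF \<open>isCont h s0\<close> snd'])
    define T where "T = \<bar>s0\<bar> + 1"
    from snd' have "\<forall>\<^sub>F x in at p. snd x < T" by (rule order_tendstoD(2)) (simp add: T_def)
    then have "\<forall>\<^sub>F x in at p. norm (g (fst x) (max 0 (snd x)) - h s0)
        \<le> \<bar>fst x - a0\<bar> * sqrt (E T) + \<bar>h (snd x) - h s0\<bar>"
    proof eventually_elim
      case (elim x)
      have "\<bar>g (fst x) (max 0 (snd x)) - g a0 (max 0 (snd x))\<bar> \<le> \<bar>fst x - a0\<bar> * sqrt (E T)"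
        by (rule gd) (use elim in \<open>auto simp: T_def\<close>)
      then show ?case unfolding h_def real_norm_def by linarith
    qed
    moreover have "((\<lambda>x. \<bar>fst x - a0\<bar> * sqrt (E T) + \<bar>h (snd x) - h s0\<bar>) \<longlongrightarrow> 0) (at p)"
    proof -
      have "((\<lambda>x. \<bar>fst x - a0\<bar> * sqrt (E T) + \<bar>h (snd x) - h s0\<bar>)
          \<longlongrightarrow> \<bar>a0 - a0\<bar> * sqrt (E T) + \<bar>h s0 - h s0\<bar>) (at p)"
        by (intro tendsto_intros h fst')
      then show ?thesis by simp
    qed
    ultimately have "((\<lambda>x. g (fst x) (max 0 (snd x)) - h s0) \<longlongrightarrow> 0) (at p)"
      by (rule Lim_null_comparison)
    then show "isCont (\<lambda>p. g (fst p) (max 0 (snd p))) p"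
      unfolding isCont_def using p by (auto simp: h_def dest: LIM_zero_cancel)
  qed
  show "continuous_on UNIV (\<lambda>p. f (fst p) (max 0 (snd p)))"
    by (rule general) (use tsol_continuous(1)[OF sol] diff in auto)
  show "continuous_on UNIV (\<lambda>p. F (fst p) (max 0 (snd p)))"
    by (rule general) (use tsol_continuous(2)[OF sol] diff in auto)
qed

lemma ex_trapped: "\<exists>a f F. trapped_profile d m k \<beta> a f F"
proof -
  obtain a1 where a1: "0 < a1"
    "\<And>a M f F. 0 < a \<Longrightarrow> a < a1 \<Longrightarrow> 0 < M \<Longrightarrow> \<alpha> * a < M powr k \<Longrightarrow> tsol M a f F \<Longrightarrow> exits_above f F"
    using exits_above_small by blast
  obtain a2 where a2: "0 < a2"
    "\<And>a M f F. a2 < a \<Longrightarrow> 0 < M \<Longrightarrow> \<alpha> * a < M powr k \<Longrightarrow> tsol M a f F \<Longrightarrow> exits_below f F"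
    using exits_below_large by blast
  \<comment> \<open>The maximum ensures \<open>x \<le> y\<close>.\<close>
  define x y where "x = a1 / 2" and "y = max (a2 + 1) a1"
  have xy: "0 < x" "x < a1" "x \<le> y" "a2 < y" 
    unfolding x_def y_def using a1(1) a2(1) by linarith+
  \<comment> \<open>One truncation height for all central values up to \<open>y\<close>: a family
    truncated at a height depending on \<open>a\<close> would not be covered by the continuity
    lemma.\<close>
  define M where "M = (\<alpha> * (y + 1)) powr (1 / k)"
  have M: "0 < M" "M powr k = \<alpha> * (y + 1)"
    using xy \<alpha>_pos k_gt_1 by (auto simp: M_def powr_powr)
  have aM: "\<alpha> * a < M powr k" if "a \<le> y" for a unfolding M using that \<alpha>_pos by (intro mult_strict_left_mono) auto
  have "\<exists>p. tsol M a (fst p) (snd p)" for a using ex_tsol[of M a] M by auto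
  then obtain p where p: "\<And>a. tsol M a (fst (p a)) (snd (p a))" by metis
  define f F where "f a = fst (p a)" and "F a = snd (p a)" for a
  have sol: "tsol M a (f a) (F a)" for a unfolding f_def F_def by (rule p)
  note cont = tsol_family_continuous[OF less_imp_le[OF M(1)] sol]
  define DD YY where "DD q = D (f (fst q)) (F (fst q)) (max 0 (snd q))"
    and "YY q = Y (F (fst q)) (max 0 (snd q))" for q :: "real \<times> real"
  have cD: "continuous_on UNIV DD"
    unfolding DD_def D_def
    by (intro continuous_intros cont continuous_on_compose2[OF continuous_on_spow[OF m_gt(1)] cont(2)]) auto
  have cY: "continuous_on UNIV YY"
    unfolding YY_def Y_def using k_gt_1 by (intro continuous_intros continuous_on_powr' cont) auto
  have below: "{a. exits_below (f a) (F a)}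
      = {a. \<exists>r>0. 0 < - DD (a, r) \<and> (\<forall>s\<in>{0..r}. 0 < \<kappa> - YY (a, s))}"
    by (auto simp: exits_below_def DD_def YY_def)
  have above: "{a. exits_above (f a) (F a)}
      = {a. \<exists>r>0. 0 < YY (a, r) - \<kappa> \<and> (\<forall>s\<in>{0..r}. 0 < DD (a, s))}"
    by (auto simp: exits_above_def DD_def YY_def)
  have ob: "open {a. exits_below (f a) (F a)}"
    unfolding below by (intro open_uniformly_positive continuous_intros cD cY)
  have oa: "open {a. exits_above (f a) (F a)}"
    unfolding above by (intro open_uniformly_positive continuous_intros cD cY)
  have x: "exits_above (f x) (F x)" using a1(2)[OF xy(1,2) M(1) aM[OF xy(3)] sol] .
  have y: "exits_below (f y) (F y)" using a2(2)[OF xy(4) M(1) aM[OF order.refl] sol] .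
  have disj: "{a. exits_below (f a) (F a)} \<inter> {a. exits_above (f a) (F a)} \<inter> {x..y} = {}"
    using exits_disjoint by blast
  have "\<not> {x..y} \<subseteq> {a. exits_below (f a) (F a)} \<union> {a. exits_above (f a) (F a)}"
  proof
    assume "{x..y} \<subseteq> {a. exits_below (f a) (F a)} \<union> {a. exits_above (f a) (F a)}"
    from connectedD[OF connected_Icc ob oa disj this]
    show False using x y xy(3) by auto
  qed
  then obtain a where a: "a \<in> {x..y}" "\<not> exits_above (f a) (F a)" "\<not> exits_below (f a) (F a)" by blast
  have "0 < a" using a xy by auto
  show ?thesis
  proof (cases rule: tsol_cases[OF sol[of a] \<open>0 < a\<close> M(1) aM[of a]])
    \<comment> \<open>The side condition \<open>a \<le> y\<close> left over from
      \<open>aM\<close>.\<close>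
    case 1
    then show ?case using a by simp
  next
    case 2
    then have "trapped_profile d m k \<beta> a (f a) (F a)" by unfold_locales auto
    then show ?thesis by blast
  next
    case (3 c T)
    then show ?thesis using a by blast
  qed
qed

end

section \<open>Uniqueness in dimension one\<close>

text \<open>\<open>\<sigma> r\<close> is the radius where \<open>f\<^sub>2\<close> has the height
  \<open>f\<^sub>1 r\<close>, so \<open>\<Psi>\<close> compares the fluxes at equal height. The
  factor \<open>c > 1\<close> makes \<open>\<Psi>\<close> positive at the start and keeps it so;
  \<open>dom\<close> makes it nondecreasing in the end. As \<open>F\<^sub>2\<close> tends to 0, a
  positive lower bound for \<open>\<Psi>\<close> is impossible.\<close>

lemma flat_comparison:
  fixes f\<^sub>1 F\<^sub>1 f\<^sub>2 F\<^sub>2 :: "real \<Rightarrow> real" and \<alpha> \<beta> m k c a :: real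
  assumes par: "0 < \<alpha>" "0 < \<beta>" "1 < m" "k < m" "1 < c"
    and cont: "continuous_on {0..} f\<^sub>1" "continuous_on {0..} F\<^sub>1" "continuous_on {0..} f\<^sub>2" "continuous_on {0..} F\<^sub>2"
    and ini: "f\<^sub>1 0 = a" "F\<^sub>1 0 = 0" "f\<^sub>2 0 = a" "F\<^sub>2 0 = 0" and a: "0 < a" and k: "1 < k"
    and pos: "\<And>r. 0 < r \<Longrightarrow> 0 < F\<^sub>1 r" "\<And>r. 0 < r \<Longrightarrow> 0 < F\<^sub>2 r" "\<And>r. 0 < r \<Longrightarrow> 0 < f\<^sub>1 r"
    and df: "\<And>r. 0 < r \<Longrightarrow> (f\<^sub>1 has_real_derivative - (F\<^sub>1 r powr m)) (at r)"
      "\<And>r. 0 < r \<Longrightarrow> (f\<^sub>2 has_real_derivative - (F\<^sub>2 r powr m)) (at r)"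
    and dF: "\<And>r. 0 < r \<Longrightarrow>
        (F\<^sub>1 has_real_derivative \<alpha> * f\<^sub>1 r - \<beta> * r * F\<^sub>1 r powr m - F\<^sub>1 r powr k) (at r)"
      "\<And>r. 0 < r \<Longrightarrow>
        (F\<^sub>2 has_real_derivative c * (\<alpha> * f\<^sub>2 r - \<beta> * r * F\<^sub>2 r powr m) - F\<^sub>2 r powr k) (at r)"
    and D\<^sub>2: "\<And>r. 0 < r \<Longrightarrow> 0 < \<alpha> * f\<^sub>2 r - \<beta> * r * F\<^sub>2 r powr m"
    and lim: "(f\<^sub>1 \<longlongrightarrow> 0) at_top" "(f\<^sub>2 \<longlongrightarrow> 0) at_top" "(F\<^sub>2 \<longlongrightarrow> 0) at_top"
    and dom: "\<forall>\<^sub>F r in at_top. m * \<alpha> * f\<^sub>1 r \<le> (m - k) * F\<^sub>1 r powr k"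
  shows False
proof -
  have dec: "f y < f x"
    if "0 \<le> x" "x < y" "continuous_on {0..} f" "\<And>r. 0 < r \<Longrightarrow> (f has_real_derivative - (F r powr m)) (at r)"
      "\<And>r. 0 < r \<Longrightarrow> 0 < F r" for x y and f F :: "real \<Rightarrow> real"
  proof (rule DERIV_neg_imp_decreasing_open[OF that(2)])
    fix s assume "x < s" "s < y"
    then have s: "0 < s" using that(1) by simp
    show "\<exists>z. (f has_real_derivative z) (at s) \<and> z < 0"
      using that(5)[OF s] by (intro exI[of _ "- (F s powr m)"] conjI that(4) s) simp
  qed (use that in \<open>auto intro: continuous_on_subset[OF that(3)]\<close>)
  have dec1: "f\<^sub>1 y < f\<^sub>1 x" if "0 \<le> x" "x < y" for x y using dec[OF that cont(1) df(1) pos(1)] .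
  have dec2: "f\<^sub>2 y < f\<^sub>2 x" if "0 \<le> x" "x < y" for x y using dec[OF that cont(3) df(2) pos(2)] .
  have below2: "\<exists>B>R. f\<^sub>2 B < y" if "0 < y" for y R
  proof -
    have "\<forall>\<^sub>F r in at_top. f\<^sub>2 r < y \<and> R < r"
      using order_tendstoD(2)[OF lim(2) that] eventually_gt_at_top by (rule eventually_conj)
    then show ?thesis using eventually_happens'[OF trivial_limit_at_top_linorder] by blast
  qed
  define G where "G = the_inv_into {0..} f\<^sub>2"
  have inj: "inj_on f\<^sub>2 {0..}" by (rule linorder_inj_onI) (use dec2 in force)+
  have Gf: "G (f\<^sub>2 s) = s" if "0 \<le> s" for s unfolding G_def using inj that by (simp add: the_inv_into_f_f)
  have surj: "\<exists>s\<ge>0. f\<^sub>2 s = y" if y: "0 < y" "y \<le> a" for y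
  proof -
    obtain B where B: "0 < B" "f\<^sub>2 B < y" using below2[OF y(1)] by blast
    have "continuous_on {0..B} f\<^sub>2" by (rule continuous_on_subset[OF cont(3)]) auto
    then show ?thesis using IVT2'[of f\<^sub>2 B y 0] B y ini by auto
  qed
  have G: "0 \<le> G y" "f\<^sub>2 (G y) = y" if "0 < y" "y \<le> a" for y
    using surj[OF that] Gf by auto
  define \<sigma> where "\<sigma> r = G (f\<^sub>1 r)" for r
  have f1a: "0 < f\<^sub>1 r" "f\<^sub>1 r \<le> a" if "0 \<le> r" for r
    using pos(3)[of r] dec1[of 0 r] ini a that by (cases "r = 0"; force)+
  have \<sigma>: "0 \<le> \<sigma> r" "f\<^sub>2 (\<sigma> r) = f\<^sub>1 r" if "0 \<le> r" for r
    unfolding \<sigma>_def using G f1a[OF that] by auto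
  have \<sigma>_pos: "0 < \<sigma> r" if "0 < r" for r
  proof -
    have "\<sigma> r \<noteq> 0" using \<sigma>(2)[of r] dec1[of 0 r] that ini by auto
    then show ?thesis using \<sigma>(1)[of r] that by simp
  qed
  have \<sigma>_0: "\<sigma> 0 = 0" using Gf[of 0] ini by (simp add: \<sigma>_def)
  have \<sigma>_less: "\<sigma> r < s" if "0 \<le> r" "0 \<le> s" "f\<^sub>2 s < f\<^sub>1 r" for r s
    using dec2[of s "\<sigma> r"] \<sigma>[of r] that by (cases "\<sigma> r = s") force+
  have \<sigma>_greater: "s < \<sigma> r" if "0 \<le> r" "0 \<le> s" "f\<^sub>1 r < f\<^sub>2 s" for r s
    using dec2[of "\<sigma> r" s] \<sigma>[of r] that by (cases "\<sigma> r = s") force+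
  have \<sigma>_cont: "continuous_on {0..R} \<sigma>" for R
  proof (cases "0 \<le> R")
    case True
    obtain B where B: "0 < B" "f\<^sub>2 B < f\<^sub>1 R" using below2[OF f1a(1)[OF True]] by blast
    have "continuous_on (f\<^sub>2 ` {0..B}) G"
      by (rule continuous_on_inv) (use Gf in \<open>auto intro: continuous_on_subset[OF cont(3)]\<close>)
    then have "continuous_on {0..R} (\<lambda>r. G (f\<^sub>1 r))"
    proof (rule continuous_on_compose2)
      show "continuous_on {0..R} f\<^sub>1" by (rule continuous_on_subset[OF cont(1)]) auto
      show "f\<^sub>1 ` {0..R} \<subseteq> f\<^sub>2 ` {0..B}"
      proof
        fix y assume "y \<in> f\<^sub>1 ` {0..R}"
        then obtain r where r: "0 \<le> r" "r \<le> R" "y = f\<^sub>1 r" by auto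
        have "f\<^sub>1 R \<le> f\<^sub>1 r" using dec1[of r R] r by (cases "r = R") auto
        then have "\<sigma> r < B" using B r by (intro \<sigma>_less) auto
        then show "y \<in> f\<^sub>2 ` {0..B}" using \<sigma>[of r] r by (intro image_eqI[of _ _ "\<sigma> r"]) auto
      qed
    qed
    then show ?thesis unfolding \<sigma>_def[abs_def] .
  qed simp
  have \<sigma>_deriv: "(\<sigma> has_real_derivative F\<^sub>1 r powr m / F\<^sub>2 (\<sigma> r) powr m) (at r)" if r: "0 < r" for r
  proof -
    let ?s = "\<sigma> r"
    have s: "0 < ?s" by (rule \<sigma>_pos[OF r])
    have "isCont G (f\<^sub>2 ?s)"
    proof (rule isCont_inverse_function[where f = f\<^sub>2 and x = "?s" and d = "?s / 2"])
      fix z assume "\<bar>z - ?s\<bar> \<le> ?s / 2"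
      then have z: "0 < z" using s by linarith
      show "G (f\<^sub>2 z) = z" using Gf z by simp
      show "isCont f\<^sub>2 z" using df(2)[OF z] DERIV_isCont by blast
    qed (use s in simp)
    then have G_cont: "isCont G (f\<^sub>1 r)" using \<sigma>(2)[of r] r by simp
    have lt: "f\<^sub>1 r < a" using dec1[of 0 r] r ini by simp
    have "(G has_real_derivative inverse (- (F\<^sub>2 ?s powr m))) (at (f\<^sub>1 r))"
    proof (rule DERIV_inverse_function[where f = f\<^sub>2 and a = 0 and b = a])
      show "DERIV f\<^sub>2 (G (f\<^sub>1 r)) :> - (F\<^sub>2 ?s powr m)" using df(2)[OF s] by (simp add: \<sigma>_def)
      show "- (F\<^sub>2 ?s powr m) \<noteq> 0" using pos(2)[OF s] by simp
      show "f\<^sub>2 (G y) = y" if "0 < y" "y < a" for y using G(2) that by simp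
    qed (use pos(3)[OF r] lt G_cont in auto)
    from DERIV_chain2[OF this df(1)[OF r]] show ?thesis
      unfolding \<sigma>_def by (simp add: field_simps)
  qed
  define \<Psi> where "\<Psi> r = F\<^sub>2 (\<sigma> r) - F\<^sub>1 r" for r
  have \<Psi>_deriv: "(\<Psi> has_real_derivative
      (c * (\<alpha> * f\<^sub>1 r - \<beta> * \<sigma> r * F\<^sub>2 (\<sigma> r) powr m) - F\<^sub>2 (\<sigma> r) powr k) * (F\<^sub>1 r powr m / F\<^sub>2 (\<sigma> r) powr m)
      - (\<alpha> * f\<^sub>1 r - \<beta> * r * F\<^sub>1 r powr m - F\<^sub>1 r powr k)) (at r)" if r: "0 < r" for r
    unfolding \<Psi>_def
    using DERIV_diff[OF DERIV_chain2[OF dF(2)[OF \<sigma>_pos[OF r]] \<sigma>_deriv[OF r]] dF(1)[OF r]] \<sigma>(2)[of r] r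
    by simp
  have \<Psi>_cont: "continuous_on {0..R} \<Psi>" for R
    unfolding \<Psi>_def
    by (intro continuous_intros continuous_on_compose2[OF cont(4) \<sigma>_cont] continuous_on_subset[OF cont(2)])
      (use \<sigma> in auto)
  text \<open>Near the centre \<open>F\<^sup>m\<^sup>+\<^sup>1/(m+1)\<close> behaves like \<open>F'(0) (a - f)\<close>, so the larger initial slope wins.\<close>
  have start: "\<exists>b>0. \<forall>r. 0 < r \<longrightarrow> r < b \<longrightarrow> 0 < \<Psi> r"
  proof -
    \<comment> \<open>The midpoint between the slopes \<open>\<alpha> * a\<close> and
      \<open>c * (\<alpha> * a)\<close> of the two fluxes at the centre.\<close>
    define q where "q = \<alpha> * a * (1 + c) / 2"
    have q: "\<alpha> * a < q" "q < c * (\<alpha> * a)" using par a by (auto simp: q_def field_simps)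
    define P\<^sub>1 where "P\<^sub>1 r = q - (\<alpha> * f\<^sub>1 r - \<beta> * r * spow m (F\<^sub>1 r) - spow k (F\<^sub>1 r))" for r
    define P\<^sub>2 where "P\<^sub>2 r = c * (\<alpha> * f\<^sub>2 r - \<beta> * r * spow m (F\<^sub>2 r)) - spow k (F\<^sub>2 r) - q" for r
    have sub: "continuous_on {0..<1} f\<^sub>1" "continuous_on {0..<1} F\<^sub>1" "continuous_on {0..<1} f\<^sub>2" "continuous_on {0..<1} F\<^sub>2"
      using cont by (auto elim: continuous_on_subset)
    have sp: "continuous_on {0..<1} (\<lambda>x. spow e (F x))"
      if "continuous_on {0..<1} F" "1 < e" for e and F :: "real \<Rightarrow> real"
      by (rule continuous_on_compose2[OF continuous_on_spow[OF that(2)] that(1)]) auto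
    have "continuous_on {0..<1} P\<^sub>1" "continuous_on {0..<1} P\<^sub>2"
      unfolding P\<^sub>1_def P\<^sub>2_def using par k by (intro continuous_intros sub sp; simp)+
    then have "\<exists>b. 0 < b \<and> b < 1 \<and> (\<forall>s\<in>{0..b}. 0 < P\<^sub>1 s)" "\<exists>b. 0 < b \<and> b < 1 \<and> (\<forall>s\<in>{0..b}. 0 < P\<^sub>2 s)"
      by (intro pos_beyond; use q ini in \<open>simp add: P\<^sub>1_def P\<^sub>2_def\<close>)+
    then obtain b\<^sub>1 b\<^sub>2 where b12: "0 < b\<^sub>1" "\<forall>s\<in>{0..b\<^sub>1}. 0 < P\<^sub>1 s" "0 < b\<^sub>2" "\<forall>s\<in>{0..b\<^sub>2}. 0 < P\<^sub>2 s" by blast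
    \<comment> \<open>The derivative of this energy is \<open>F powr m * (F' - q)\<close>, negative
      for the first profile and positive for the second. At equal heights the terms with
      \<open>f\<close> cancel and the fluxes are compared.\<close>
    define E\<^sub>1 where "E\<^sub>1 r = F\<^sub>1 r powr (m + 1) / (m + 1) + q * f\<^sub>1 r" for r
    define E\<^sub>2 where "E\<^sub>2 r = F\<^sub>2 r powr (m + 1) / (m + 1) + q * f\<^sub>2 r" for r
    have cE: "continuous_on {0..r} (\<lambda>r. F r powr (m + 1) / (m + 1) + q * f r)"
      if "continuous_on {0..} f" "continuous_on {0..} F" "\<And>r. 0 < r \<Longrightarrow> 0 < F r" "F 0 = 0"
      for r and f F :: "real \<Rightarrow> real"
    proof -
      have F0: "0 \<le> F s" if "s \<in> {0..r}" for s
        using that \<open>F 0 = 0\<close> \<open>\<And>r. 0 < r \<Longrightarrow> 0 < F r\<close>[of s] by (cases "s = 0") auto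
      have "continuous_on {0..r} f" "continuous_on {0..r} F"
        using that(1,2) by (auto elim: continuous_on_subset)
      then show ?thesis using par F0 by (intro continuous_intros continuous_on_powr') auto
    qed
    have dE: "((\<lambda>r. F r powr (m + 1) / (m + 1) + q * f r) has_real_derivative F r powr m * (F' - q)) (at r)"
      if "(f has_real_derivative - (F r powr m)) (at r)" "(F has_real_derivative F') (at r)" "0 < F r"
      for r F' and f F :: "real \<Rightarrow> real"
    proof -
      have "((\<lambda>r. F r powr (m + 1)) has_real_derivative (m + 1) * F r powr (m + 1 - 1) * F') (at r)"
        by (rule DERIV_chain2[OF has_real_derivative_powr[OF that(3)] that(2)])
      from DERIV_add[OF DERIV_cdivide[OF this, of "m + 1"] DERIV_cmult[OF that(1), of q]]
      show ?thesis by (rule DERIV_cong) (use par in \<open>simp add: field_simps\<close>)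
    qed
    have E1: "E\<^sub>1 r < q * a" if r: "0 < r" "r < b\<^sub>1" for r
    proof -
      have "E\<^sub>1 r < E\<^sub>1 0"
      proof (rule DERIV_neg_imp_decreasing_open[OF r(1)])
        fix s assume s: "0 < s" "s < r"
        have "0 < P\<^sub>1 s" using b12 s r by auto
        then have "F\<^sub>1 s powr m * ((\<alpha> * f\<^sub>1 s - \<beta> * s * F\<^sub>1 s powr m - F\<^sub>1 s powr k) - q) < 0"
          using pos(1)[OF s(1)] by (intro mult_pos_neg) (auto simp: P\<^sub>1_def spow_pos)
        then show "\<exists>y. (E\<^sub>1 has_real_derivative y) (at s) \<and> y < 0"
          using dE[OF df(1) dF(1) pos(1), OF s(1) s(1) s(1)] unfolding E\<^sub>1_def by blast
      qed (use cE[OF cont(1,2) pos(1) ini(2)] in \<open>simp add: E\<^sub>1_def[abs_def]\<close>)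
      then show ?thesis using ini by (simp add: E\<^sub>1_def)
    qed
    have E2: "q * a < E\<^sub>2 r" if r: "0 < r" "r < b\<^sub>2" for r
    proof -
      have "E\<^sub>2 0 < E\<^sub>2 r"
      proof (rule DERIV_pos_imp_increasing_open[OF r(1)])
        fix s assume s: "0 < s" "s < r"
        have "0 < P\<^sub>2 s" using b12 s r by auto
        then have "0 < F\<^sub>2 s powr m * ((c * (\<alpha> * f\<^sub>2 s - \<beta> * s * F\<^sub>2 s powr m) - F\<^sub>2 s powr k) - q)"
          using pos(2)[OF s(1)] by (intro mult_pos_pos) (auto simp: P\<^sub>2_def spow_pos)
        then show "\<exists>y. (E\<^sub>2 has_real_derivative y) (at s) \<and> 0 < y"
          using dE[OF df(2) dF(2) pos(2), OF s(1) s(1) s(1)] unfolding E\<^sub>2_def by blast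
      qed (use cE[OF cont(3,4) pos(2) ini(4)] in \<open>simp add: E\<^sub>2_def[abs_def]\<close>)
      then show ?thesis using ini by (simp add: E\<^sub>2_def)
    qed
    have "f\<^sub>2 b\<^sub>2 < a" using dec2[of 0 b\<^sub>2] b12 ini by simp
    then have "0 < f\<^sub>1 0 - f\<^sub>2 b\<^sub>2" using ini by simp
    moreover have "continuous_on {0..<1} (\<lambda>r. f\<^sub>1 r - f\<^sub>2 b\<^sub>2)" by (intro continuous_intros sub)
    ultimately have "\<exists>b. 0 < b \<and> b < 1 \<and> (\<forall>s\<in>{0..b}. 0 < f\<^sub>1 s - f\<^sub>2 b\<^sub>2)"
      by (intro pos_beyond) auto
    then obtain b\<^sub>3 where b3: "0 < b\<^sub>3" "\<forall>s\<in>{0..b\<^sub>3}. 0 < f\<^sub>1 s - f\<^sub>2 b\<^sub>2" by blast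
    have "0 < \<Psi> r" if r: "0 < r" "r < min b\<^sub>1 b\<^sub>3" for r
    proof -
      have "\<sigma> r < b\<^sub>2" using b3 b12 r by (intro \<sigma>_less) auto
      then have "E\<^sub>1 r < E\<^sub>2 (\<sigma> r)" using E1[of r] E2[of "\<sigma> r"] r \<sigma>_pos[of r] by auto
      then have lt: "F\<^sub>1 r powr (m + 1) < F\<^sub>2 (\<sigma> r) powr (m + 1)"
        using \<sigma>(2)[of r] r par by (simp add: E\<^sub>1_def E\<^sub>2_def divide_less_cancel)
      have "F\<^sub>1 r < F\<^sub>2 (\<sigma> r)"
        by (rule powr_less_cancel2[OF _ _ _ lt]) (use par pos \<sigma>_pos r in auto)
      then show ?thesis by (simp add: \<Psi>_def)
    qed
    then show ?thesis using b12 b3 by (intro exI[of _ "min b\<^sub>1 b\<^sub>3"]) auto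
  qed
  \<comment> \<open>With the larger flux the second profile descends faster:
    \<open>\<sigma>' = (F\<^sub>1 / F\<^sub>2) powr m < 1\<close>.\<close>
  have \<sigma>_lt: "\<sigma> r < r" if r: "0 < r" and P: "\<And>s. 0 < s \<Longrightarrow> s < r \<Longrightarrow> 0 < \<Psi> s" for r
  proof -
    have "0 - \<sigma> 0 < r - \<sigma> r"
    proof (rule DERIV_pos_imp_increasing_open[where f = "\<lambda>r. r - \<sigma> r", OF r])
      fix s assume s: "0 < s" "s < r"
      have "F\<^sub>1 s powr m < F\<^sub>2 (\<sigma> s) powr m"
        using P[OF s] pos(1)[OF s(1)] par by (intro powr_less_mono2) (auto simp: \<Psi>_def)
      then have "0 < 1 - F\<^sub>1 s powr m / F\<^sub>2 (\<sigma> s) powr m"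
        using pos(2)[OF \<sigma>_pos[OF s(1)]] by (simp add: divide_less_eq)
      then show "\<exists>y. ((\<lambda>r. r - \<sigma> r) has_real_derivative y) (at s) \<and> 0 < y"
        using DERIV_diff[OF DERIV_ident \<sigma>_deriv[OF s(1)]] by blast
    qed (intro continuous_intros \<sigma>_cont)
    then show ?thesis using \<sigma>_0 by simp
  qed
  obtain b where b: "0 < b" "\<And>r. 0 < r \<Longrightarrow> r < b \<Longrightarrow> 0 < \<Psi> r" using start by blast
  have \<Psi>_pos: "0 < \<Psi> r" if r: "0 < r" for r
  proof (rule ccontr)
    assume neg: "\<not> 0 < \<Psi> r"
    then have "b \<le> r" using b(2)[OF r] by force
    obtain x where x: "b / 2 < x" "x \<le> r" "\<Psi> x = 0" "\<And>s. b / 2 \<le> s \<Longrightarrow> s < x \<Longrightarrow> 0 < \<Psi> s"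
    proof (rule first_zero[of "b/2" r \<Psi>])
      show "continuous_on {b/2..r} \<Psi>" using \<Psi>_cont[of r] by (rule continuous_on_subset) (use b in auto)
    qed (use b neg \<open>b \<le> r\<close> in auto)
    have x0: "0 < x" using x b by simp
    have P: "0 < \<Psi> s" if "0 < s" "s < x" for s
      using b(2)[of s] x(4)[of s] that b(1) by (cases "s < b") auto
    have \<sigma>x: "\<sigma> x < x" by (rule \<sigma>_lt[OF x0 P])
    have eq: "F\<^sub>2 (\<sigma> x) = F\<^sub>1 x" using x(3) by (simp add: \<Psi>_def)
    \<comment> \<open>At a zero of \<open>\<Psi>\<close> the absorption terms cancel. What differs
      is the factor \<open>c\<close> and the radius \<open>\<sigma> x < x\<close>; both push
      \<open>\<Psi>'\<close> above 0, which is impossible at a first zero.\<close>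
    define d\<^sub>2 where "d\<^sub>2 = \<alpha> * f\<^sub>1 x - \<beta> * \<sigma> x * F\<^sub>1 x powr m"
    have "(\<Psi> has_real_derivative (c * d\<^sub>2 - F\<^sub>1 x powr k) * (F\<^sub>1 x powr m / F\<^sub>1 x powr m)
        - (\<alpha> * f\<^sub>1 x - \<beta> * x * F\<^sub>1 x powr m - F\<^sub>1 x powr k)) (at x)"
      using \<Psi>_deriv[OF x0] unfolding eq d\<^sub>2_def .
    then have "(\<Psi> has_real_derivative c * d\<^sub>2 - (\<alpha> * f\<^sub>1 x - \<beta> * x * F\<^sub>1 x powr m)) (at x)"
      by (rule DERIV_cong) (use pos(1)[OF x0] in simp)
    then have "c * d\<^sub>2 - (\<alpha> * f\<^sub>1 x - \<beta> * x * F\<^sub>1 x powr m) \<le> 0"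
      by (rule deriv_at_first_zero_nonpos[where g = \<Psi> and c = x and a = 0]) (use x0 x(3) P in auto)
    moreover have "\<alpha> * f\<^sub>1 x - \<beta> * x * F\<^sub>1 x powr m < d\<^sub>2"
      unfolding d\<^sub>2_def using \<sigma>x par pos(1)[OF x0] by simp
    moreover have "0 < d\<^sub>2" using D\<^sub>2[OF \<sigma>_pos[OF x0]] \<sigma>(2)[of x] x0 by (simp add: eq d\<^sub>2_def)
    then have "d\<^sub>2 < c * d\<^sub>2" using par by simp
    ultimately show False by linarith
  qed
  obtain r\<^sub>1 where r1: "\<forall>r\<ge>r\<^sub>1. m * \<alpha> * f\<^sub>1 r \<le> (m - k) * F\<^sub>1 r powr k"
    using dom unfolding eventually_at_top_linorder by blast
  define R where "R = max 1 r\<^sub>1"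
  have incr: "\<Psi> R \<le> \<Psi> r" if "R \<le> r" for r
  proof (rule DERIV_nonneg_imp_nondecreasing[OF that])
    fix s assume "R \<le> s" "s \<le> r"
    then have s: "0 < s" "r\<^sub>1 \<le> s" by (auto simp: R_def)
    define x y where "x = F\<^sub>1 s" and "y = F\<^sub>2 (\<sigma> s)"
    have xy: "0 < x" "x < y" using pos(1)[OF s(1)] \<Psi>_pos[OF s(1)] by (auto simp: x_def y_def \<Psi>_def)
    \<comment> \<open>\<open>\<Psi>'\<close> is \<open>x powr m\<close> times \<open>(h y - h x) +
      \<beta> * (s - \<sigma> s) + (c - 1) * d\<^sub>2 / y powr m\<close>. Only the first summand
      needs an argument, and \<open>dom\<close> is the condition for \<open>h' \<ge> 0\<close> from
      \<open>x\<close> on.\<close>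
    define h where "h u = \<alpha> * f\<^sub>1 s * u powr (- m) - u powr (k - m)" for u
    have "h x \<le> h y"
    proof (rule DERIV_nonneg_imp_nondecreasing[of x y h])
      fix u assume u: "x \<le> u" "u \<le> y"
      have u0: "0 < u" using u xy by simp
      have "m * \<alpha> * f\<^sub>1 s \<le> (m - k) * x powr k" using r1 s(2) by (simp add: x_def)
      also have "\<dots> \<le> (m - k) * u powr k" using par k xy u by (intro mult_left_mono powr_mono2) auto
      finally have "0 \<le> u powr (- m - 1) * ((m - k) * u powr k - m * \<alpha> * f\<^sub>1 s)" by simp
      moreover have "u powr (k - m - 1) = u powr (- m - 1) * u powr k"
        unfolding powr_add[symmetric] by (simp add: algebra_simps)
      ultimately have "0 \<le> \<alpha> * f\<^sub>1 s * (- m * u powr (- m - 1)) - (k - m) * u powr (k - m - 1)"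
        by (simp add: algebra_simps)
      moreover have "(h has_real_derivative \<alpha> * f\<^sub>1 s * (- m * u powr (- m - 1)) - (k - m) * u powr (k - m - 1)) (at u)"
        unfolding h_def by (intro DERIV_diff DERIV_cmult has_real_derivative_powr u0)
      ultimately show "\<exists>z. (h has_real_derivative z) (at u) \<and> 0 \<le> z" by blast
    qed (use xy in simp)
    have \<sigma>s: "\<sigma> s < s" by (rule \<sigma>_lt[OF s(1) \<Psi>_pos])
    define d\<^sub>2 where "d\<^sub>2 = \<alpha> * f\<^sub>1 s - \<beta> * \<sigma> s * y powr m"
    have d2: "0 < d\<^sub>2" using D\<^sub>2[OF \<sigma>_pos[OF s(1)]] \<sigma>(2)[of s] s(1) by (simp add: y_def d\<^sub>2_def)
    have "0 \<le> x powr m * ((h y - h x) + \<beta> * (s - \<sigma> s) + (c - 1) * d\<^sub>2 / y powr m)"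
      using \<open>h x \<le> h y\<close> \<sigma>s par d2 by (intro mult_nonneg_nonneg add_nonneg_nonneg) auto
    also have "\<dots> = (c * d\<^sub>2 - y powr k) * (x powr m / y powr m) - (\<alpha> * f\<^sub>1 s - \<beta> * s * x powr m - x powr k)"
    proof -
      have "h u = (\<alpha> * f\<^sub>1 s - u powr k) / u powr m" if "0 < u" for u
        using that by (simp add: h_def powr_diff powr_minus divide_inverse algebra_simps)
      then have hxy: "h x = (\<alpha> * f\<^sub>1 s - x powr k) / x powr m" "h y = (\<alpha> * f\<^sub>1 s - y powr k) / y powr m"
        using xy by auto
      have id: "p * (((A - v) / q - (A - u) / p) + \<beta> * (s - t) + (c - 1) * (A - \<beta> * t * q) / q)
          = (c * (A - \<beta> * t * q) - v) * (p / q) - (A - \<beta> * s * p - u)"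
        if "p \<noteq> 0" "q \<noteq> 0" for p q u v A t :: real
        using that by (simp add: field_simps)
      show ?thesis unfolding hxy d\<^sub>2_def by (rule id) (use xy in auto)
    qed
    finally show "\<exists>z. (\<Psi> has_real_derivative z) (at s) \<and> 0 \<le> z"
      using \<Psi>_deriv[OF s(1)] unfolding x_def y_def d\<^sub>2_def by blast
  qed
  have R: "0 < \<Psi> R" by (rule \<Psi>_pos) (simp add: R_def)
  have "\<forall>\<^sub>F s in at_top. F\<^sub>2 s < \<Psi> R" by (rule order_tendstoD(2)[OF lim(3) R])
  then obtain B where B: "\<forall>s\<ge>B. F\<^sub>2 s < \<Psi> R" unfolding eventually_at_top_linorder by blast
  define B' where "B' = max B 0"
  have "0 < f\<^sub>2 B'"
  proof (rule ccontr)
    assume "\<not> 0 < f\<^sub>2 B'"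
    have 0: "0 < B' + 1" by (simp add: B'_def)
    have "f\<^sub>2 (B' + 1) < 0" using dec2[of B' "B' + 1"] \<open>\<not> 0 < f\<^sub>2 B'\<close> by (simp add: B'_def)
    moreover have "0 \<le> \<beta> * (B' + 1) * F\<^sub>2 (B' + 1) powr m" using par 0 by simp
    moreover have "\<alpha> * f\<^sub>2 (B' + 1) < 0" using par calculation(1) by (simp add: mult_pos_neg)
    ultimately show False using D\<^sub>2[OF 0] by linarith
  qed
  then have "\<forall>\<^sub>F r in at_top. f\<^sub>1 r < f\<^sub>2 B' \<and> R \<le> r"
    using order_tendstoD(2)[OF lim(1)] eventually_ge_at_top by (intro eventually_conj)
  then obtain r where r: "f\<^sub>1 r < f\<^sub>2 B'" "R \<le> r"
    using eventually_happens'[OF trivial_limit_at_top_linorder] by blast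
  have r0: "0 < r" using r by (simp add: R_def)
  have "B' < \<sigma> r" using r r0 by (intro \<sigma>_greater) (auto simp: B'_def)
  then have "F\<^sub>2 (\<sigma> r) < \<Psi> R" using B by (simp add: B'_def)
  moreover have "\<Psi> R \<le> F\<^sub>2 (\<sigma> r) - F\<^sub>1 r" using incr[OF r(2)] by (simp add: \<Psi>_def)
  moreover have "0 < F\<^sub>1 r" by (rule pos(1)[OF r0])
  ultimately show False by linarith
qed

section \<open>Decay like the singular solution implies trapping\<close>

context profile_ode
begin

text \<open>Because \<open>\<alpha> = \<beta> * \<mu>\<close>, the sign of \<open>D\<close> decides
  whether \<open>r powr \<mu> * f\<close>, the quantity with limit \<open>K\<close>, grows or
  falls.\<close>

lemma flow_scaled_deriv:
  assumes flow: "flow a T f F" and r: "0 < r" "r < T"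
  shows "((\<lambda>r. r powr \<mu> * f r) has_real_derivative r powr (\<mu> - 1) * (D f F r / \<beta>)) (at r)"
proof -
  have "r powr \<mu> = r powr (\<mu> - 1) * r" using powr_add[of r "\<mu> - 1" 1] r by simp
  then have eq: "\<mu> * r powr (\<mu> - 1) * f r + - (F r powr m) * r powr \<mu> = r powr (\<mu> - 1) * (D f F r / \<beta>)"
    using \<beta>_pos flow_pos[OF flow r] by (simp add: D_def \<alpha>_def spow_pos field_simps)
  show ?thesis
    by (rule DERIV_cong[OF DERIV_mult[OF has_real_derivative_powr[OF r(1)] flow_deriv(1)[OF flow r]] eq])
qed

text \<open>After an exit the solution stays in an invariant region, where two monotonicities clash.
  If \<open>D < 0\<close> and \<open>Y < \<kappa>\<close>, the difference to the singular solution
  increases to 0, so \<open>z \<le> K\<close>; but \<open>z\<close> decreases strictly and then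
  cannot tend to \<open>K\<close>. The other region is symmetric.\<close>

lemma trapped_of_limit:
  assumes flow: "\<And>T. flow a T f F" and lim: "((\<lambda>r. r powr \<mu> * f r) \<longlongrightarrow> K) at_top"
  shows "trapped_profile d m k \<beta> a f F"
proof (rule ccontr)
  assume "\<not> trapped_profile d m k \<beta> a f F"
  then obtain r where r: "0 < r" "\<not> in_Q0 f F r"
    using flow by (auto simp: trapped_profile_def trapped_profile_axioms_def profile_ode_axioms)
  obtain c where c: "0 < c" "D f F c = 0 \<and> Y F c < \<kappa> \<or> 0 < D f F c \<and> Y F c = \<kappa>"
    using flow_exit_cases[OF flow[of "r + 1"] r(1) _ r(2)] by (metis less_add_one)
  note cT = less_add_one[of c]
  have "\<exists>r0>0. D f F r0 < 0 \<and> Y F r0 < \<kappa> \<or> 0 < D f F r0 \<and> \<kappa> < Y F r0"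
    using c(2)
  proof
    assume "D f F c = 0 \<and> Y F c < \<kappa>"
    then obtain r where "c < r" "D f F r < 0" "\<forall>s\<in>{c..r}. Y F s < \<kappa>"
      using flow_beyond_D[OF flow c(1) cT] by blast
    then show ?thesis using c(1) by (intro exI[of _ r]) auto
  next
    assume "0 < D f F c \<and> Y F c = \<kappa>"
    then obtain r where "c < r" "\<kappa> < Y F r" "\<forall>s\<in>{c..r}. 0 < D f F s"
      using flow_beyond_Y[OF flow c(1) cT] by blast
    then show ?thesis using c(1) by (intro exI[of _ r]) auto
  qed
  then obtain r0 where r0: "0 < r0" "D f F r0 < 0 \<and> Y F r0 < \<kappa> \<or> 0 < D f F r0 \<and> \<kappa> < Y F r0" by blast
  define g where "g r = f r - K * r powr (- \<mu>)" for r
  define g' where "g' r = (\<kappa> powr (\<mu> + 1) - Y F r powr (\<mu> + 1)) * r powr (- \<mu> - 1)" for r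
  define z where "z r = r powr \<mu> * f r" for r
  have dg: "(g has_real_derivative g' r) (at r)" if "r0 \<le> r" for r
    unfolding g_def g'_def
    by (rule flow_singular_difference_deriv[OF flow, of r "r + 1"]) (use that r0 in auto)
  have dz: "(z has_real_derivative r powr (\<mu> - 1) * (D f F r / \<beta>)) (at r)" if "r0 \<le> r" for r
    unfolding z_def by (rule flow_scaled_deriv[OF flow, of r "r + 1"]) (use that r0 in auto)
  have z_cont: "continuous_on {x..y} z" if "r0 \<le> x" for x y
    using that by (intro continuous_at_imp_continuous_on ballI DERIV_isCont[OF dz]) auto
  have gz: "g r = r powr (- \<mu>) * (z r - K)" if "0 < r" for r
  proof -
    have "r powr (- \<mu>) * r powr \<mu> = 1" using that by (simp add: powr_add[symmetric])
    then have "r powr (- \<mu>) * z r = f r" by (simp add: z_def mult.assoc[symmetric])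
    then show ?thesis by (simp add: g_def right_diff_distrib mult.commute)
  qed
  have g_lim: "(g \<longlongrightarrow> 0) at_top"
  proof -
    have "((\<lambda>r. r powr (- \<mu>) * (z r - K)) \<longlongrightarrow> 0 * (K - K)) at_top"
      unfolding z_def by (intro tendsto_intros lim tendsto_powr_neg_at_top \<mu>_pos)
    then have "((\<lambda>r. r powr (- \<mu>) * (z r - K)) \<longlongrightarrow> 0) at_top" by simp
    moreover have "\<forall>\<^sub>F r in at_top. r powr (- \<mu>) * (z r - K) = g r"
      using eventually_gt_at_top[of 0] by (rule eventually_mono) (simp add: gz)
    ultimately show ?thesis by (rule Lim_transform_eventually)
  qed
  have zlim: "(z \<longlongrightarrow> K) at_top" using lim by (simp add: z_def[abs_def])
  have Y0: "0 \<le> Y F r" if "0 < r" for r using that by (simp add: Y_def)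
  show False
    using r0(2)
  proof
    assume Q: "D f F r0 < 0 \<and> Y F r0 < \<kappa>"
    have Q': "D f F r < 0 \<and> Y F r < \<kappa>" if "r0 \<le> r" for r
      using flow_trapped_below[OF flow r0(1) _ _ that, of "r + 1"] Q by simp
    have "\<forall>r\<ge>r0. g r \<le> 0"
    proof (rule tail_le_of_deriv_le[OF dg _ _ g_lim])
      fix r assume r: "r0 \<le> r"
      show "((\<lambda>_. 0::real) has_real_derivative 0) (at r)" by simp
      have "Y F r powr (\<mu> + 1) \<le> \<kappa> powr (\<mu> + 1)"
        using Q'[OF r] Y0[of r] r r0 \<mu>_pos by (intro powr_mono2) auto
      then show "0 \<le> g' r" by (simp add: g'_def)
    qed (assumption | rule tendsto_const)+
    then have "g r0 \<le> 0" by simp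
    then have "z r0 \<le> K" using gz[OF r0(1)] r0(1) by (simp add: mult_le_0_iff)
    moreover have "z (r0 + 1) < z r0"
    proof (rule DERIV_neg_imp_decreasing_open[where f = z])
      fix s assume "r0 < s" "s < r0 + 1"
      then show "\<exists>y. (z has_real_derivative y) (at s) \<and> y < 0"
        using dz[of s] Q'[of s] r0 \<beta>_pos
        by (intro exI[of _ "s powr (\<mu> - 1) * (D f F s / \<beta>)"]) (auto intro!: mult_pos_neg divide_neg_pos)
    qed (use z_cont in auto)
    moreover have "K \<le> z (r0 + 1)"
    proof (rule tendsto_upperbound[OF zlim])
      show "\<forall>\<^sub>F r in at_top. z r \<le> z (r0 + 1)"
        using eventually_ge_at_top[of "r0 + 1"]
      proof eventually_elim
        case (elim r)
        show ?case
        proof (rule DERIV_nonpos_imp_nonincreasing[where f = z, OF elim])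
          fix s assume "r0 + 1 \<le> s" "s \<le> r"
          then show "\<exists>y. (z has_real_derivative y) (at s) \<and> y \<le> 0"
            using dz[of s] Q'[of s] r0 \<beta>_pos
            by (intro exI[of _ "s powr (\<mu> - 1) * (D f F s / \<beta>)"])
              (auto intro!: mult_nonneg_nonpos divide_nonpos_pos)
        qed
      qed
    qed simp
    ultimately show False by linarith
  next
    assume Q: "0 < D f F r0 \<and> \<kappa> < Y F r0"
    have Q': "0 < D f F r \<and> \<kappa> < Y F r" if "r0 \<le> r" for r
      using flow_trapped_above[OF flow r0(1) _ _ that, of "r + 1"] Q by simp
    have "\<forall>r\<ge>r0. 0 \<le> g r"
    proof (rule tail_le_of_deriv_le[OF _ dg _ _ g_lim])
      fix r assume r: "r0 \<le> r"
      show "((\<lambda>_. 0::real) has_real_derivative 0) (at r)" by simp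
      have "\<kappa> powr (\<mu> + 1) \<le> Y F r powr (\<mu> + 1)"
        using Q'[OF r] \<kappa>_pos \<mu>_pos by (intro powr_mono2) auto
      then show "g' r \<le> 0" by (simp add: g'_def mult_nonpos_nonneg)
    qed (assumption | rule tendsto_const)+
    then have "0 \<le> g r0" by simp
    then have "K \<le> z r0" using gz[OF r0(1)] r0(1) by (simp add: zero_le_mult_iff)
    moreover have "z r0 < z (r0 + 1)"
    proof (rule DERIV_pos_imp_increasing_open[where f = z])
      fix s assume "r0 < s" "s < r0 + 1"
      then show "\<exists>y. (z has_real_derivative y) (at s) \<and> 0 < y"
        using dz[of s] Q'[of s] r0 \<beta>_pos
        by (intro exI[of _ "s powr (\<mu> - 1) * (D f F s / \<beta>)"]) auto
    qed (use z_cont in auto)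
    moreover have "z (r0 + 1) \<le> K"
    proof (rule tendsto_lowerbound[OF zlim])
      show "\<forall>\<^sub>F r in at_top. z (r0 + 1) \<le> z r"
        using eventually_ge_at_top[of "r0 + 1"]
      proof eventually_elim
        case (elim r)
        show ?case
        proof (rule DERIV_nonneg_imp_nondecreasing[where f = z, OF elim])
          fix s assume "r0 + 1 \<le> s" "s \<le> r"
          then show "\<exists>y. (z has_real_derivative y) (at s) \<and> 0 \<le> y"
            using dz[of s] Q'[of s] r0 \<beta>_pos
            by (intro exI[of _ "s powr (\<mu> - 1) * (D f F s / \<beta>)"]) auto
        qed
      qed
    qed simp
    ultimately show False by linarith
  qed
qed

end

section \<open>Limits of trapped solutions needed for the comparison\<close>

context trapped_profile
begin

lemma F_tendsto_0: "(F \<longlongrightarrow> 0) at_top"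
proof (rule tendsto_sandwich[OF _ _ tendsto_const])
  define e where "e = 1 / (k - 1)"
  have e: "0 < e" using k_gt_1 by (simp add: e_def)
  show "\<forall>\<^sub>F r in at_top. 0 \<le> F r"
    using eventually_gt_at_top[of 0] by (rule eventually_mono) (simp add: F_pos less_imp_le)
  show "((\<lambda>r. (\<kappa> / r) powr e) \<longlongrightarrow> 0) at_top" by (rule powr_div_tendsto_0[OF \<kappa>_pos e])
  show "\<forall>\<^sub>F r in at_top. F r \<le> (\<kappa> / r) powr e"
    using eventually_gt_at_top[of 0]
  proof eventually_elim
    case (elim r)
    have "F r = (Y F r / r) powr e" using F_powr[OF elim, of 1] F_pos[OF elim] by (simp add: e_def)
    also have "\<dots> \<le> (\<kappa> / r) powr e"
      using e Y_le[OF elim] Y_pos[OF elim] elim by (intro powr_mono2 divide_right_mono) auto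
    finally show ?case .
  qed
qed

lemma scaled_tendsto_K: "((\<lambda>r. r powr \<mu> * f r) \<longlongrightarrow> K) at_top"
proof -
  obtain A where "((\<lambda>r. (r powr \<mu> * f r - K) * r powr \<theta>) \<longlongrightarrow> - A) at_top" using asymptotics by blast
  then have "((\<lambda>r. (r powr \<mu> * f r - K) * r powr \<theta> * r powr (- \<theta>)) \<longlongrightarrow> - A * 0) at_top"
    by (intro tendsto_mult tendsto_powr_neg_at_top \<theta>_pos)
  then have "((\<lambda>r. (r powr \<mu> * f r - K) * r powr \<theta> * r powr (- \<theta>)) \<longlongrightarrow> 0) at_top" by simp
  moreover have "\<forall>\<^sub>F r in at_top. (r powr \<mu> * f r - K) * r powr \<theta> * r powr (- \<theta>) = r powr \<mu> * f r - K"
    using eventually_gt_at_top[of 0]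
    by (rule eventually_mono) (simp add: mult.assoc powr_add[symmetric])
  ultimately have "((\<lambda>r. r powr \<mu> * f r - K) \<longlongrightarrow> 0) at_top" by (rule Lim_transform_eventually)
  then show ?thesis by (rule LIM_zero_cancel)
qed

text \<open>\<open>f\<close> decays like \<open>r powr (- \<mu>)\<close>, while
  \<open>Y \<ge> Y F 1\<close> keeps \<open>F powr k\<close> above a multiple of
  \<open>r powr (- (k / (k - 1)))\<close>; the exponents differ by
  \<open>(m + 1 - 2 * k) / (k - 1) > 0\<close>. This provides \<open>dom\<close> of
  \<open>flat_comparison\<close>.\<close>

lemma absorption_dominates: "\<forall>\<^sub>F r in at_top. m * \<alpha> * f r \<le> (m - k) * F r powr k"
proof -
  define C where "C = m * \<alpha> * (K + 1) / ((m - k) * Y F 1 powr (k / (k - 1)))"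
  define e where "e = (m + 1 - 2 * k) / (k - 1)"
  have e: "0 < e" using k_gt_1 k_lt by (simp add: e_def)
  have e_eq: "k / (k - 1) = \<mu> - e" 
  proof -
    have "k - 1 \<noteq> 0" using k_gt_1 by simp
    then show ?thesis by (simp add: e_def \<mu>_def divide_simps)
  qed
  have "\<forall>\<^sub>F r in at_top. C * r powr (- e) < 1"
    by (rule order_tendstoD(2)[OF tendsto_mult_right_zero[OF tendsto_powr_neg_at_top[OF e]]]) simp
  moreover have "\<forall>\<^sub>F r in at_top. r powr \<mu> * f r < K + 1"
    by (rule order_tendstoD(2)[OF scaled_tendsto_K]) simp
  ultimately show ?thesis using eventually_ge_at_top[of 1]
  proof eventually_elim
    case (elim r)
    then have r: "0 < r" by simp
    have Y1: "0 < Y F 1 powr (k / (k - 1))" using Y_pos[of 1] by simp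
    have "f r * r powr \<mu> * r powr (- \<mu>) \<le> (K + 1) * r powr (- \<mu>)"
      using elim by (intro mult_right_mono) (auto simp: mult.commute)
    then have "f r \<le> (K + 1) * r powr (- \<mu>)" using r by (simp add: mult.assoc powr_add[symmetric])
    then have "m * \<alpha> * f r \<le> m * \<alpha> * ((K + 1) * r powr (- \<mu>))"
      using m_gt \<alpha>_pos by (intro mult_left_mono) auto
    also have "\<dots> = C * ((m - k) * Y F 1 powr (k / (k - 1))) * r powr (- \<mu>)"
      using Y1 m_gt by (simp add: C_def)
    also have "r powr (- \<mu>) = r powr (- e) * r powr (- (k / (k - 1)))"
      unfolding e_eq powr_add[symmetric] by simp
    also have "C * ((m - k) * Y F 1 powr (k / (k - 1))) * (r powr (- e) * r powr (- (k / (k - 1))))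
        = (C * r powr (- e)) * ((m - k) * Y F 1 powr (k / (k - 1)) * r powr (- (k / (k - 1))))" by simp
    also have "\<dots> \<le> 1 * ((m - k) * Y F 1 powr (k / (k - 1)) * r powr (- (k / (k - 1))))"
      using elim m_gt by (intro mult_right_mono) auto
    also have "\<dots> \<le> (m - k) * (Y F r powr (k / (k - 1)) * r powr (- (k / (k - 1))))"
      using m_gt k_gt_1 Y_mono[of 1 r] Y_pos[of 1] elim
      by (simp add: mult.assoc) (intro mult_left_mono mult_right_mono powr_mono2; simp)
    also have "Y F r powr (k / (k - 1)) * r powr (- (k / (k - 1))) = F r powr k"
      unfolding F_powr[OF r, of k] powr_divide powr_minus by (simp only: divide_inverse)
    finally show ?case .
  qed
qed

end

section \<open>Uniqueness by scaling\<close>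

context profile_ode
begin

lemma trapped_unique:
  assumes d: "d = 0" and 1: "trapped_profile d m k \<beta> a\<^sub>1 f\<^sub>1 F\<^sub>1" and 2: "trapped_profile d m k \<beta> a\<^sub>2 f\<^sub>2 F\<^sub>2"
  shows "a\<^sub>1 \<le> a\<^sub>2"
proof (rule ccontr)
  assume "\<not> a\<^sub>1 \<le> a\<^sub>2"
  interpret P: trapped_profile d m k \<beta> a\<^sub>2 f\<^sub>2 F\<^sub>2 by (rule 2)
  interpret Q: trapped_profile d m k \<beta> a\<^sub>1 f\<^sub>1 F\<^sub>1 by (rule 1)
  have a: "0 < a\<^sub>2" "a\<^sub>2 < a\<^sub>1" using flow_init(3)[OF P.flow] \<open>\<not> a\<^sub>1 \<le> a\<^sub>2\<close> by auto
  \<comment> \<open>Determined by \<open>\<tau> powr \<mu> * a\<^sub>1 = a\<^sub>2\<close>, so that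
    both profiles start at the same height.\<close>
  define \<tau> where "\<tau> = (a\<^sub>2 / a\<^sub>1) powr (1 / \<mu>)"
  have "(a\<^sub>2 / a\<^sub>1) powr (1 / \<mu>) < 1 powr (1 / \<mu>)" using a \<mu>_pos by (intro powr_less_mono2) auto
  then have \<tau>: "0 < \<tau>" "\<tau> < 1" "\<tau> powr \<mu> = a\<^sub>2 / a\<^sub>1" using a \<mu>_pos by (auto simp: \<tau>_def powr_powr)
  \<comment> \<open>This scaling exponent of the flux preserves \<open>Y\<close>. It respects
    \<open>f' = - F powr m\<close> and the absorption; only \<open>D\<close> picks up a factor, the
    \<open>c\<close> below, which exceeds 1 since \<open>\<tau> < 1\<close> and
    \<open>2 * k < m + 1\<close>.\<close>
  define e where "e = 1 / (k - 1)"
  define c where "c = \<tau> powr (- ((m + 1 - 2 * k) / (k - 1)))"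
  have ex: "e * m = \<mu> + 1" "e * k = e + 1" "e + 1 = - ((m + 1 - 2 * k) / (k - 1)) + \<mu>"
  proof -
    have k1: "k - 1 \<noteq> 0" using k_gt_1 by simp
    show "e * m = \<mu> + 1" by (simp add: e_def \<mu>_def)
    show "e * k = e + 1" unfolding e_def using k1 by (simp add: divide_simps)
    show "e + 1 = - ((m + 1 - 2 * k) / (k - 1)) + \<mu>"
      unfolding e_def \<mu>_def using k1 by (simp add: divide_simps)
  qed
  have c: "1 < c"
  proof -
    have "1 powr (- ((m + 1 - 2 * k) / (k - 1))) < \<tau> powr (- ((m + 1 - 2 * k) / (k - 1)))"
      using \<tau> k_gt_1 k_lt by (intro powr_less_mono2_neg) auto
    then show ?thesis by (simp add: c_def)
  qed
  have c\<tau>: "\<tau> powr (e + 1) = c * \<tau> powr \<mu>" unfolding c_def ex(3) powr_add ..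
  define f F where "f r = \<tau> powr \<mu> * f\<^sub>1 (\<tau> * r)" and "F r = \<tau> powr e * F\<^sub>1 (\<tau> * r)" for r
  have F: "0 < F r" if "0 < r" for r using Q.F_pos[of "\<tau> * r"] that \<tau> by (simp add: F_def)
  have Fm: "F r powr m = \<tau> powr (\<mu> + 1) * F\<^sub>1 (\<tau> * r) powr m" if "0 < r" for r
    using Q.F_pos[of "\<tau> * r"] that \<tau> by (simp add: F_def powr_mult powr_powr ex)
  have Fk: "F r powr k = \<tau> powr (e + 1) * F\<^sub>1 (\<tau> * r) powr k" if "0 < r" for r
    using Q.F_pos[of "\<tau> * r"] that \<tau> by (simp add: F_def powr_mult powr_powr ex)
  have Dr: "\<alpha> * f r - \<beta> * r * F r powr m = \<tau> powr \<mu> * D f\<^sub>1 F\<^sub>1 (\<tau> * r)" if "0 < r" for r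
  proof -
    have "\<tau> powr (\<mu> + 1) = \<tau> powr \<mu> * \<tau>" using \<tau> by (simp add: powr_add)
    then show ?thesis unfolding Fm[OF that] using Q.F_pos[of "\<tau> * r"] that \<tau>
      by (simp add: D_def f_def spow_pos algebra_simps)
  qed
  note cont = flow_continuous_atLeast[OF Q.flow] flow_continuous_atLeast[OF P.flow]
  have deriv: "(f has_real_derivative - (F r powr m)) (at r)"
    "(F has_real_derivative c * (\<alpha> * f r - \<beta> * r * F r powr m) - F r powr k) (at r)" if r: "0 < r" for r
  proof -
    have s: "0 < \<tau> * r" "\<tau> * r < \<tau> * r + 1" using \<tau> r by auto
    have lin: "((\<lambda>r. \<tau> * r) has_real_derivative \<tau>) (at r)" using DERIV_cmult_Id by blast
    have "(f has_real_derivative \<tau> powr \<mu> * (- (F\<^sub>1 (\<tau> * r) powr m) * \<tau>)) (at r)"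
      unfolding f_def by (intro DERIV_cmult DERIV_chain2[OF flow_deriv(1)[OF Q.flow s] lin])
    then show "(f has_real_derivative - (F r powr m)) (at r)"
      by (rule DERIV_cong) (use \<tau> in \<open>simp add: Fm[OF r] powr_add\<close>)
    have "(F has_real_derivative \<tau> powr e * ((D f\<^sub>1 F\<^sub>1 (\<tau> * r) - F\<^sub>1 (\<tau> * r) powr k - d / (\<tau> * r) * F\<^sub>1 (\<tau> * r)) * \<tau>)) (at r)"
      unfolding F_def by (intro DERIV_cmult DERIV_chain2[OF flow_deriv(2)[OF Q.flow s] lin])
    moreover have "\<tau> powr e * ((D f\<^sub>1 F\<^sub>1 (\<tau> * r) - F\<^sub>1 (\<tau> * r) powr k - d / (\<tau> * r) * F\<^sub>1 (\<tau> * r)) * \<tau>)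
        = \<tau> powr (e + 1) * D f\<^sub>1 F\<^sub>1 (\<tau> * r) - \<tau> powr (e + 1) * F\<^sub>1 (\<tau> * r) powr k"
      using \<tau> by (simp add: d powr_add algebra_simps)
    ultimately show "(F has_real_derivative c * (\<alpha> * f r - \<beta> * r * F r powr m) - F r powr k) (at r)"
      unfolding Dr[OF r] Fk[OF r] c\<tau> by (simp add: mult.assoc)
  qed
  have scale: "filterlim (\<lambda>r. \<tau> * r) at_top at_top"
    using \<tau> by (intro filterlim_tendsto_pos_mult_at_top[OF tendsto_const] filterlim_ident)
  show False
  proof (rule flat_comparison[of \<alpha> \<beta> m k c f\<^sub>2 F\<^sub>2 f F a\<^sub>2])
    show "continuous_on {0..} f" "continuous_on {0..} F"
      unfolding f_def F_def using \<tau>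
      by (auto intro!: continuous_intros continuous_on_compose2[OF cont(1)] continuous_on_compose2[OF cont(2)])
    show "f 0 = a\<^sub>2" "F 0 = 0" using flow_init[OF Q.flow] a \<tau> by (auto simp: f_def F_def)
    show "(F\<^sub>2 has_real_derivative \<alpha> * f\<^sub>2 r - \<beta> * r * F\<^sub>2 r powr m - F\<^sub>2 r powr k) (at r)" if "0 < r" for r
      by (rule DERIV_cong[OF flow_deriv(2)[OF P.flow that, of "r + 1"]])
        (use P.F_pos[OF that] in \<open>simp_all add: d D_def spow_pos\<close>)
    show "(f\<^sub>2 has_real_derivative - (F\<^sub>2 r powr m)) (at r)" if "0 < r" for r
      by (rule flow_deriv(1)[OF P.flow that, of "r + 1"]) simp
    show "0 < \<alpha> * f r - \<beta> * r * F r powr m" if "0 < r" for r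
      unfolding Dr[OF that] using Q.D_pos[of "\<tau> * r"] \<tau>(1) that by simp
    show "(f \<longlongrightarrow> 0) at_top"
      unfolding f_def by (intro tendsto_mult_right_zero filterlim_compose[OF Q.f_tendsto_0 scale])
    show "(F \<longlongrightarrow> 0) at_top"
      unfolding F_def by (intro tendsto_mult_right_zero filterlim_compose[OF Q.F_tendsto_0 scale])
  qed (use \<alpha>_pos \<beta>_pos m_gt k_gt_1 c cont flow_init[OF P.flow] P.F_pos P.f_pos F deriv
      P.f_tendsto_0 P.absorption_dominates in auto)
qed

end

section \<open>The differential equation in its original form\<close>

lemma p_flux_spow: "p_flux p = spow (p - 1)"
  by (simp add: fun_eq_iff p_flux_def spow_def)

context profile_ode
begin

text \<open>Away from the centre this is a change of variables. At 0 the flux must still be C1: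
  \<open>F / r\<close> has the limit \<open>\<alpha> * a / (d + 1)\<close>, and by the equation
  \<open>F'\<close> has the same one.\<close>

lemma solution_on_of_flow:
  assumes par: "m = 1 / (p - 1)" "k = q / (p - 1)" "1 < p" "d = N - 1" "1 \<le> N" "\<alpha> = alpha p q" "\<beta> = beta p q"
    and a: "0 < a" and flow: "\<And>T. flow a T f F"
  shows "solution_on N p q a \<infinity> f"
proof -
  have I: "init_interval \<infinity> = {0..}" by (auto simp: init_interval_def)
  have dN: "real N - 1 = d" using par by simp
  note cf = flow_continuous_atLeast[OF flow]
  define f' where "f' r = - spow m (F r)" for r
  define H where "H r = D f F r - \<bar>F r\<bar> powr k" for r
  define F' where "F' r = (if r = 0 then \<alpha> * a / (d + 1) else H r - d * (F r / r))" for r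
  have F: "0 < F r" if "0 < r" for r using flow_pos[OF flow that, of "r + 1"] by simp
  have cs: "continuous_on {0..} (\<lambda>r. spow m (F r))"
    by (rule continuous_on_compose2[OF continuous_on_spow[OF m_gt(1)] cf(2)]) auto
  have cH: "continuous_on {0..} H"
    unfolding H_def using k_gt_1 by (intro continuous_intros continuous_D cf continuous_on_powr') auto
  have df: "(f has_real_derivative f' r) (at r)" if "0 < r" for r
    using flow_deriv(1)[OF flow that, of "r + 1"] F[OF that] by (simp add: f'_def spow_pos)
  have dF: "(F has_real_derivative F' r) (at r)" if "0 < r" for r
    by (rule DERIV_cong[OF flow_deriv(2)[OF flow that, of "r + 1"]])
      (use F[OF that] that in \<open>simp_all add: F'_def H_def\<close>)
  have f'0: "(f' \<longlongrightarrow> 0) (at_right 0)"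
  proof -
    have "continuous (at 0 within {0..}) f'"
      using continuous_on_minus[OF cs] by (simp add: f'_def[abs_def] continuous_on_eq_continuous_within)
    then show ?thesis
      using flow_init(2)[OF flow] by (simp add: continuous_within at_within_Ici_at_right f'_def)
  qed
  have F'0: "(F' \<longlongrightarrow> \<alpha> * a / (d + 1)) (at_right 0)"
  proof -
    have "(H \<longlongrightarrow> H 0) (at_right 0)"
      using cH by (auto simp: continuous_on_def at_within_Ici_at_right[symmetric])
    then have H: "(H \<longlongrightarrow> \<alpha> * a) (at_right 0)"
      using flow_DY_init[OF flow] flow_init(2)[OF flow] by (simp add: H_def)
    have "((\<lambda>r. F r / r) \<longlongrightarrow> \<alpha> * a / (real d + 1)) (at_right 0)"
    proof (rule ivp_flux_asymp)
      show "ivp d \<alpha> \<beta> (spow m) (\<lambda>x. \<bar>x\<bar> powr k) a 1 f F" using flow[of 1] by (simp add: flow_def sol_def)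
      show "continuous_on UNIV (\<lambda>x::real. \<bar>x\<bar> powr k)"
        using k_gt_1 by (intro continuous_on_powr' continuous_intros) auto
    qed (use continuous_on_spow[OF m_gt(1)] in auto)
    from tendsto_diff[OF H tendsto_mult[OF tendsto_const[of "real d"] this]]
    have t: "((\<lambda>r. H r - d * (F r / r)) \<longlongrightarrow> \<alpha> * a - d * (\<alpha> * a / (real d + 1))) (at_right 0)" .
    have eq: "\<alpha> * a - d * (\<alpha> * a / (real d + 1)) = \<alpha> * a / (d + 1)"
    proof -
      have "real d + 1 \<noteq> 0" by linarith
      then show ?thesis by (simp add: field_simps)
    qed
    have ev: "\<forall>\<^sub>F r in at_right 0. H r - d * (F r / r) = F' r"
      unfolding eventually_at_right_field by (intro exI[of _ 1]) (simp add: F'_def)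
    show ?thesis using Lim_transform_eventually[OF t ev] unfolding eq .
  qed
  have "continuous_on {0..} F'"
    unfolding continuous_on_def
  proof
    fix r :: real assume r: "r \<in> {0..}"
    show "(F' \<longlongrightarrow> F' r) (at r within {0..})"
    proof (cases "r = 0")
      case True
      then show ?thesis using F'0 by (simp add: at_within_Ici_at_right F'_def)
    next
      case False
      then have r0: "0 < r" using r by simp
      have "continuous_on {0<..} (\<lambda>r. H r - d * (F r / r))"
        by (intro continuous_intros continuous_on_subset[OF cH] continuous_on_subset[OF cf(2)]) auto
      then have "isCont (\<lambda>r. H r - d * (F r / r)) r" using r0 by (simp add: continuous_on_eq_continuous_at)
      then have "((\<lambda>r. H r - d * (F r / r)) \<longlongrightarrow> F' r) (at r)" using r0 by (simp add: isCont_def F'_def)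
      moreover have "\<forall>\<^sub>F s in at r. H s - d * (F s / s) = F' s"
      proof (rule eventually_mono)
        show "\<forall>\<^sub>F s in at r. s \<in> {0<..}" by (rule eventually_at_in_open') (use r0 in auto)
      qed (simp add: F'_def)
      ultimately have "(F' \<longlongrightarrow> F' r) (at r)" by (rule Lim_transform_eventually)
      then show ?thesis by (rule tendsto_within_subset) simp
    qed
  qed
  moreover have "(F has_real_derivative F' r) (at r within {0..})" if "0 \<le> r" for r
  proof (cases "r = 0")
    case True
    then show ?thesis using deriv_at_0_of_limit[OF cf(2) dF F'0] by (simp add: F'_def)
  next
    case False
    then show ?thesis using dF that has_field_derivative_at_within by (metis less_eq_real_def)
  qed
  moreover have flux: "p_flux p (f' r) = - F r" for r
  proof -
    have "(p - 1) * m = 1" using par by simp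
    then show ?thesis unfolding p_flux_spow f'_def spow_minus by (simp add: spow_inverse)
  qed
  ultimately have C2: "C1_with_deriv (\<lambda>r. p_flux p (f' r)) (\<lambda>r. - F' r) {0..}"
    unfolding C1_with_deriv_def flux by (auto intro!: DERIV_minus continuous_intros)
  have C1: "C1_with_deriv f f' {0..}"
    unfolding C1_with_deriv_def
  proof (intro conjI ballI)
    fix r :: real assume r: "r \<in> {0..}"
    show "(f has_real_derivative f' r) (at r within {0..})"
    proof (cases "r = 0")
      case True
      then show ?thesis using deriv_at_0_of_limit[OF cf(1) df f'0] flow_init(2)[OF flow] by (simp add: f'_def)
    next
      case False
      then have "0 < r" using r by simp
      then show ?thesis by (rule has_field_derivative_at_within[OF df])
    qed
  next
    show "continuous_on {0..} f'" unfolding f'_def by (intro continuous_intros cs)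
  qed
  have "- F' r + (real N - 1) / r * p_flux p (f' r) + alpha p q * f r + beta p q * r * f' r - \<bar>f' r\<bar> powr q = 0"
    if r: "0 < r" for r
  proof -
    have "\<bar>f' r\<bar> powr q = \<bar>F r\<bar> powr k" using par by (simp add: f'_def abs_spow powr_powr)
    then show ?thesis unfolding flux dN par(6,7)[symmetric] using r
      by (simp add: F'_def H_def D_def f'_def)
  qed
  then show ?thesis
    unfolding solution_on_def I using C1 C2 flow_init[OF flow]
    by (intro conjI exI[of _ f'] exI[of _ "\<lambda>r. - F' r"]) (auto simp: f'_def)
qed

text \<open>The converse change of variables, without any sign condition. Real radii
  \<open>T\<close> below \<open>S\<close> are used because \<open>S\<close> may be infinite;
  \<open>G\<close> does not depend on \<open>T\<close>.\<close>

lemma sol_of_solution_on: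
  assumes par: "m = 1 / (p - 1)" "k = q / (p - 1)" "1 < p" "d = N - 1" "1 \<le> N" "\<alpha> = alpha p q" "\<beta> = beta p q"
    and sol: "solution_on N p q a S g"
  shows "\<exists>G. \<forall>T. ereal T < S \<longrightarrow> sol a T g G"
proof -
  obtain g' \<Phi>' where
      C1: "C1_with_deriv g g' (init_interval S)" and C2: "C1_with_deriv (\<lambda>r. p_flux p (g' r)) \<Phi>' (init_interval S)"
    and ini: "g 0 = a" "g' 0 = 0"
    and eq: "\<And>r. 0 < r \<Longrightarrow> ereal r < S \<Longrightarrow> \<Phi>' r + (real N - 1) / r * p_flux p (g' r)
             + alpha p q * g r + beta p q * r * g' r - \<bar>g' r\<bar> powr q = 0"
    using sol unfolding solution_on_def by blast
  have dN: "real N - 1 = d" using par by simp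
  define G where "G r = - p_flux p (g' r)" for r
  have g': "g' r = - spow m (G r)" for r
  proof -
    have "m * (p - 1) = 1" using par by simp
    then show ?thesis by (simp add: G_def p_flux_spow spow_minus spow_inverse)
  qed
  have "sol a T g G" if T: "ereal T < S" for T
  proof -
    have less: "ereal r < S" if "r < T" for r using less_trans[of "ereal r" "ereal T" S] that T by simp
    then have sub: "{0..<T} \<subseteq> init_interval S" by (auto simp: init_interval_def)
    have at: "(h has_real_derivative h') (at r)"
      if "(h has_real_derivative h') (at r within init_interval S)" "0 < r" "r < T" for h h' r
    proof -
      have "at r within init_interval S = at r"
        by (rule at_within_open_subset[of r "{0<..<T}"]) (use that sub in auto)
      then show ?thesis using that by simp
    qed
    have cont: "continuous_on {0..<T} h" if "C1_with_deriv h h' (init_interval S)" for h h'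
    proof (rule continuous_on_subset[OF DERIV_continuous_on sub])
      show "(h has_real_derivative h' r) (at r within init_interval S)" if "r \<in> init_interval S" for r
        using \<open>C1_with_deriv h h' (init_interval S)\<close> that unfolding C1_with_deriv_def by blast
    qed
    have "(g has_real_derivative - spow m (G r)) (at r)"
      "(G has_real_derivative \<alpha> * g r - \<beta> * r * spow m (G r) - \<bar>G r\<bar> powr k - d / r * G r) (at r)"
      if r: "0 < r" "r < T" for r
    proof -
      have rS: "r \<in> init_interval S" "ereal r < S" using less[OF r(2)] r by (auto simp: init_interval_def)
      show "(g has_real_derivative - spow m (G r)) (at r)"
        using at[OF _ r] C1 rS(1) unfolding C1_with_deriv_def g'[symmetric] by blast
      have "((\<lambda>r. p_flux p (g' r)) has_real_derivative \<Phi>' r) (at r)"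
        using at[OF _ r] C2 rS(1) unfolding C1_with_deriv_def by blast
      then have "(G has_real_derivative - \<Phi>' r) (at r)" unfolding G_def by (rule DERIV_minus)
      moreover have pf: "p_flux p (g' r) = - G r" by (simp add: G_def)
      have aq: "\<bar>g' r\<bar> powr q = \<bar>G r\<bar> powr k"
        unfolding g' using par by (simp add: abs_spow powr_powr)
      have "- \<Phi>' r = \<alpha> * g r - \<beta> * r * spow m (G r) - \<bar>G r\<bar> powr k - d / r * G r"
        using eq[OF r(1) rS(2)] unfolding dN par(6,7)[symmetric] pf aq unfolding g'[of r]
        by (simp add: algebra_simps)
      ultimately show "(G has_real_derivative \<alpha> * g r - \<beta> * r * spow m (G r) - \<bar>G r\<bar> powr k - d / r * G r) (at r)"
        by simp
    qed
    moreover have "continuous_on {0..<T} g" "continuous_on {0..<T} G"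
      using cont[OF C1] continuous_on_minus[OF cont[OF C2]] by (simp_all add: G_def[abs_def])
    ultimately show ?thesis
      unfolding sol_def ivp_def using ini by (auto simp: G_def p_flux_spow)
  qed
  then show ?thesis by blast
qed

text \<open>On a compact interval reaching beyond \<open>r\<close> both fluxes are bounded by some
  \<open>M\<close>; there the truncation at \<open>M\<close> changes nothing, and its Lipschitz
  constant applies.\<close>

lemma sol_unique:
  assumes 1: "sol a T f F" and 2: "sol a T g G" and r: "0 \<le> r" "r < T"
  shows "f r = g r"
proof -
  define S where "S = (r + T) / 2"
  have S: "r < S" "S < T" using r by (auto simp: S_def)
  have "continuous_on {0..S} F" "continuous_on {0..S} G"
    using 1 2 S by (auto simp: sol_def ivp_def elim!: continuous_on_subset)
  then have "compact (F ` {0..S} \<union> G ` {0..S})" by (intro compact_Un compact_continuous_image) auto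
  then obtain M where M: "\<forall>x\<in>F ` {0..S} \<union> G ` {0..S}. norm x \<le> M"
    using compact_imp_bounded bounded_iff by metis
  have le: "\<bar>F s\<bar> \<le> M" "\<bar>G s\<bar> \<le> M" if "0 < s" "s < S" for s using M that by auto
  have M0: "0 \<le> M" using le(1)[of "S/2"] S r by auto
  note lip = trunc_nonlinearities[OF M0]
  have "f r = g r \<and> F r = G r"
  proof (rule ivp_unique[where f = f and F = F and g = g and G = G and r = r])
    show "ivp d \<alpha> \<beta> (spow m) (\<lambda>x. \<bar>x\<bar> powr k) a S f F" "ivp d \<alpha> \<beta> (spow m) (\<lambda>x. \<bar>x\<bar> powr k) a S g G"
      using 1 2 S by (auto simp: sol_def intro: ivp_restrict)
    show "0 \<le> m * M powr (m - 1) + k * M powr (k - 1)" by (rule lip(1))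
    fix s assume s: "0 < s" "s < S"
    show "\<bar>spow m (F s) - spow m (G s)\<bar> \<le> (m * M powr (m - 1) + k * M powr (k - 1)) * \<bar>F s - G s\<bar>"
      "\<bar>\<bar>F s\<bar> powr k - \<bar>G s\<bar> powr k\<bar> \<le> (m * M powr (m - 1) + k * M powr (k - 1)) * \<bar>F s - G s\<bar>"
      using lip(2,3)[of "F s" "G s"] le[OF s] by (simp_all add: trunc_at_eq)
  qed (use \<alpha>_pos \<beta>_pos r S in auto)
  then show ?thesis by simp
qed

lemma maximal_of_flow:
  assumes par: "m = 1 / (p - 1)" "k = q / (p - 1)" "1 < p" "d = N - 1" "1 \<le> N" "\<alpha> = alpha p q" "\<beta> = beta p q"
    and a: "0 < a" and flow: "\<And>T. flow a T f F"
  shows "maximal_solution N p q a \<infinity> f"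
  unfolding maximal_solution_def
proof (intro conjI allI impI ballI)
  show "solution_on N p q a \<infinity> f" by (rule solution_on_of_flow[OF par a flow])
  fix S :: ereal and g r
  show "S \<le> \<infinity>" by simp
  assume g: "solution_on N p q a S g" and r: "r \<in> init_interval S"
  obtain G where G: "\<And>T. ereal T < S \<Longrightarrow> sol a T g G" using sol_of_solution_on[OF par g] by blast
  obtain T where T: "r < T" "ereal T < S"
    using r ereal_dense2[of "ereal r" S] by (auto simp: init_interval_def)
  have "sol a T f F" using flow[of T] by (simp add: flow_def)
  then show "g r = f r" using sol_unique[OF _ G[OF T(2)], of f F r] T r by (auto simp: init_interval_def)
qed

lemma trapped_of_decay:
  assumes par: "m = 1 / (p - 1)" "k = q / (p - 1)" "1 < p" "d = N - 1" "1 \<le> N" "\<alpha> = alpha p q" "\<beta> = beta p q"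
    and \<mu>: "\<mu> = mu p q" and K: "K = K_star N p q"
    and a: "0 < a" and decay: "has_K_star_decay N p q a"
  shows "\<exists>f F. trapped_profile d m k \<beta> a f F"
proof -
  obtain f where f: "maximal_solution N p q a \<infinity> f" "\<forall>r>0. 0 < f r"
      "asymp_equiv f at_top (\<lambda>r. K_star N p q * r powr (- mu p q))"
    using decay unfolding has_K_star_decay_def by blast
  obtain F where F: "\<And>T. sol a T f F"
    using sol_of_solution_on[OF par, of a \<infinity> f] f(1) unfolding maximal_solution_def by auto
  \<comment> \<open>Positivity of the profile already forces a positive flux.\<close>
  have "0 < F r" if r: "0 < r" for r
  proof (rule ivp_flux_pos[where F = F and r = r])
    show "ivp d \<alpha> \<beta> (spow m) (\<lambda>x. \<bar>x\<bar> powr k) a (r + 1) f F" using F by (simp add: sol_def)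
    show "continuous_on UNIV (\<lambda>x::real. \<bar>x\<bar> powr k)"
      using k_gt_1 by (intro continuous_on_powr' continuous_intros) auto
  qed (use continuous_on_spow[OF m_gt(1)] \<alpha>_pos a r f(2) in auto)
  then have flow: "flow a T f F" for T using F a by (auto simp: flow_def)
  have K0: "0 < K" using \<kappa>_pos \<mu>_pos by (simp add: K_def)
  \<comment> \<open>\<open>asymp_equiv\<close> gives the quotient of 0 by 0 the value 1; as
    \<open>K > 0\<close>, that branch is not taken for positive \<open>r\<close>.\<close>
  have "((\<lambda>r. if f r = 0 \<and> K * r powr (- \<mu>) = 0 then 1 else f r / (K * r powr (- \<mu>))) \<longlongrightarrow> 1) at_top"
    using f(3) unfolding asymp_equiv_def K \<mu> .
  then have "((\<lambda>r. K * (if f r = 0 \<and> K * r powr (- \<mu>) = 0 then 1 else f r / (K * r powr (- \<mu>)))) \<longlongrightarrow> K * 1) at_top"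
    by (intro tendsto_intros)
  moreover have "\<forall>\<^sub>F r in at_top. K * (if f r = 0 \<and> K * r powr (- \<mu>) = 0 then 1 else f r / (K * r powr (- \<mu>)))
      = r powr \<mu> * f r"
    using eventually_gt_at_top[of 0]
    by (rule eventually_mono) (use K0 in \<open>simp add: powr_minus field_simps\<close>)
  ultimately have "((\<lambda>r. r powr \<mu> * f r) \<longlongrightarrow> K * 1) at_top" by (rule Lim_transform_eventually)
  then show ?thesis using trapped_of_limit[OF flow] by auto
qed

end

theorem theorem1p2:
  fixes N :: nat and p q :: real
  assumes "1 \<le> N"
    and "p_crit N < p" and "p < 2"
    and "p - 1 < q" and "q < p / 2"
  shows "\<exists>B. B \<noteq> {} \<and> B \<subseteq> {0<..} \<and> closedin (top_of_set {0<..}) B \<and>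
    (\<forall>a\<in>B. \<exists>f. maximal_solution N p q a \<infinity> f \<and> (\<forall>r>0. 0 < f r) \<and>
       (\<exists>A>0. \<exists>e \<in> o[at_top](\<lambda>r. r powr (- theta N p q)).
          \<forall>r>0. f r = r powr (- mu p q) * (K_star N p q - A * r powr (- theta N p q) + e r))) \<and>
    (N = 1 \<longrightarrow>
       (\<exists>!a. 0 < a \<and> has_K_star_decay 1 p q a) \<and>
       B = {THE a. 0 < a \<and> has_K_star_decay 1 p q a})"
proof -
  define m k d where "m = 1 / (p - 1)" and "k = q / (p - 1)" and "d = N - 1"
  have p_crit: "2 * real N < p * (real N + 1)" using assms(1,2) by (simp add: p_crit_def divide_less_eq)
  have "1 \<le> p_crit N" using assms(1) by (simp add: p_crit_def le_divide_eq)
  then have p1: "1 < p" using assms(2) by simp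
  have pos: "0 < q - p + 1" "0 < p - 2 * q" using assms by auto
  have km: "k - 1 = (q - p + 1) / (p - 1)" "m - 1 = (2 - p) / (p - 1)"
    using p1 by (simp_all add: k_def m_def field_simps)
  have dN: "real d = real N - 1" using assms(1) by (simp add: d_def)
  interpret profile_ode d m k "beta p q"
  proof
    show "1 < k" using km(1) pos(1) p1 by (smt (verit) divide_pos_pos)
    have "2 * q / (p - 1) < p / (p - 1)" using p1 pos by (intro divide_strict_right_mono) auto
    moreover have "m + 1 = p / (p - 1)" using p1 by (simp add: m_def field_simps)
    ultimately show "2 * k < m + 1" by (simp add: k_def)
    \<comment> \<open>\<open>p > p_crit N\<close> cleared of denominators.\<close>
    have "(real N - 1) * (2 - p) < 2 * (p - 1)" using p_crit by (simp add: algebra_simps)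
    then show "real d * (m - 1) < 2" unfolding dN km using p1 by (simp add: divide_less_eq)
    show "0 < beta p q" using pos by (simp add: beta_def)
  qed
  have mk: "m / (k - 1) = 1 / (q - p + 1)" "1 / (k - 1) = (p - 1) / (q - p + 1)"
    unfolding km m_def using p1 by auto
  have \<mu>: "\<mu> = mu p q" unfolding \<mu>_def mk mu_def using pos by (simp add: field_simps)
  have \<alpha>: "\<alpha> = alpha p q" unfolding \<alpha>_def \<mu> using pos by (simp add: mu_def alpha_def beta_def)
  have \<mu>1: "\<mu> + 1 = 1 / (q - p + 1)" by (simp add: \<mu>_def mk)
  have \<kappa>: "\<kappa> = (p - 1) * (\<mu> + 1) - real N + 1" unfolding \<kappa>_def mk dN \<mu>1 by simp
  have K: "K = K_star N p q" unfolding K_def K_star_def \<mu>[symmetric] \<kappa>[symmetric] unfolding \<mu>1 by simp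
  have \<theta>: "\<theta> = theta N p q"
  proof -
    have "\<theta> = 1 - (k - 1) * (real N - 1)" using k_gt_1 by (simp add: \<theta>_def \<kappa>_def dN right_diff_distrib)
    then show ?thesis unfolding km theta_def using p1 by (simp add: field_simps)
  qed
  note par = m_def k_def p1 d_def assms(1) \<alpha> refl
  obtain a f F where tr: "trapped_profile d m k (beta p q) a f F" using ex_trapped by blast
  interpret P: trapped_profile d m k "beta p q" a f F by (rule tr)
  have a: "0 < a" by (rule flow_init(3)[OF P.flow])
  have maximal: "maximal_solution N p q a \<infinity> f" by (rule maximal_of_flow[OF par a P.flow])
  obtain A where A: "0 < A" "((\<lambda>r. (r powr \<mu> * f r - K) * r powr \<theta>) \<longlongrightarrow> - A) at_top"
    using P.asymptotics by blast
  \<comment> \<open>The remainder is defined by the expansion itself, which then holds for all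
    positive \<open>r\<close>; only its size has to be shown.\<close>
  define e where "e r = r powr \<mu> * f r - K + A * r powr (- \<theta>)" for r
  have e: "e \<in> o[at_top](\<lambda>r. r powr (- \<theta>))"
  proof (rule smalloI_tendsto)
    have "((\<lambda>r. (r powr \<mu> * f r - K) * r powr \<theta> + A) \<longlongrightarrow> - A + A) at_top" by (intro tendsto_intros A)
    moreover have "\<forall>\<^sub>F r in at_top. (r powr \<mu> * f r - K) * r powr \<theta> + A = e r / r powr (- \<theta>)"
      using eventually_gt_at_top[of 0]
      by (rule eventually_mono) (simp add: e_def powr_minus field_simps)
    ultimately have "((\<lambda>r. e r / r powr (- \<theta>)) \<longlongrightarrow> - A + A) at_top" by (rule Lim_transform_eventually)
    then show "((\<lambda>r. e r / r powr (- \<theta>)) \<longlongrightarrow> 0) at_top" by simp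
    show "\<forall>\<^sub>F r in at_top. r powr (- \<theta>) \<noteq> 0"
      using eventually_gt_at_top[of 0] by (rule eventually_mono) simp
  qed
  have f_eq: "f r = r powr (- \<mu>) * (K - A * r powr (- \<theta>) + e r)" if "0 < r" for r
    using that by (simp add: e_def mult.assoc[symmetric] powr_add[symmetric])
  have decay: "has_K_star_decay N p q a"
    unfolding has_K_star_decay_def K[symmetric] \<mu>[symmetric]
  proof (intro exI[of _ f] conjI allI impI)
    show "maximal_solution N p q a \<infinity> f" by (rule maximal)
    show "0 < f r" if "0 < r" for r by (rule P.f_pos[OF that])
    have K0: "0 < K" using \<kappa>_pos \<mu>_pos by (simp add: K_def)
    have "((\<lambda>r. r powr \<mu> * f r / K) \<longlongrightarrow> K / K) at_top"
      by (intro tendsto_intros P.scaled_tendsto_K) (use K0 in simp)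
    then have "((\<lambda>r. r powr \<mu> * f r / K) \<longlongrightarrow> 1) at_top" using K0 by simp
    moreover have "\<forall>\<^sub>F r in at_top. r powr \<mu> * f r / K
        = (if f r = 0 \<and> K * r powr (- \<mu>) = 0 then 1 else f r / (K * r powr (- \<mu>)))"
      using eventually_gt_at_top[of 0]
      by (rule eventually_mono) (use K0 in \<open>simp add: powr_minus field_simps\<close>)
    ultimately show "asymp_equiv f at_top (\<lambda>r. K * r powr (- \<mu>))"
      unfolding asymp_equiv_def by (rule Lim_transform_eventually)
  qed
  have unique: "b = a" if N1: "N = 1" and b: "0 < b" "has_K_star_decay N p q b" for b
  proof -
    obtain g G where "trapped_profile d m k (beta p q) b g G"
      using trapped_of_decay[OF par \<mu> K b] by blast
    \<comment> \<open>\<open>trapped_unique\<close> gives one inequality, so it is used in both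
      orders.\<close>
    then show ?thesis using trapped_unique[of a f F b g G] trapped_unique[of b g G a f F] tr N1
      by (simp add: d_def)
  qed
  show ?thesis
  proof (intro exI[of _ "{a}"] conjI ballI impI)
    show "closedin (top_of_set {0<..}) {a}" using a by (intro closed_subset) auto
    fix b assume "b \<in> {a}"
    then show "\<exists>f. maximal_solution N p q b \<infinity> f \<and> (\<forall>r>0. 0 < f r) \<and>
       (\<exists>A>0. \<exists>e \<in> o[at_top](\<lambda>r. r powr (- theta N p q)).
          \<forall>r>0. f r = r powr (- mu p q) * (K_star N p q - A * r powr (- theta N p q) + e r))"
      using maximal P.f_pos A(1) e f_eq unfolding \<mu> K \<theta> by blast
  next
    assume N1: "N = 1"
    have 1: "0 < a \<and> has_K_star_decay 1 p q a" using a decay N1 by simp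
    have 2: "b = a" if "0 < b \<and> has_K_star_decay 1 p q b" for b using unique[OF N1] that N1 by simp
    show "\<exists>!a. 0 < a \<and> has_K_star_decay 1 p q a" using 1 2 by (rule ex1I)
    have "(THE a. 0 < a \<and> has_K_star_decay 1 p q a) = a" using 1 2 by (rule the_equality)
    then show "{a} = {THE a. 0 < a \<and> has_K_star_decay 1 p q a}" by simp
  qed (use a in auto)
qed

end
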